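(* Let $\rho\geq2$ be an integer and let $U\in C^\infty(\mathbb{T})$ with $U(0)=0$ and $D(U)<1$. Let $V(x)=\sum_{n=0}^\infty U(x/\rho^n)$ be the corresponding self-similar potential, and let $\tau(0,r)$ be the exit time from $(-r,r)$ of the solution $y_t$ of $dy_t=d\omega_t-\nabla V(y_t)\,dt$, $y_0=0$. Then for $r>1$ $$\mathbb{E}_0[\tau(0,r)]=r^{2+\nu(r)}$$ with $$\nu(r)=\frac{\mathcal{P}_\rho(2U)+\mathcal{P}_\rho(-2U)}{\ln\rho}+\epsilon(r),$$ where $\epsilon(r)\to0$ as $r\to\infty$.
   Context: $\mathbb{T}=\mathbb{R}/\mathbb{Z}$; functions on $\mathbb{T}$ are identified with 1-periodic functions on $\mathbb{R}$; $\omega$ is a standard one-dimensional Brownian motion and $\mathbb{E}_0$ is expectation for the process started at $0$. $D(U)=\big(\int_{\mathbb{T}}e^{2U(x)}dx\int_{\mathbb{T}}e^{-2U(x)}dx\big)^{-1}$. Pressure: for an integer $R\ge2$, let $B=\{0,\dots,R-1\}$ and let $s_R$ be the left shift on $B^{\mathbb{N}^*}$ ($\mathbb{N}^*=\{1,2,\dots\}$), which codes the map $x\mapsto Rx$ on $\mathbb{T}$ via the base-$R$ expansion $x=\sum_{k\ge1}x^k/R^k$. For continuous $f$ on $\mathbb{T}$, viewed through this coding as a function on $B^{\mathbb{N}^*}$, $$\mathcal{P}_R(f)=\sup_P\Big\{\int f\,dP-I^{(3)}_\mu(P)\Big\},$$ the supremum being over shift-invariant Borel probability measures $P$ on $B^{\mathbb{N}^*}$,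 where $\mu$ is the uniform probability measure on $B$ and $I^{(3)}_\mu$ is the level-3 large deviation entropy function (specific relative entropy of $P$ with respect to the product measure $\mu^{\otimes\mathbb{N}^*}$), i.e. $I^{(3)}_\mu(P)=\ln R-h_P(s_R)$ with $h_P(s_R)$ the Kolmogorov–Sinai entropy. Thus $\mathcal{P}_R(f)$ is the usual topological pressure of $f$ for $x\mapsto Rx$ minus $\ln R$, and $\mathcal{P}_R(0)=0$. *)

theory Defs
  imports "HOL-Probability.Probability"
begin

section \<open>Functions on the torus and the self-similar potential\<close>

text \<open>\<open>f \<in> C\<^sup>\<infinity>(\<real>/\<int>)\<close>, as a smooth 1-periodic function on the line.\<close>

definition smooth_torus :: "(real \<Rightarrow> real) \<Rightarrow> bool" where
  "smooth_torus f \<longleftrightarrow>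
     (\<forall>x. f (x + 1) = f x) \<and> (\<forall>n x. (deriv ^^ n) f differentiable (at x))"

definition torus_D :: "(real \<Rightarrow> real) \<Rightarrow> real" where
  "torus_D U =
     inverse (integral {0..1} (\<lambda>x. exp (2 * U x)) * integral {0..1} (\<lambda>x. exp (- 2 * U x)))"

definition self_similar_potential :: "nat \<Rightarrow> (real \<Rightarrow> real) \<Rightarrow> real \<Rightarrow> real" where
  "self_similar_potential \<rho> U x = (\<Sum>n. U (x / real \<rho> ^ n))"


section \<open>Brownian motion, diffusions with unit noise, exit times\<close>

text \<open>Processes are indexed by \<open>real\<close>; only times \<open>t \<ge> 0\<close> are relevant.\<close>

definition brownian_motion :: "'w measure \<Rightarrow> (real \<Rightarrow> 'w \<Rightarrow> real) \<Rightarrow> bool" where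
  "brownian_motion M W \<longleftrightarrow>
     prob_space M \<and>
     (\<forall>t\<ge>0. W t \<in> borel_measurable M) \<and>
     (AE w in M. W 0 w = 0) \<and>
     (\<forall>s t. 0 \<le> s \<and> s < t \<longrightarrow>
        distributed M lborel (\<lambda>w. W t w - W s w) (normal_density 0 (sqrt (t - s)))) \<and>
     (\<forall>n (t :: nat \<Rightarrow> real). 0 \<le> t 0 \<and> strict_mono t \<longrightarrow>
        prob_space.indep_vars M (\<lambda>_. borel) (\<lambda>i w. W (t (Suc i)) w - W (t i) w) {..<n}) \<and>
     (AE w in M. continuous_on {0..} (\<lambda>t. W t w))"

text \<open>
  \<open>Y\<close> solves \<open>dY\<^sub>t = dW\<^sub>t + b(Y\<^sub>t) dt\<close>, \<open>Y\<^sub>0 = x\<^sub>0\<close>.  Because the noise is additive, the integrated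
  equation contains no stochastic integral and is read path by path.  Adaptedness of \<open>Y\<close> is not
  demanded: for Lipschitz \<open>b\<close> it follows from pathwise uniqueness.
\<close>

definition sde_solution ::
  "'w measure \<Rightarrow> (real \<Rightarrow> 'w \<Rightarrow> real) \<Rightarrow> (real \<Rightarrow> real) \<Rightarrow> real \<Rightarrow> (real \<Rightarrow> 'w \<Rightarrow> real) \<Rightarrow> bool"
where
  "sde_solution M W b x\<^sub>0 Y \<longleftrightarrow>
     (\<forall>t\<ge>0. Y t \<in> borel_measurable M) \<and>
     (AE w in M. continuous_on {0..} (\<lambda>t. Y t w) \<and> Y 0 w = x\<^sub>0 \<and>
        (\<forall>t\<ge>0. Y t w = x\<^sub>0 + W t w + integral {0..t} (\<lambda>s. b (Y s w))))"

text \<open>The value is \<open>\<infinity>\<close> if the path never leaves \<open>D\<close>.\<close>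

definition exit_time :: "(real \<Rightarrow> 'w \<Rightarrow> real) \<Rightarrow> real set \<Rightarrow> 'w \<Rightarrow> ennreal" where
  "exit_time Y D w = Inf {ennreal t | t. 0 \<le> t \<and> Y t w \<notin> D}"


section \<open>Level-3 entropy and pressure\<close>

text \<open>
  Sequences \<open>(x\<^sup>k)\<close>, \<open>k \<ge> 1\<close>, are encoded as functions on \<open>nat\<close>, with \<open>x k\<close> standing for the
  \<open>(k+1)\<close>-st entry.  The \<open>\<sigma>\<close>-algebra of the countable product of a finite discrete
  space is its Borel \<open>\<sigma>\<close>-algebra.
\<close>

definition digit_measure :: "nat \<Rightarrow> nat measure" where
  "digit_measure R = uniform_count_measure {..<R}"

definition shift :: "(nat \<Rightarrow> 'b) \<Rightarrow> nat \<Rightarrow> 'b" where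
  "shift x = (\<lambda>k. x (Suc k))"

definition shift_invariant_probs :: "'b measure \<Rightarrow> (nat \<Rightarrow> 'b) measure set" where
  "shift_invariant_probs \<mu> =
     {P. prob_space P \<and> sets P = sets (\<Pi>\<^sub>M k\<in>UNIV. \<mu>) \<and> distr P P shift = P}"

text \<open>
  Specific relative entropy of \<open>P\<close> with respect to the product of copies of \<open>\<mu>\<close>: the limit of the
  relative entropies per symbol of the \<open>n\<close>-symbol marginals, in natural logarithm.  The limit
  exists for shift-invariant \<open>P\<close> and finite alphabets, by subadditivity of block entropies.
  In the library's \<open>KL_divergence\<close> the reference measure comes first.
\<close>

definition level3_entropy :: "'b measure \<Rightarrow> (nat \<Rightarrow> 'b) measure \<Rightarrow> real" where
  "level3_entropy \<mu> P =
     lim (\<lambda>n. KL_divergence (exp 1)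
                (\<Pi>\<^sub>M k\<in>{..<n}. \<mu>)
                (distr P (\<Pi>\<^sub>M k\<in>{..<n}. \<mu>) (\<lambda>x. restrict x {..<n})) / real n)"

definition expansion :: "nat \<Rightarrow> (nat \<Rightarrow> nat) \<Rightarrow> real" where
  "expansion R x = (\<Sum>k. real (x k) / real R ^ Suc k)"

definition pressure :: "nat \<Rightarrow> (real \<Rightarrow> real) \<Rightarrow> real" where
  "pressure R f =
     (SUP P \<in> shift_invariant_probs (digit_measure R).
        (\<integral>x. f (expansion R x) \<partial>P) - level3_entropy (digit_measure R) P)"

end

theory Submission
  imports Defs
begin

text \<open>
  The expected exit time is comparable to the solution of \<open>f''/2 - V' f' = -1\<close>, namely a constant
  minus \<open>q(x) = \<integral>\<^sub>0\<^sup>x e\<^bsup>2V(u)\<^esup> \<integral>\<^sub>0\<^sup>u 2e\<^bsup>-2V(v)\<^esup> dv du\<close>.  Since the noise is additive, the path is a pathwise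
  limit of Euler chains driven by Gaussian increments; a one-step Taylor estimate for the chain and
  Fatou's lemma replace the Ito formula, and give
  \<open>min (q (\<plusminus>r')) \<le> E \<tau>(0,r) \<le> max (q (\<plusminus>(r+2)))\<close> for \<open>r' < r\<close>.

  By \<open>V(\<rho>x) = U(\<rho>x) + V(x)\<close>, the integrals of \<open>e\<^bsup>\<plusminus>2V\<^esup>\<close> over \<open>[0, \<rho>\<^sup>N]\<close> are, up to constant factors,
  sums of \<open>e\<^bsup>\<plusminus>2 S\<^sub>N U\<^esup>\<close> over the words of length \<open>N\<close>, with \<open>S\<^sub>N\<close> the Birkhoff sums of \<open>x \<mapsto> \<rho>x\<close>.  The
  variational principle identifies their exponential growth rate with the pressure: Gibbs'
  inequality bounds the free energy of every invariant measure, and a measure made of independent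
  \<open>N\<close>-blocks with weights \<open>e\<^bsup>S\<^sub>N f\<^esup>\<close>, averaged over \<open>N\<close> shifts, attains the bound up to \<open>O(1/N)\<close>.
\<close>

section \<open>Words, Gibbs' inequality and superadditive sequences\<close>

text \<open>Every comparison loses a constant, never a factor that grows with the scale. If f has
  Lipschitz constant L, its Birkhoff sums over a cell of level n stay within L of a value depending
  only on the word of the cell, because the cells met along the orbit have lengths R^(-(n-j)), which
  sum to at most 1. Hence n times the pressure is the logarithm of the normalised partition sum up
  to L, for every n > 0. Distances are taken on the real line, so the point 1, reached by the digits
  R - 1, is treated like any other.

  The normalisation by R^n, which matches the subtraction of ln R in the pressure, is the origin of
  the exponent 2: an integral over [0, \<rho>^N] carries a factor \<rho>^N, once for the scale
  function and once for the speed function. The iterated integral q is not their product but is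
  enclosed between two such products. So q grows like exp(N \<gamma>) up to constant factors, with
  \<gamma> = 2 ln \<rho> + P(2U) + P(-2U), and \<epsilon> r is of order 1 / ln r.\<close>

definition words :: "nat \<Rightarrow> nat \<Rightarrow> nat list set" where
  "words R n = {w. set w \<subseteq> {..<R} \<and> length w = n}"

lemma finite_words [simp]: "finite (words R n)"
  unfolding words_def by (simp add: finite_lists_length_eq)

lemma card_words: "card (words R n) = R ^ n"
  unfolding words_def by (simp add: card_lists_length_eq)

lemma words_length: "w \<in> words R n \<Longrightarrow> length w = n"
  by (simp add: words_def)

lemma words_nth: "w \<in> words R n \<Longrightarrow> i < n \<Longrightarrow> w ! i < R"
  by (auto simp: words_def subset_iff)

lemma words_0 [simp]: "words R 0 = {[]}"
  by (auto simp: words_def)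

lemma words_append: "words R (m + n) = (\<lambda>(u, v). u @ v) ` (words R m \<times> words R n)"
proof (intro equalityI subsetI)
  fix w assume w: "w \<in> words R (m + n)"
  have "take m w \<in> words R m" "drop m w \<in> words R n"
    using w set_take_subset[of m w] set_drop_subset[of m w] by (auto simp: words_def)
  moreover have "w = take m w @ drop m w" by simp
  ultimately show "w \<in> (\<lambda>(u, v). u @ v) ` (words R m \<times> words R n)"
    by (metis (mono_tags, lifting) SigmaI case_prod_conv image_eqI)
qed (auto simp: words_def)

lemma sum_words_append:
  fixes g :: "nat list \<Rightarrow> 'a::comm_monoid_add"
  shows "(\<Sum>w\<in>words R (m + n). g w) = (\<Sum>u\<in>words R m. \<Sum>v\<in>words R n. g (u @ v))"
proof -
  have "inj_on (\<lambda>(u, v). u @ v) (words R m \<times> words R n)"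
    by (auto simp: inj_on_def words_def)
  then show ?thesis
    unfolding words_append by (subst sum.reindex) (simp_all add: sum.cartesian_product case_prod_unfold)
qed

lemma words_1: "words R (Suc 0) = (\<lambda>c. [c]) ` {..<R}"
  by (auto simp: words_def length_Suc_conv)

text \<open>Nonnegativity of relative entropy, by ln t \<le> t - 1 at t = q a / p a. It is applied
  with q uniform, a product of marginals, the Gibbs weights, and an average of laws. Terms with p a
  = 0 vanish by themselves; \<open>ac\<close> excludes p a > 0 where q a = 0.\<close>

lemma gibbs_inequality:
  fixes p q :: "'b \<Rightarrow> real"
  assumes "finite S" and p: "\<And>a. a \<in> S \<Longrightarrow> 0 \<le> p a" and q: "\<And>a. a \<in> S \<Longrightarrow> 0 \<le> q a"
    and ac: "\<And>a. a \<in> S \<Longrightarrow> q a = 0 \<Longrightarrow> p a = 0"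
    and "sum q S \<le> sum p S"
  shows "(\<Sum>a\<in>S. p a * ln (q a)) \<le> (\<Sum>a\<in>S. p a * ln (p a))"
proof -
  have "p a * ln (q a) - p a * ln (p a) \<le> q a - p a" if a: "a \<in> S" for a
  proof (cases "p a = 0")
    case False
    then have pos: "p a > 0" "q a > 0"
      using p[OF a] q[OF a] ac[OF a] by (auto simp: less_le)
    have "p a * ln (q a) - p a * ln (p a) = p a * ln (q a / p a)"
      using pos by (simp add: ln_div algebra_simps)
    also have "\<dots> \<le> p a * (q a / p a - 1)"
      using pos by (intro mult_left_mono ln_le_minus_one) auto
    also have "\<dots> = q a - p a" using pos by (simp add: field_simps)
    finally show ?thesis .
  qed (use q[OF a] in simp)
  then have "(\<Sum>a\<in>S. p a * ln (q a) - p a * ln (p a)) \<le> (\<Sum>a\<in>S. q a - p a)"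
    by (rule sum_mono)
  then show ?thesis using assms(5) by (simp add: sum_subtractf)
qed

text \<open>The limit is the supremum over n > 0. Convergence gives a meaning to the
  \<open>lim\<close> in the definition of the entropy; the bound at each n is what the estimates at
  fixed n use.\<close>

lemma fekete_superadditive:
  fixes a :: "nat \<Rightarrow> real"
  assumes super: "\<And>m n. a m + a n \<le> a (m + n)" and nn: "\<And>n. 0 \<le> a n"
    and bound: "\<And>n. a n \<le> real n * C"
  shows "\<exists>L. (\<lambda>n. a n / real n) \<longlonglongrightarrow> L \<and> (\<forall>n>0. a n / real n \<le> L)"
proof -
  define L where "L = (SUP n\<in>{0<..}. a n / real n)"
  have le_C: "a n / real n \<le> C" if "n > 0" for n
    using bound[of n] that by (simp add: field_simps)
  then have bdd: "bdd_above ((\<lambda>n. a n / real n) ` {0<..})"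
    by (intro bdd_aboveI2[of _ _ C]) auto
  have upper: "a n / real n \<le> L" if "n > 0" for n
    unfolding L_def using that bdd by (intro cSUP_upper) auto
  have mult: "real q * a k \<le> a (q * k)" for q k
  proof (induction q)
    case 0 show ?case using nn[of 0] by simp
  next
    case (Suc q)
    then show ?case using super[of k "q * k"] by (simp add: algebra_simps)
  qed
  \<comment> \<open>Divide n by k with remainder and drop the remainder term, which is nonnegative.
    The loss a k / n tends to 0 for fixed k.\<close>
  have lower: "a k / real k - a k / real n \<le> a n / real n" if "k > 0" "n > 0" for k n
  proof -
    have "real n \<le> real k * (real (n div k) + 1)"
    proof -
      have "n = k * (n div k) + n mod k" by simp
      also have "\<dots> \<le> k * (n div k) + k" using that by (intro add_left_mono less_imp_le mod_less_divisor)
      finally have "real n \<le> real (k * (n div k) + k)" by linarith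
      then show ?thesis by (simp add: algebra_simps)
    qed
    then have "real n / real k - 1 \<le> real (n div k)" using that by (simp add: field_simps)
    then have "(real n / real k - 1) * a k \<le> real (n div k) * a k"
      using nn by (intro mult_right_mono) auto
    also have "\<dots> \<le> a (n div k * k)" by (rule mult)
    also have "\<dots> \<le> a (n div k * k) + a (n mod k)" using nn by simp
    also have "\<dots> \<le> a n" using super[of "n div k * k" "n mod k"] by simp
    finally have "(real n / real k - 1) * a k / real n \<le> a n / real n"
      by (rule divide_right_mono) simp
    then show ?thesis using that by (simp add: left_diff_distrib diff_divide_distrib)
  qed
  have "(\<lambda>n. a n / real n) \<longlonglongrightarrow> L"
  proof (rule order_tendstoI)
    fix x assume "x < L"
    then obtain k where k: "k > 0" "x < a k / real k"
      unfolding L_def using less_cSUP_iff[OF _ bdd] by auto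
    have "(\<lambda>n. a k / real k - a k / real n) \<longlonglongrightarrow> a k / real k - 0"
      by (intro tendsto_intros lim_const_over_n)
    then have "eventually (\<lambda>n. x < a k / real k - a k / real n) sequentially"
      using k by (auto dest: order_tendstoD)
    then show "eventually (\<lambda>n. x < a n / real n) sequentially"
      using eventually_gt_at_top[of 0]
      by eventually_elim (use lower[OF k(1)] in \<open>meson less_le_trans\<close>)
  next
    fix x assume "L < x"
    then show "eventually (\<lambda>n. a n / real n < x) sequentially"
      by (intro eventually_mono[OF eventually_gt_at_top[of 0]] le_less_trans[OF upper])
  qed
  with upper show ?thesis by auto
qed

section \<open>Block entropies of digit processes\<close>

text \<open>Shift invariance is left to a later locale: the concatenation of independent blocks is
  invariant only under an n-fold shift, so probabilities and entropies of windows carry a starting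
  position.\<close>

locale digit_process = prob_space P for P :: "(nat \<Rightarrow> nat) measure" +
  fixes R :: nat
  assumes sets_P: "sets P = sets (\<Pi>\<^sub>M k\<in>UNIV. digit_measure R)" and R_pos: "R > 0"
begin

definition win :: "nat \<Rightarrow> nat list \<Rightarrow> real" where
  "win j w = prob {x \<in> space P. map x [j..<j + length w] = w}"

lemma space_P: "space P = UNIV \<rightarrow> {..<R}"
proof -
  have "space P = space (\<Pi>\<^sub>M k\<in>UNIV. digit_measure R)"
    using sets_P by (rule sets_eq_imp_space_eq)
  then show ?thesis by (auto simp: space_PiM digit_measure_def space_uniform_count_measure)
qed

lemma digit_less: "x \<in> space P \<Longrightarrow> x k < R"
  by (auto simp: space_P)

lemma measurable_digit [measurable]: "(\<lambda>x. x k) \<in> measurable P (count_space UNIV)"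
proof -
  have "(\<lambda>x. x k) \<in> measurable (\<Pi>\<^sub>M k\<in>UNIV. digit_measure R) (digit_measure R)"
    by measurable
  moreover have "(\<lambda>c. c) \<in> measurable (digit_measure R) (count_space UNIV)"
    by (auto simp: measurable_def digit_measure_def)
  ultimately have "(\<lambda>x. x k) \<in> measurable (\<Pi>\<^sub>M k\<in>UNIV. digit_measure R) (count_space UNIV)"
    by (rule measurable_compose)
  then show ?thesis by (subst measurable_cong_sets[OF sets_P refl])
qed

lemma map_eq_iff_nth: "map x [j..<j + length w] = w \<longleftrightarrow> (\<forall>i<length w. x (j + i) = w ! i)"
  unfolding list_eq_iff_nth_eq by auto

lemma win_sets [measurable]: "{x \<in> space P. map x [j..<j + length w] = w} \<in> sets P"
  unfolding map_eq_iff_nth by measurable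

lemma window_in_words: "x \<in> space P \<Longrightarrow> map x [j..<j + n] \<in> words R n"
  by (auto simp: words_def digit_less)

lemma win_nonneg [simp]: "0 \<le> win j w"
  by (simp add: win_def)

lemma win_le_1: "win j w \<le> 1"
  by (simp add: win_def)

text \<open>A function of finitely many digits is a finite combination of indicators, so its
  integral becomes a sum over words.\<close>

lemma window_integral:
  fixes c :: "nat list \<Rightarrow> real"
  shows "integrable P (\<lambda>x. c (map x [j..<j + n]))" (is "integrable P ?f")
    and "(\<integral>x. c (map x [j..<j + n]) \<partial>P) = (\<Sum>w\<in>words R n. win j w * c w)"
proof -
  let ?A = "\<lambda>w. {x \<in> space P. map x [j..<j + n] = w}"
  have A: "?A w \<in> sets P" if "w \<in> words R n" for w
    using win_sets[of j w] words_length[OF that] by simp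
  have eq: "?f x = (\<Sum>w\<in>words R n. c w * indicator (?A w) x)" if "x \<in> space P" for x
  proof -
    have "(\<Sum>w\<in>words R n. c w * indicator (?A w) x)
        = (\<Sum>w\<in>words R n. if w = map x [j..<j + n] then c w else 0)"
      using that by (intro sum.cong) (auto simp: indicator_def)
    also have "\<dots> = ?f x" using window_in_words[OF that, of j n] by (simp add: sum.delta)
    finally show ?thesis ..
  qed
  have i: "integrable P (\<lambda>x. c w * indicator (?A w) x)" if "w \<in> words R n" for w
    using A[OF that] by (intro integrable_mult_right integrable_real_indicator) (auto simp: emeasure_eq_measure)
  show "integrable P ?f"
    by (subst Bochner_Integration.integrable_cong[OF refl eq], assumption,
        rule Bochner_Integration.integrable_sum, rule i)
  have "(\<integral>x. ?f x \<partial>P) = (\<integral>x. (\<Sum>w\<in>words R n. c w * indicator (?A w) x) \<partial>P)"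
    by (rule Bochner_Integration.integral_cong[OF refl eq])
  also have "\<dots> = (\<Sum>w\<in>words R n. c w * measure P (?A w))"
    using i A by (subst Bochner_Integration.integral_sum) auto
  also have "\<dots> = (\<Sum>w\<in>words R n. win j w * c w)"
    by (intro sum.cong) (auto simp: win_def words_length)
  finally show "(\<integral>x. ?f x \<partial>P) = (\<Sum>w\<in>words R n. win j w * c w)" .
qed

lemma sum_win: "(\<Sum>w\<in>words R n. win j w) = 1"
  using window_integral(2)[of "\<lambda>_. 1" j n] by (simp add: prob_space)

lemma win_eq_integral: "win j w = (\<integral>x. (if map x [j..<j + length w] = w then 1 else 0) \<partial>P)"
proof -
  have "win j w = (\<integral>x. indicator {x \<in> space P. map x [j..<j + length w] = w} x \<partial>P)"
    by (simp add: win_def)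
  also have "\<dots> = (\<integral>x. (if map x [j..<j + length w] = w then 1 else 0) \<partial>P)"
    by (intro Bochner_Integration.integral_cong) auto
  finally show ?thesis .
qed

text \<open>This and its left counterpart integrate a test on a prefix or a suffix of the window of
  length m + n; a suffix starts m positions later.\<close>

lemma sum_win_append_right:
  assumes "u \<in> words R m"
  shows "(\<Sum>v\<in>words R n. win j (u @ v)) = win j u"
proof -
  have "win j u = (\<integral>x. (if take m (map x [j..<j + (m + n)]) = u then 1 else 0) \<partial>P)"
    unfolding win_eq_integral using words_length[OF assms]
    by (simp add: take_map)
  also have "\<dots> = (\<Sum>w\<in>words R (m + n). win j w * (if take m w = u then 1 else 0))"
    by (rule window_integral(2))
  also have "\<dots> = (\<Sum>u'\<in>words R m. \<Sum>v\<in>words R n. win j (u' @ v) * (if u' = u then 1 else 0))"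
    unfolding sum_words_append by (intro sum.cong) (auto simp: words_length)
  also have "\<dots> = (\<Sum>u'\<in>words R m. if u' = u then (\<Sum>v\<in>words R n. win j (u' @ v)) else 0)"
    by (intro sum.cong) auto
  also have "\<dots> = (\<Sum>v\<in>words R n. win j (u @ v))"
    using assms by (simp add: sum.delta)
  finally show ?thesis ..
qed

lemma sum_win_append_left:
  assumes "v \<in> words R n"
  shows "(\<Sum>u\<in>words R m. win j (u @ v)) = win (j + m) v"
proof -
  have "win (j + m) v = (\<integral>x. (if drop m (map x [j..<j + (m + n)]) = v then 1 else 0) \<partial>P)"
    unfolding win_eq_integral using words_length[OF assms]
    by (simp add: drop_map add.assoc)
  also have "\<dots> = (\<Sum>w\<in>words R (m + n). win j w * (if drop m w = v then 1 else 0))"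
    by (rule window_integral(2))
  also have "\<dots> = (\<Sum>u\<in>words R m. \<Sum>v'\<in>words R n. win j (u @ v') * (if v' = v then 1 else 0))"
    unfolding sum_words_append by (intro sum.cong) (auto simp: words_length)
  also have "\<dots> = (\<Sum>u\<in>words R m. \<Sum>v'\<in>words R n. if v' = v then win j (u @ v') else 0)"
    by (intro sum.cong) auto
  also have "\<dots> = (\<Sum>u\<in>words R m. win j (u @ v))"
    using assms by (simp add: sum.delta)
  finally show ?thesis ..
qed

text \<open>Relative entropy of the law of the window with respect to the uniform law on words, that
  is, n ln R minus the Shannon entropy. With this sign it is nonnegative and superadditive.\<close>

definition ent :: "nat \<Rightarrow> nat \<Rightarrow> real" where
  "ent j n = (\<Sum>w\<in>words R n. win j w * ln (win j w)) + real n * ln (real R)"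

lemma ent_eq: "ent j n = (\<Sum>w\<in>words R n. win j w * ln (win j w * real R ^ n))"
proof -
  have "(\<Sum>w\<in>words R n. win j w * ln (win j w * real R ^ n))
      = (\<Sum>w\<in>words R n. win j w * ln (win j w) + win j w * (real n * ln (real R)))"
  proof (intro sum.cong refl)
    fix w
    show "win j w * ln (win j w * real R ^ n)
        = win j w * ln (win j w) + win j w * (real n * ln (real R))"
    proof (cases "win j w = 0")
      case False
      then have "win j w > 0" using win_nonneg[of j w] by linarith
      then show ?thesis using R_pos by (simp add: ln_mult ln_realpow distrib_left)
    qed simp
  qed
  also have "\<dots> = ent j n"
    unfolding ent_def sum.distrib sum_distrib_right[symmetric] by (simp add: sum_win)
  finally show ?thesis ..
qed

lemma ent_nonneg: "0 \<le> ent j n"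
proof -
  have "(\<Sum>w\<in>words R n. win j w * ln (1 / real R ^ n)) \<le> (\<Sum>w\<in>words R n. win j w * ln (win j w))"
    by (rule gibbs_inequality) (use R_pos in \<open>simp_all add: sum_win card_words\<close>)
  moreover have "(\<Sum>w\<in>words R n. win j w * ln (1 / real R ^ n)) = - real n * ln (real R)"
  proof -
    have "(\<Sum>w\<in>words R n. win j w * c) = c" for c
      using sum_distrib_right[of "win j" "words R n" c] by (simp add: sum_win)
    then show ?thesis using R_pos by (simp only: ln_div ln_realpow) (simp add: ln_div ln_realpow)
  qed
  ultimately show ?thesis by (simp add: ent_def)
qed

lemma ent_le: "ent j n \<le> real n * ln (real R)"
proof -
  have "win j w * ln (win j w) \<le> 0" for w
  proof (cases "win j w = 0")
    case False
    then have "win j w > 0" using win_nonneg[of j w] by linarith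
    then show ?thesis using win_le_1[of j w] by (intro mult_nonneg_nonpos) auto
  qed simp
  then show ?thesis unfolding ent_def by (simp add: sum_nonpos)
qed

text \<open>The gap between the two sides is the mutual information of two adjacent windows: Gibbs'
  inequality for the joint law against the product of its marginals.\<close>

lemma ent_superadditive: "ent j m + ent (j + m) n \<le> ent j (m + n)"
proof -
  let ?U = "words R m" and ?V = "words R n"
  let ?p = "\<lambda>(u, v). win j (u @ v)" and ?q = "\<lambda>(u, v). win j u * win (j + m) v"
  have le_u: "win j (u @ v) \<le> win j u" if "u \<in> ?U" "v \<in> ?V" for u v
    using member_le_sum[of v ?V "\<lambda>v. win j (u @ v)"] that sum_win_append_right[OF that(1), of j n]
    by simp
  have le_v: "win j (u @ v) \<le> win (j + m) v" if "u \<in> ?U" "v \<in> ?V" for u v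
    using member_le_sum[of u ?U "\<lambda>u. win j (u @ v)"] that sum_win_append_left[OF that(2), of j m]
    by simp
  have sp: "sum ?p (?U \<times> ?V) = 1"
    using sum_win[of j "m + n"] by (simp add: sum_words_append sum.cartesian_product)
  have sq: "sum ?q (?U \<times> ?V) = 1"
    using sum_win[of j m] sum_win[of "j + m" n]
    by (simp add: sum.cartesian_product[symmetric] sum_distrib_left[symmetric])
  have "(\<Sum>a\<in>?U \<times> ?V. ?p a * ln (?q a)) \<le> (\<Sum>a\<in>?U \<times> ?V. ?p a * ln (?p a))"
  proof (rule gibbs_inequality)
    \<comment> \<open>The joint law is dominated by each marginal, so it vanishes wherever the
      product does.\<close>
    fix a assume a: "a \<in> ?U \<times> ?V" "?q a = 0"
    obtain u v where uv: "a = (u, v)" "u \<in> ?U" "v \<in> ?V" using a(1) by auto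
    show "?p a = 0" using a(2) le_u[OF uv(2,3)] le_v[OF uv(2,3)] win_nonneg[of j "u @ v"]
      by (auto simp: uv(1) intro: antisym)
  qed (auto simp: sp sq)
  also have "(\<Sum>a\<in>?U \<times> ?V. ?p a * ln (?p a)) = ent j (m + n) - real (m + n) * ln (real R)"
    unfolding ent_def by (simp add: sum_words_append sum.cartesian_product case_prod_beta)
  also have "(\<Sum>a\<in>?U \<times> ?V. ?p a * ln (?q a))
      = (\<Sum>u\<in>?U. \<Sum>v\<in>?V. win j (u @ v) * ln (win j u) + win j (u @ v) * ln (win (j + m) v))"
  proof -
    have "win j (u @ v) * ln (win j u * win (j + m) v)
        = win j (u @ v) * ln (win j u) + win j (u @ v) * ln (win (j + m) v)"
      if "u \<in> ?U" "v \<in> ?V" for u v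
    proof (cases "win j (u @ v) = 0")
      case False
      then have "win j (u @ v) > 0" using win_nonneg[of j "u @ v"] by linarith
      then have "win j u > 0" "win (j + m) v > 0" using le_u[OF that] le_v[OF that] by linarith+
      then show ?thesis by (simp add: ln_mult algebra_simps)
    qed simp
    then show ?thesis
      unfolding sum.cartesian_product by (intro sum.cong) auto
  qed
  also have "\<dots> = (\<Sum>u\<in>?U. win j u * ln (win j u)) + (\<Sum>v\<in>?V. win (j + m) v * ln (win (j + m) v))"
  proof -
    have "(\<Sum>u\<in>?U. \<Sum>v\<in>?V. win j (u @ v) * ln (win j u)) = (\<Sum>u\<in>?U. win j u * ln (win j u))"
      by (intro sum.cong) (auto simp: sum_distrib_right[symmetric] sum_win_append_right)
    moreover have "(\<Sum>u\<in>?U. \<Sum>v\<in>?V. win j (u @ v) * ln (win (j + m) v))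
        = (\<Sum>v\<in>?V. win (j + m) v * ln (win (j + m) v))"
      by (subst sum.swap, intro sum.cong) (auto simp: sum_distrib_right[symmetric] sum_win_append_left)
    ultimately show ?thesis by (simp add: sum.distrib)
  qed
  finally show ?thesis by (simp add: ent_def algebra_simps)
qed

text \<open>Split the large window into three and drop the nonnegative contributions of the m
  letters before and the l letters after.\<close>

lemma ent_window_mono: "ent (j + m) n \<le> ent j (m + n + l)"
  using ent_superadditive[of j m n] ent_superadditive[of j "m + n" l]
    ent_nonneg[of j m] ent_nonneg[of "j + (m + n)" l] by linarith

section \<open>Relative entropies of the finite marginals as sums over words\<close>

abbreviation block_space :: "nat \<Rightarrow> (nat \<Rightarrow> nat) set" where
  "block_space n \<equiv> PiE {..<n} (\<lambda>_. {..<R})"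

text \<open>Finite product measures live on extensional functions, window laws on lists; sums are
  moved across by this bijection.\<close>

lemma bij_block_words: "bij_betw (\<lambda>a. map a [0..<n]) (block_space n) (words R n)"
proof (rule bij_betw_byWitness[where f' = "\<lambda>w. \<lambda>i\<in>{..<n}. w ! i"])
  show "\<forall>a\<in>block_space n. (\<lambda>i\<in>{..<n}. map a [0..<n] ! i) = a"
    by (auto simp: fun_eq_iff restrict_def PiE_def extensional_def)
  show "\<forall>w\<in>words R n. map (\<lambda>i\<in>{..<n}. w ! i) [0..<n] = w"
  proof
    fix w assume w: "w \<in> words R n"
    have "map (\<lambda>i\<in>{..<n}. w ! i) [0..<n] = map (\<lambda>i. w ! i) [0..<n]"
      by (rule map_cong) simp_all
    also have "\<dots> = w" unfolding words_length[OF w, symmetric] by (rule map_nth)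
    finally show "map (\<lambda>i\<in>{..<n}. w ! i) [0..<n] = w" .
  qed
  show "(\<lambda>a. map a [0..<n]) ` block_space n \<subseteq> words R n"
  proof (rule image_subsetI)
    fix a assume "a \<in> block_space n"
    then have "\<forall>i<n. a i < R" by (simp add: PiE_iff)
    then show "map a [0..<n] \<in> words R n" by (simp add: words_def image_subset_iff)
  qed
  show "(\<lambda>w. \<lambda>i\<in>{..<n}. w ! i) ` words R n \<subseteq> block_space n"
    by (intro image_subsetI restrict_PiE_iff[THEN iffD2]) (simp add: words_nth)
qed

lemma sets_blocks: "sets (\<Pi>\<^sub>M k\<in>{..<n}. digit_measure R) = Pow (block_space n)" (is "sets ?M = _")
proof -
  have sp: "space ?M = block_space n"
    by (simp add: space_PiM digit_measure_def space_uniform_count_measure)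
  have fin: "finite (block_space n)" by (intro finite_PiE) auto
  have "A \<in> sets ?M" if A: "A \<subseteq> block_space n" for A
  proof -
    have "{a} \<in> sets ?M" if "a \<in> A" for a
    proof -
      have a: "a \<in> block_space n" using A that by blast
      have "{a} = PiE {..<n} (\<lambda>i. {a i})"
        using a by (auto simp: PiE_def extensional_def fun_eq_iff Pi_def) metis
      also have "\<dots> \<in> sets ?M"
        using a by (intro sets_PiM_I_finite) (auto simp: digit_measure_def sets_uniform_count_measure)
      finally show ?thesis .
    qed
    then have "(\<Union>a\<in>A. {a}) \<in> sets ?M"
      using finite_subset[OF A fin] by (intro sets.finite_UN) auto
    then show ?thesis by simp
  qed
  then show ?thesis using sets.sets_into_space[of _ ?M] by (auto simp: sp)
qed

lemma product_blocks: "(\<Pi>\<^sub>M k\<in>{..<n}. digit_measure R) = uniform_count_measure (block_space n)"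
proof (rule measure_eqI_finite[OF sets_blocks])
  interpret D: prob_space "digit_measure R"
    unfolding digit_measure_def using R_pos by (intro prob_space_uniform_count_measure) auto
  interpret product_sigma_finite "\<lambda>_::nat. digit_measure R" ..
  fix a assume a: "a \<in> block_space n"
  have "{a} = PiE {..<n} (\<lambda>i. {a i})"
    using a by (auto simp: PiE_def extensional_def fun_eq_iff Pi_def) metis
  also have "emeasure (\<Pi>\<^sub>M k\<in>{..<n}. digit_measure R) \<dots> = (\<Prod>i<n. emeasure (digit_measure R) {a i})"
    using a by (intro emeasure_PiM) (auto simp: digit_measure_def sets_uniform_count_measure)
  also have "\<dots> = (\<Prod>i<n. ennreal (1 / real R))"
  proof (intro prod.cong refl)
    fix i assume "i \<in> {..<n}"
    then have "{a i} \<subseteq> {..<R}" using a by (simp add: PiE_iff)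
    then show "emeasure (digit_measure R) {a i} = ennreal (1 / real R)"
      by (simp add: digit_measure_def emeasure_uniform_count_measure)
  qed
  also have "\<dots> = ennreal (1 / real (R ^ n))"
    by (simp add: ennreal_power power_one_over)
  also have "\<dots> = emeasure (uniform_count_measure (block_space n)) {a}"
    using a by (subst emeasure_uniform_count_measure) (simp_all add: finite_PiE card_PiE)
  finally show "emeasure (\<Pi>\<^sub>M k\<in>{..<n}. digit_measure R) {a}
    = emeasure (uniform_count_measure (block_space n)) {a}" .
qed (auto simp: sets_uniform_count_measure intro!: finite_PiE)

text \<open>The reference measure is uniform on R^n points, so the density \<open>g\<close> of the
  marginal is the window probability times R^n; the base \<open>exp 1\<close> makes the logarithm
  natural.\<close>

lemma KL_divergence_blocks:
  "KL_divergence (exp 1) (\<Pi>\<^sub>M k\<in>{..<n}. digit_measure R)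
     (distr P (\<Pi>\<^sub>M k\<in>{..<n}. digit_measure R) (\<lambda>x. restrict x {..<n})) = ent 0 n"
  (is "KL_divergence _ ?M ?N = _")
proof -
  define g where "g a = win 0 (map a [0..<n]) * real R ^ n" for a :: "nat \<Rightarrow> nat"
  have fin: "finite (block_space n)" by (intro finite_PiE) auto
  have card: "card (block_space n) = R ^ n" by (simp add: card_PiE)
  interpret M: prob_space ?M
    unfolding product_blocks using R_pos fin card
    by (intro prob_space_uniform_count_measure) (auto simp: PiE_eq_empty_iff)
  have [measurable]: "(\<lambda>x. restrict x {..<n}) \<in> measurable P ?M"
  proof -
    have "(\<lambda>x. restrict x {..<n}) \<in> measurable (\<Pi>\<^sub>M k\<in>UNIV. digit_measure R) ?M"
      by (rule measurable_restrict_subset) auto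
    then show ?thesis by (subst measurable_cong_sets[OF sets_P refl])
  qed
  have g: "(\<lambda>a. ennreal (g a)) \<in> borel_measurable ?M" "g \<in> borel_measurable ?M"
    by (simp_all add: product_blocks uniform_count_measure_def)
  have "?N = density ?M g"
  proof (rule measure_eqI_finite)
    show "sets ?N = Pow (block_space n)" "sets (density ?M g) = Pow (block_space n)"
      by (simp_all add: sets_blocks)
    fix a assume a: "a \<in> block_space n"
    have "emeasure ?N {a} = emeasure P ((\<lambda>x. restrict x {..<n}) -` {a} \<inter> space P)"
      using a by (intro emeasure_distr) (auto simp: sets_blocks)
    also have "(\<lambda>x. restrict x {..<n}) -` {a} \<inter> space P
        = {x \<in> space P. map x [0..<0 + length (map a [0..<n])] = map a [0..<n]}"
    proof -
      have "restrict x {..<n} = a \<longleftrightarrow> map x [0..<n] = map a [0..<n]" for x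
      proof
        assume "map x [0..<n] = map a [0..<n]"
        then have "\<forall>i<n. x i = a i" by auto
        then show "restrict x {..<n} = a"
          using a by (auto simp: fun_eq_iff restrict_def PiE_def extensional_def)
      qed auto
      then show ?thesis by auto
    qed
    also have "emeasure P \<dots> = ennreal (win 0 (map a [0..<n]))"
      by (simp add: win_def emeasure_eq_measure)
    also have "\<dots> = emeasure (density ?M g) {a}"
    proof -
      have "emeasure (density ?M g) {a} = (\<integral>\<^sup>+x. ennreal (g x) * indicator {a} x \<partial>?M)"
        using a by (intro emeasure_density g) (simp_all add: sets_blocks)
      also have "\<dots> = (\<integral>\<^sup>+x. ennreal (g a) * indicator {a} x \<partial>?M)"
        by (intro nn_integral_cong) (auto simp: indicator_def)
      also have "\<dots> = ennreal (g a) * emeasure ?M {a}"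
        using a by (intro nn_integral_cmult_indicator) (simp_all add: sets_blocks)
      also have "emeasure ?M {a} = ennreal (1 / real (R ^ n))"
        unfolding product_blocks using a fin by (subst emeasure_uniform_count_measure) (simp_all add: card)
      also have "ennreal (g a) * \<dots> = ennreal (win 0 (map a [0..<n]))"
        using R_pos by (simp add: g_def ennreal_mult[symmetric])
      finally show ?thesis by simp
    qed
    finally show "emeasure ?N {a} = emeasure (density ?M g) {a}" .
  qed (rule fin)
  then have "KL_divergence (exp 1) ?M ?N = (\<integral>a. g a * log (exp 1) (g a) \<partial>?M)"
    by (simp, intro M.KL_density g) (simp_all add: g_def)
  also have "\<dots> = (\<Sum>a\<in>block_space n. g a * ln (g a)) / real (R ^ n)"
    unfolding product_blocks using fin by (subst integral_uniform_count_measure) (simp_all add: card log_ln)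
  also have "(\<Sum>a\<in>block_space n. g a * ln (g a))
      = (\<Sum>w\<in>words R n. (win 0 w * real R ^ n) * ln (win 0 w * real R ^ n))"
    unfolding g_def by (rule sum.reindex_bij_betw[OF bij_block_words])
  also have "\<dots> / real (R ^ n) = ent 0 n"
    unfolding ent_eq using R_pos by (simp add: sum_divide_distrib)
  finally show ?thesis .
qed

lemma shift_measurable [measurable]: "shift \<in> measurable P P"
proof -
  have "shift \<in> measurable (\<Pi>\<^sub>M k\<in>UNIV. digit_measure R) (\<Pi>\<^sub>M k\<in>UNIV. digit_measure R)"
    unfolding shift_def by (rule measurable_PiM_single') (auto simp: space_PiM)
  then show ?thesis by (subst measurable_cong_sets[OF sets_P sets_P])
qed

lemma expansion_measurable [measurable]: "expansion R \<in> borel_measurable P"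
  unfolding expansion_def by measurable

end

section \<open>Existence of the specific relative entropy\<close>

locale invariant_process = digit_process +
  assumes distr_shift: "distr P P shift = P"
begin

lemma win_shift: "win (Suc j) w = win j w"
proof -
  have "win j w = measure (distr P P shift) {x \<in> space P. map x [j..<j + length w] = w}"
    by (simp add: distr_shift win_def)
  also have "\<dots> = prob (shift -` {x \<in> space P. map x [j..<j + length w] = w} \<inter> space P)"
    by (intro measure_distr) measurable
  also have "shift -` {x \<in> space P. map x [j..<j + length w] = w} \<inter> space P
      = {x \<in> space P. map x [Suc j..<Suc j + length w] = w}"
  proof -
    have "map (shift x) [j..<j + length w] = w \<longleftrightarrow> map x [Suc j..<Suc j + length w] = w" for x :: "nat \<Rightarrow> nat"
      using map_eq_iff_nth[of "shift x" j w] map_eq_iff_nth[of x "Suc j" w]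
      by (simp add: shift_def)
    then show ?thesis using measurable_space[OF shift_measurable] by auto
  qed
  finally show ?thesis by (simp add: win_def)
qed

lemma win_eq_0: "win j w = win 0 w"
  by (induction j) (simp_all add: win_shift)

text \<open>Invariance moves the second window of \<open>ent_superadditive\<close> back to position
  0, which gives superadditivity in n alone, and Fekete's lemma applies.\<close>

lemma level3_entropy_tendsto:
  "(\<lambda>n. ent 0 n / real n) \<longlonglongrightarrow> level3_entropy (digit_measure R) P"
  and ent_le_level3_entropy: "n > 0 \<Longrightarrow> ent 0 n / real n \<le> level3_entropy (digit_measure R) P"
proof -
  have "ent 0 m + ent 0 n \<le> ent 0 (m + n)" for m n
    using ent_superadditive[of 0 m n] unfolding add_0 ent_def win_eq_0[of m] .
  then obtain L where L: "(\<lambda>n. ent 0 n / real n) \<longlonglongrightarrow> L" "\<forall>n>0. ent 0 n / real n \<le> L"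
    using fekete_superadditive[of "ent 0", OF _ ent_nonneg ent_le] by blast
  have "level3_entropy (digit_measure R) P = L"
    unfolding level3_entropy_def KL_divergence_blocks using L(1) by (rule limI)
  with L show "(\<lambda>n. ent 0 n / real n) \<longlonglongrightarrow> level3_entropy (digit_measure R) P"
    "n > 0 \<Longrightarrow> ent 0 n / real n \<le> level3_entropy (digit_measure R) P" by auto
qed

end

lemma invariant_processI:
  assumes "P \<in> shift_invariant_probs (digit_measure R)" "R > 0"
  shows "invariant_process P R"
  using assms unfolding shift_invariant_probs_def
  by (auto simp: invariant_process_def digit_process_def digit_process_axioms_def invariant_process_axioms_def)

section \<open>Upper bound for the free energy\<close>

text \<open>Left endpoint of the cell of points whose base R expansion begins with the word.\<close>

definition word_value :: "nat \<Rightarrow> nat list \<Rightarrow> real" where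
  "word_value R w = (\<Sum>i<length w. real (w ! i) / real R ^ Suc i)"

text \<open>A Birkhoff sum that depends on the word alone: the j-th orbit point is replaced by the
  left endpoint of the cell of the remaining letters.\<close>

definition birkhoff_word :: "nat \<Rightarrow> (real \<Rightarrow> real) \<Rightarrow> nat list \<Rightarrow> real" where
  "birkhoff_word R f w = (\<Sum>j<length w. f (word_value R (drop j w)))"

text \<open>Division by R^n reflects the uniform reference measure: the growth rate is the
  topological pressure minus ln R, which is 0 for f = 0.\<close>

definition partition_sum :: "nat \<Rightarrow> (real \<Rightarrow> real) \<Rightarrow> nat \<Rightarrow> real" where
  "partition_sum R f n = (\<Sum>w\<in>words R n. exp (birkhoff_word R f w)) / real R ^ n"

lemma partition_sum_pos: "R > 0 \<Longrightarrow> partition_sum R f n > 0"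
  unfolding partition_sum_def using card_words[of R n]
  by (intro divide_pos_pos sum_pos) (auto simp: card_gt_0_iff simp del: card_words)

lemma expansion_word_value:
  assumes R: "R \<ge> 2" and x: "\<And>k. x k < R"
  shows "\<bar>expansion R x - word_value R (map x [0..<m])\<bar> \<le> (1 / real R) ^ m"
proof -
  let ?t = "\<lambda>k. real (x k) / real R ^ Suc k"
  \<comment> \<open>The tail in which all digits are R - 1; it sums to exactly R^(-m).\<close>
  let ?u = "\<lambda>k. (1 / real R) ^ m * ((real R - 1) / real R) * (1 / real R) ^ k"
  have le: "?t (k + m) \<le> ?u k" for k
  proof -
    have "real (x (k + m)) \<le> real R - 1" using x[of "k + m"] by linarith
    then show ?thesis using R by (simp add: field_simps power_add)
  qed
  have u: "?u sums ((1 / real R) ^ m * ((real R - 1) / real R) * (1 / (1 - 1 / real R)))"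
    using R by (intro sums_mult geometric_sums) auto
  have usum: "suminf ?u = (1 / real R) ^ m"
  proof -
    have "suminf ?u = (1 / real R) ^ m * ((real R - 1) / real R) * (1 / (1 - 1 / real R))"
      by (rule sums_unique[OF u, symmetric])
    also have "\<dots> = (1 / real R) ^ m" using R by (simp add: field_simps)
    finally show ?thesis .
  qed
  have st: "summable (\<lambda>k. ?t (k + m))"
    using le by (intro summable_comparison_test'[OF sums_summable[OF u], of 0]) auto
  have "suminf ?t = (\<Sum>k. ?t (k + m)) + (\<Sum>k<m. ?t k)"
    using st by (intro suminf_split_initial_segment) (rule iffD1[OF summable_iff_shift[of ?t m]])
  then have "expansion R x - word_value R (map x [0..<m]) = (\<Sum>k. ?t (k + m))"
    by (simp add: expansion_def word_value_def)
  moreover have "0 \<le> (\<Sum>k. ?t (k + m))" using st by (intro suminf_nonneg) auto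
  moreover have "(\<Sum>k. ?t (k + m)) \<le> suminf ?u"
    using le st sums_summable[OF u] by (rule suminf_le)
  ultimately show ?thesis using usum by linarith
qed

lemma expansion_range:
  assumes R: "R \<ge> 2" and x: "\<And>k. x k < R"
  shows "\<bar>expansion R x\<bar> \<le> 1"
  using expansion_word_value[of R x 0] assms by (simp add: word_value_def)

text \<open>The total distance between orbit points and their truncations, uniformly in n. It bounds
  the distortion of Birkhoff sums by the Lipschitz constant alone.\<close>

lemma geometric_tail_sum:
  assumes "R \<ge> 2"
  shows "(\<Sum>j<n. (1 / real R) ^ (n - j)) \<le> 1"
proof -
  let ?c = "1 / real R"
  \<comment> \<open>The subtracted term lets the induction close: R \<ge> 2 leaves room for the new
    summand.\<close>
  have "(\<Sum>j<n. ?c ^ (n - j)) \<le> 1 - ?c ^ n"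
  proof (induction n)
    case (Suc n)
    have "2 * ?c ^ Suc n \<le> ?c ^ n"
      using assms by (simp add: field_simps)
    moreover have "(\<Sum>j<Suc n. ?c ^ (Suc n - j)) = ?c ^ Suc n + (\<Sum>j<n. ?c ^ (n - j))"
      by (subst sum.lessThan_Suc_shift) simp
    ultimately show ?case using Suc by linarith
  qed simp
  also have "\<dots> \<le> 1" by simp
  finally show ?thesis .
qed

definition birkhoff_seq :: "nat \<Rightarrow> (real \<Rightarrow> real) \<Rightarrow> nat \<Rightarrow> (nat \<Rightarrow> nat) \<Rightarrow> real" where
  "birkhoff_seq R f n x = (\<Sum>j<n. f (expansion R (\<lambda>k. x (j + k))))"

text \<open>After j shifts there are still n - j known digits, so the j-th terms differ by at most L
  R^(-(n-j)).\<close>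

lemma birkhoff_seq_word:
  assumes R: "R \<ge> 2" and x: "\<And>k. x k < R" and f: "\<And>a b. \<bar>f a - f b\<bar> \<le> L * \<bar>a - b\<bar>"
  shows "\<bar>birkhoff_seq R f n x - birkhoff_word R f (map x [0..<n])\<bar> \<le> L"
proof -
  have L: "0 \<le> L" using f[of 0 1] by simp
  have "\<bar>f (expansion R (\<lambda>k. x (j + k))) - f (word_value R (drop j (map x [0..<n])))\<bar>
      \<le> L * (1 / real R) ^ (n - j)" if "j < n" for j
  proof -
    have "drop j (map x [0..<n]) = map (\<lambda>k. x (j + k)) [0..<n - j]"
      using that by (intro nth_equalityI) auto
    then have "\<bar>expansion R (\<lambda>k. x (j + k)) - word_value R (drop j (map x [0..<n]))\<bar> \<le> (1 / real R) ^ (n - j)"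
      using expansion_word_value[of R "\<lambda>k. x (j + k)" "n - j"] R x by simp
    then show ?thesis using L by (intro order_trans[OF f] mult_left_mono)
  qed
  then have "\<bar>birkhoff_seq R f n x - birkhoff_word R f (map x [0..<n])\<bar>
      \<le> (\<Sum>j<n. L * (1 / real R) ^ (n - j))"
    unfolding birkhoff_seq_def birkhoff_word_def length_map length_upt diff_zero sum_subtractf[symmetric]
    by (intro order_trans[OF sum_abs] sum_mono) auto
  also have "\<dots> \<le> L * 1"
    unfolding sum_distrib_left[symmetric] using L geometric_tail_sum[OF R] by (intro mult_left_mono)
  finally show ?thesis by simp
qed

context digit_process
begin

lemma tail_measurable [measurable]: "(\<lambda>x k. x (j + k)) \<in> measurable P P"
proof -
  have "(\<lambda>x k. x (j + k)) \<in> measurable (\<Pi>\<^sub>M k\<in>UNIV. digit_measure R) (\<Pi>\<^sub>M k\<in>UNIV. digit_measure R)"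
    by (rule measurable_PiM_single') (auto simp: space_PiM)
  then show ?thesis by (subst measurable_cong_sets[OF sets_P sets_P])
qed

lemma integrable_lipschitz_expansion:
  assumes R: "R \<ge> 2" and f: "\<And>a b. \<bar>f a - f b\<bar> \<le> L * \<bar>a - b\<bar>" and [measurable]: "f \<in> borel_measurable borel"
  shows "integrable P (\<lambda>x. f (expansion R (\<lambda>k. x (j + k))))"
proof (rule integrable_const_bound[of _ "\<bar>f 0\<bar> + L"])
  have L: "0 \<le> L" using f[of 0 1] by simp
  have "\<bar>f (expansion R (\<lambda>k. x (j + k)))\<bar> \<le> \<bar>f 0\<bar> + L" if "x \<in> space P" for x
  proof -
    have "\<bar>expansion R (\<lambda>k. x (j + k))\<bar> \<le> 1"
      using R digit_less[OF that] by (intro expansion_range)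
    then have "L * \<bar>expansion R (\<lambda>k. x (j + k)) - 0\<bar> \<le> L * 1" using L by (intro mult_left_mono) auto
    then show ?thesis using f[of "expansion R (\<lambda>k. x (j + k))" 0] by linarith
  qed
  then show "AE x in P. norm (f (expansion R (\<lambda>k. x (j + k)))) \<le> \<bar>f 0\<bar> + L" by simp
  have "(\<lambda>x. expansion R (\<lambda>k. x (j + k))) \<in> borel_measurable P"
    by (rule measurable_compose[OF tail_measurable expansion_measurable])
  then show "(\<lambda>x. f (expansion R (\<lambda>k. x (j + k)))) \<in> borel_measurable P" by measurable
qed

end

context invariant_process
begin

lemma integral_tail:
  fixes g :: "(nat \<Rightarrow> nat) \<Rightarrow> real"
  assumes "g \<in> borel_measurable P"
  shows "(\<integral>x. g (\<lambda>k. x (j + k)) \<partial>P) = (\<integral>x. g x \<partial>P)"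
proof (induction j)
  case (Suc j)
  have "(\<integral>x. g (\<lambda>k. x (j + k)) \<partial>P) = (\<integral>x. g (\<lambda>k. x (j + k)) \<partial>distr P P shift)"
    by (simp add: distr_shift)
  also have "\<dots> = (\<integral>x. g (\<lambda>k. shift x (j + k)) \<partial>P)"
    by (rule integral_distr[OF shift_measurable measurable_compose[OF tail_measurable assms]])
  finally show ?case using Suc by (simp add: shift_def)
qed simp

text \<open>Invariance replaces the integral of f by 1/n times that of a Birkhoff sum, and L pays
  for passing to words. Gibbs' inequality against the weights proportional to exp of that sum bounds
  energy minus block entropy by ln Z. The specific entropy is the supremum of the block entropies
  per letter, so subtracting it only lowers the left side.\<close>

lemma free_energy_le:
  assumes R: "R \<ge> 2" and f: "\<And>a b. \<bar>f a - f b\<bar> \<le> L * \<bar>a - b\<bar>"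
    and [measurable]: "f \<in> borel_measurable borel" and n: "n > 0"
  shows "(\<integral>x. f (expansion R x) \<partial>P) - level3_entropy (digit_measure R) P
    \<le> (ln (partition_sum R f n) + L) / real n"
proof -
  let ?\<phi> = "birkhoff_word R f" and ?Z = "partition_sum R f n"
  have Z: "?Z > 0" using R_pos by (rule partition_sum_pos)
  have "real n * (\<integral>x. f (expansion R x) \<partial>P) = (\<Sum>j<n. \<integral>x. f (expansion R (\<lambda>k. x (j + k))) \<partial>P)"
    using integral_tail[of "\<lambda>x. f (expansion R x)"] by simp
  also have "\<dots> = (\<integral>x. birkhoff_seq R f n x \<partial>P)"
    unfolding birkhoff_seq_def using integrable_lipschitz_expansion[OF R f]
    by (subst Bochner_Integration.integral_sum) auto
  also have "\<dots> \<le> (\<integral>x. ?\<phi> (map x [0..<0 + n]) + L \<partial>P)"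
  proof (rule integral_mono)
    show "integrable P (birkhoff_seq R f n)"
      unfolding birkhoff_seq_def using integrable_lipschitz_expansion[OF R f]
      by (intro Bochner_Integration.integrable_sum) auto
    show "integrable P (\<lambda>x. ?\<phi> (map x [0..<0 + n]) + L)"
      using window_integral(1)[of ?\<phi> 0 n] by simp
    show "birkhoff_seq R f n x \<le> ?\<phi> (map x [0..<0 + n]) + L" if "x \<in> space P" for x
      using birkhoff_seq_word[of R x f L n, OF R digit_less[OF that] f] by simp
  qed
  also have "\<dots> = (\<Sum>w\<in>words R n. win 0 w * ?\<phi> w) + L"
    using window_integral[of ?\<phi> 0 n] by (simp add: prob_space)
  finally have 1: "real n * (\<integral>x. f (expansion R x) \<partial>P) \<le> (\<Sum>w\<in>words R n. win 0 w * ?\<phi> w) + L" .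
  let ?q = "\<lambda>w. exp (?\<phi> w) / (?Z * real R ^ n)"
  have sq: "(\<Sum>w\<in>words R n. ?q w) = 1"
  proof -
    have "(\<Sum>w\<in>words R n. exp (?\<phi> w)) = ?Z * real R ^ n"
      using R_pos by (simp add: partition_sum_def)
    moreover have "?Z * real R ^ n \<noteq> 0" using Z R_pos by simp
    ultimately show ?thesis by (simp only: sum_divide_distrib[symmetric] divide_self_if if_False)
  qed
  have "(\<Sum>w\<in>words R n. win 0 w * ln (?q w)) \<le> (\<Sum>w\<in>words R n. win 0 w * ln (win 0 w))"
    by (rule gibbs_inequality) (use Z R_pos in \<open>simp_all add: sq sum_win\<close>)
  moreover have "(\<Sum>w\<in>words R n. win 0 w * ln (?q w))
      = (\<Sum>w\<in>words R n. win 0 w * ?\<phi> w - win 0 w * (ln ?Z + real n * ln (real R)))"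
    using Z R_pos by (intro sum.cong) (simp_all add: ln_div ln_mult ln_realpow right_diff_distrib)
  moreover have "\<dots> = (\<Sum>w\<in>words R n. win 0 w * ?\<phi> w) - (ln ?Z + real n * ln (real R))"
    unfolding sum_subtractf sum_distrib_right[symmetric] by (simp add: sum_win)
  ultimately have "(\<Sum>w\<in>words R n. win 0 w * ?\<phi> w) - ent 0 n \<le> ln ?Z"
    by (simp add: ent_def)
  with 1 have "real n * (\<integral>x. f (expansion R x) \<partial>P) - ent 0 n \<le> ln ?Z + L" by linarith
  moreover have "ent 0 n \<le> level3_entropy (digit_measure R) P * real n"
    using ent_le_level3_entropy[OF n] n by (simp add: field_simps)
  ultimately show ?thesis using n by (simp add: field_simps)
qed

end

section \<open>Independent blocks and the variational principle\<close>

text \<open>Cylinders over finite index sets J determine the measure, and each depends only on an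
  initial window containing J, whose law is given by word probabilities.\<close>

lemma digit_process_eqI:
  assumes "digit_process P R" "digit_process P' R"
    and eq: "\<And>w. digit_process.win P 0 w = digit_process.win P' 0 w"
  shows "P = P'"
proof -
  interpret P: digit_process P R by fact
  interpret P': digit_process P' R by fact
  show ?thesis
  proof (rule measure_eqI_PiM_infinite[OF P.sets_P P'.sets_P])
    fix A :: "nat \<Rightarrow> nat set" and J :: "nat set"
    assume J: "finite J" and A: "\<And>i. i \<in> J \<Longrightarrow> A i \<in> sets (digit_measure R)"
    obtain m where m: "\<And>i. i \<in> J \<Longrightarrow> i < m"
      using finite_nat_set_iff_bounded[of J] J by blast
    let ?X = "prod_emb UNIV (\<lambda>_. digit_measure R) J (Pi\<^sub>E J A)"
    let ?c = "\<lambda>w. if \<forall>i\<in>J. w ! i \<in> A i then 1 else 0 :: real"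
    have X: "?X = {x \<in> UNIV \<rightarrow> {..<R}. \<forall>i\<in>J. x i \<in> A i}"
      by (auto simp: prod_emb_def digit_measure_def space_uniform_count_measure PiE_iff)
    have main: "emeasure Q ?X = ennreal (\<Sum>w\<in>words R m. digit_process.win Q 0 w * ?c w)"
      if "digit_process Q R" for Q
    proof -
      interpret Q: digit_process Q R by fact
      have "?X \<in> sets Q" unfolding Q.sets_P using J A by (intro sets_PiM_I) auto
      then have "Q.prob ?X = (\<integral>x. indicator ?X x \<partial>Q)" by simp
      also have "\<dots> = (\<integral>x. ?c (map x [0..<0 + m]) \<partial>Q)"
        using m unfolding X by (intro Bochner_Integration.integral_cong) (auto simp: indicator_def Q.space_P)
      also have "\<dots> = (\<Sum>w\<in>words R m. Q.win 0 w * ?c w)" by (rule Q.window_integral(2))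
      finally show ?thesis by (simp add: Q.emeasure_eq_measure)
    qed
    show "emeasure P ?X = emeasure P' ?X"
      unfolding main[OF assms(1)] main[OF assms(2)] eq ..
  qed (rule P.finite_measure)
qed

section \<open>Averaging a periodic law over its shifts\<close>

context digit_process
begin

text \<open>The law of the sequence read from an independent, uniformly chosen start j < n. As the
  image of a product measure it is integrated by Fubini.\<close>

definition shift_average :: "nat \<Rightarrow> (nat \<Rightarrow> nat) measure" where
  "shift_average n = distr (uniform_count_measure {..<n} \<Otimes>\<^sub>M P) (\<Pi>\<^sub>M k\<in>UNIV. digit_measure R)
     (\<lambda>(j, x) k. x (j + k))"

lemma shift_average_measurable [measurable]:
  "(\<lambda>(j, x) k. x (j + k)) \<in> measurable (uniform_count_measure {..<n} \<Otimes>\<^sub>M P) (\<Pi>\<^sub>M k\<in>UNIV. digit_measure R)"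
proof (subst measurable_cong_sets[OF sets_pair_measure_cong[OF sets_uniform_count_measure_count_space refl] refl],
    rule measurable_pair_measure_countable1)
  fix j :: nat
  have "(\<lambda>x k. x (j + k)) \<in> measurable P (\<Pi>\<^sub>M k\<in>UNIV. digit_measure R)"
    using tail_measurable[of j] by (subst (asm) measurable_cong_sets[OF refl sets_P])
  then show "(\<lambda>x. case (j, x) of (j, x) \<Rightarrow> \<lambda>k. x (j + k)) \<in> measurable P (\<Pi>\<^sub>M k\<in>UNIV. digit_measure R)"
    by simp
qed simp

lemma shift_average_integral:
  assumes n: "n > 0" and [measurable]: "g \<in> borel_measurable P" and B: "\<And>x. x \<in> space P \<Longrightarrow> \<bar>g x\<bar> \<le> B"
  shows "(\<integral>x. g x \<partial>shift_average n) = (\<Sum>j<n. \<integral>x. g (\<lambda>k. x (j + k)) \<partial>P) / real n"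
proof -
  let ?U = "uniform_count_measure {..<n}" and ?D = "\<Pi>\<^sub>M k\<in>UNIV. digit_measure R"
  interpret U: prob_space ?U using n by (intro prob_space_uniform_count_measure) auto
  interpret UP: pair_prob_space ?U P ..
  have gD: "g \<in> borel_measurable ?D" by (subst measurable_cong_sets[OF sets_P[symmetric] refl]) fact
  have gm: "(\<lambda>p. g ((\<lambda>(j, x) k. x (j + k)) p)) \<in> borel_measurable (?U \<Otimes>\<^sub>M P)"
    by (rule measurable_compose[OF shift_average_measurable gD])
  have sp: "(\<lambda>k. x (j + k)) \<in> space P" if "x \<in> space P" for x j
    using that by (auto simp: space_P)
  have "(\<integral>x. g x \<partial>shift_average n) = (\<integral>p. g ((\<lambda>(j, x) k. x (j + k)) p) \<partial>(?U \<Otimes>\<^sub>M P))"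
    unfolding shift_average_def by (rule integral_distr[OF shift_average_measurable gD])
  also have "\<dots> = (\<integral>j. \<integral>x. g ((\<lambda>(j, x) k. x (j + k)) (j, x)) \<partial>P \<partial>?U)"
  proof (rule UP.integral_fst'[symmetric])
    have "AE p in ?U \<Otimes>\<^sub>M P. norm (g ((\<lambda>(j, x) k. x (j + k)) p)) \<le> B"
      using sp B by (intro AE_I2) (auto simp: space_pair_measure)
    then show "integrable (?U \<Otimes>\<^sub>M P) (\<lambda>p. g ((\<lambda>(j, x) k. x (j + k)) p))"
      using gm by (rule UP.P.integrable_const_bound)
  qed
  also have "\<dots> = (\<Sum>j<n. \<integral>x. g (\<lambda>k. x (j + k)) \<partial>P) / real n"
    by (subst integral_uniform_count_measure) auto
  finally show ?thesis .
qed

lemma digit_process_shift_average: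
  assumes n: "n > 0" shows "digit_process (shift_average n) R"
proof -
  interpret U: prob_space "uniform_count_measure {..<n}"
    using n by (intro prob_space_uniform_count_measure) auto
  interpret UP: pair_prob_space "uniform_count_measure {..<n}" P ..
  have "prob_space (shift_average n)"
    unfolding shift_average_def by (rule UP.P.prob_space_distr) measurable
  then show ?thesis
    by (simp add: digit_process_def digit_process_axioms_def R_pos shift_average_def)
qed

lemma shift_average_win:
  assumes n: "n > 0"
  shows "digit_process.win (shift_average n) i w = (\<Sum>j<n. win (j + i) w) / real n"
proof -
  interpret A: digit_process "shift_average n" R using n by (rule digit_process_shift_average)
  let ?g = "\<lambda>x. if map x [i..<i + length w] = w then 1 else 0 :: real"
  have g: "?g \<in> borel_measurable P" by measurable
  have "A.win i w = (\<integral>x. ?g x \<partial>shift_average n)" by (rule A.win_eq_integral)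
  also have "\<dots> = (\<Sum>j<n. \<integral>x. ?g (\<lambda>k. x (j + k)) \<partial>P) / real n"
    by (rule shift_average_integral[OF n g, of 1]) auto
  also have "\<dots> = (\<Sum>j<n. win (j + i) w) / real n"
    unfolding win_eq_integral map_eq_iff_nth by (simp only: add.assoc)
  finally show ?thesis .
qed

lemma shift_average_invariant:
  assumes n: "n > 0" and per: "\<And>w. win n w = win 0 w"
  shows "shift_average n \<in> shift_invariant_probs (digit_measure R)"
proof -
  interpret A: digit_process "shift_average n" R using n by (rule digit_process_shift_average)
  have sets: "sets (shift_average n) = sets (\<Pi>\<^sub>M k\<in>UNIV. digit_measure R)" by (rule A.sets_P)
  let ?S = "distr (shift_average n) (shift_average n) shift"
  have S: "digit_process ?S R"
    using A.prob_space_distr[OF A.shift_measurable] sets R_pos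
    by (simp add: digit_process_def digit_process_axioms_def)
  interpret S: digit_process ?S R by (rule S)
  have "?S = shift_average n"
  proof (rule digit_process_eqI[OF S A.digit_process_axioms])
    fix w
    have m: "(\<lambda>x. if map x [0..<0 + length w] = w then 1 else 0 :: real) \<in> borel_measurable (shift_average n)"
      by measurable
    have "S.win 0 w = (\<integral>x. (if map (shift x) [0..<0 + length w] = w then 1 else 0) \<partial>shift_average n)"
      unfolding S.win_eq_integral by (rule integral_distr[OF A.shift_measurable m])
    also have "\<dots> = A.win 1 w"
      unfolding A.win_eq_integral map_eq_iff_nth shift_def by simp
    also have "\<dots> = (\<Sum>j<n. win (j + 1) w) / real n" by (rule shift_average_win[OF n])
    \<comment> \<open>Shifting drops the start 0 and adds the start n; periodicity makes these two
      terms equal.\<close>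
    also have "(\<Sum>j<n. win (j + 1) w) = (\<Sum>j<n. win (j + 0) w)"
    proof -
      have "(\<Sum>j<n. win (j + 1) w) + win 0 w = (\<Sum>j<Suc n. win j w)"
        by (subst sum.lessThan_Suc_shift) simp
      then show ?thesis by (simp add: per)
    qed
    also have "\<dots> / real n = A.win 0 w" by (rule shift_average_win[OF n, symmetric])
    finally show "S.win 0 w = A.win 0 w" .
  qed
  then show ?thesis
    using sets A.prob_space_axioms by (simp add: shift_invariant_probs_def)
qed

text \<open>Convexity of relative entropy: each shifted law is compared with the average by Gibbs'
  inequality, and the cross terms add up to the entropy of the average.\<close>

lemma shift_average_ent_le:
  assumes n: "n > 0"
  shows "real n * digit_process.ent (shift_average n) R 0 m \<le> (\<Sum>j<n. ent j m)"
proof -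
  interpret A: digit_process "shift_average n" R using n by (rule digit_process_shift_average)
  have Aw: "real n * A.win 0 w = (\<Sum>j<n. win j w)" for w
    using shift_average_win[OF n, of 0 w] n by simp
  have "(\<Sum>w\<in>words R m. win j w * ln (A.win 0 w)) \<le> (\<Sum>w\<in>words R m. win j w * ln (win j w))"
    if j: "j < n" for j
  proof (rule gibbs_inequality)
    fix w assume "A.win 0 w = 0"
    then have "(\<Sum>j<n. win j w) = 0" using Aw[of w] by simp
    then show "win j w = 0" using j by (subst (asm) sum_nonneg_eq_0_iff) auto
  qed (simp_all add: sum_win A.sum_win)
  then have "(\<Sum>j<n. \<Sum>w\<in>words R m. win j w * ln (A.win 0 w))
      \<le> (\<Sum>j<n. \<Sum>w\<in>words R m. win j w * ln (win j w))"
    by (rule sum_mono) simp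
  also have "(\<Sum>j<n. \<Sum>w\<in>words R m. win j w * ln (A.win 0 w))
      = (\<Sum>w\<in>words R m. (real n * A.win 0 w) * ln (A.win 0 w))"
    unfolding Aw by (subst sum.swap) (simp add: sum_distrib_right)
  also have "\<dots> = real n * (\<Sum>w\<in>words R m. A.win 0 w * ln (A.win 0 w))"
    by (simp add: sum_distrib_left mult.assoc)
  finally show ?thesis
    by (simp add: ent_def A.ent_def sum.distrib distrib_left)
qed

end

text \<open>\<open>\<nu>\<close> is the law of one block; the process \<open>Q\<close> concatenates independent blocks and is invariant under
  the \<open>n\<close>-fold shift only.\<close>

locale block_weights =
  fixes R n :: nat and \<nu> :: "nat list \<Rightarrow> real"
  assumes R2: "R \<ge> 2" and n_pos: "n > 0"
    and \<nu>_pos: "\<And>w. w \<in> words R n \<Longrightarrow> \<nu> w > 0" and \<nu>_sum: "(\<Sum>w\<in>words R n. \<nu> w) = 1"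
begin

definition B :: "nat list measure" where "B = point_measure (words R n) (\<lambda>w. ennreal (\<nu> w))"

lemma space_B [simp]: "space B = words R n" by (simp add: B_def space_point_measure)

lemma sets_B [simp]: "sets B = Pow (words R n)" by (simp add: B_def sets_point_measure)

lemma emeasure_B: "w \<in> words R n \<Longrightarrow> emeasure B {w} = ennreal (\<nu> w)"
  unfolding B_def by (subst emeasure_point_measure_finite) auto

sublocale B: prob_space B
  unfolding B_def using \<nu>_pos \<nu>_sum
  by (intro prob_space_point_measure) (auto simp: less_imp_le sum_ennreal)

text \<open>Provides \<open>S\<close>, the law of an independent sequence of blocks, and
  \<open>PiM_iter\<close>: prepending an independent block does not change this law.\<close>

sublocale sequence_space B ..

definition cat :: "(nat \<Rightarrow> nat list) \<Rightarrow> nat \<Rightarrow> nat" where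
  "cat \<omega> k = \<omega> (k div n) ! (k mod n)"

lemma cat_measurable [measurable]: "cat \<in> measurable S (\<Pi>\<^sub>M k\<in>UNIV. digit_measure R)"
proof (rule measurable_PiM_single')
  fix k :: nat
  have "(\<lambda>\<omega>. \<omega> (k div n)) \<in> measurable S B" by measurable
  moreover have "(\<lambda>w. w ! (k mod n)) \<in> measurable B (digit_measure R)"
    using n_pos by (auto simp: measurable_def digit_measure_def space_uniform_count_measure
      sets_uniform_count_measure words_nth)
  ultimately show "(\<lambda>\<omega>. cat \<omega> k) \<in> measurable S (digit_measure R)"
    unfolding cat_def by (rule measurable_compose)
next
  show "cat \<in> space S \<rightarrow> (UNIV \<rightarrow>\<^sub>E space (digit_measure R))"
  proof (rule Pi_I)
    fix \<omega> assume "\<omega> \<in> space S"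
    then have "\<omega> i \<in> words R n" for i by (simp add: space_PiM PiE_iff)
    then have "cat \<omega> k < R" for k using n_pos unfolding cat_def by (intro words_nth) auto
    then show "cat \<omega> \<in> UNIV \<rightarrow>\<^sub>E space (digit_measure R)"
      by (simp add: digit_measure_def space_uniform_count_measure PiE_iff)
  qed
qed

definition Q :: "(nat \<Rightarrow> nat) measure" where
  "Q = distr S (\<Pi>\<^sub>M k\<in>UNIV. digit_measure R) cat"

sublocale Q: digit_process Q R
  unfolding digit_process_def digit_process_axioms_def Q_def
  using P.prob_space_distr[OF cat_measurable] R2 by simp

lemma cat_case_nat_less: "k < n \<Longrightarrow> cat (case_nat s \<omega>) k = s ! k"
  by (simp add: cat_def)

lemma cat_case_nat_add: "cat (case_nat s \<omega>) (k + n) = cat \<omega> k"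
  using n_pos by (simp add: cat_def)

text \<open>Regenerate \<open>S\<close> by prepending a block with \<open>case_nat\<close>. This
  sets the first n digits and moves the others by n places, so the event becomes the rectangle
  formed by {u} and the event for v.\<close>

lemma Q_win_append:
  assumes u: "u \<in> words R n"
  shows "Q.win 0 (u @ v) = \<nu> u * Q.win 0 v"
proof -
  let ?E = "\<lambda>v. {\<omega> \<in> space S. map (cat \<omega>) [0..<length v] = v}"
  have E: "?E v \<in> sets S" and Qw: "ennreal (Q.win 0 v) = emeasure S (?E v)" for v
  proof -
    let ?X = "{x \<in> space Q. map x [0..<0 + length v] = v}"
    have X: "?X \<in> sets (\<Pi>\<^sub>M k\<in>UNIV. digit_measure R)"
      using Q.win_sets[of 0 v] unfolding Q.sets_P .
    have eq: "cat -` ?X \<inter> space S = ?E v"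
      using measurable_space[OF cat_measurable] by (auto simp: Q_def)
    show "?E v \<in> sets S" using measurable_sets[OF cat_measurable X] by (simp only: eq)
    have "ennreal (Q.win 0 v) = emeasure Q ?X"
      by (simp only: Q.win_def Q.emeasure_eq_measure)
    also have "\<dots> = emeasure S (?E v)"
      unfolding eq[symmetric] by (subst (1) Q_def) (rule emeasure_distr[OF cat_measurable X])
    finally show "ennreal (Q.win 0 v) = emeasure S (?E v)" .
  qed
  have m: "(\<lambda>(s, \<omega>). case_nat s \<omega>) \<in> measurable (B \<Otimes>\<^sub>M S) S" by measurable
  have "ennreal (Q.win 0 (u @ v)) = emeasure (distr (B \<Otimes>\<^sub>M S) S (\<lambda>(s, \<omega>). case_nat s \<omega>)) (?E (u @ v))"
    unfolding PiM_iter by (rule Qw)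
  also have "\<dots> = emeasure (B \<Otimes>\<^sub>M S) ((\<lambda>(s, \<omega>). case_nat s \<omega>) -` ?E (u @ v) \<inter> space (B \<Otimes>\<^sub>M S))"
    by (rule emeasure_distr[OF m E])
  also have "(\<lambda>(s, \<omega>). case_nat s \<omega>) -` ?E (u @ v) \<inter> space (B \<Otimes>\<^sub>M S) = {u} \<times> ?E v"
  proof -
    have *: "map (cat (case_nat s \<omega>)) [0..<length (u @ v)] = u @ v \<longleftrightarrow> s = u \<and> map (cat \<omega>) [0..<length v] = v"
      if s: "s \<in> words R n" for s \<omega>
    proof -
      have "[0..<n + length v] = [0..<n] @ map (\<lambda>k. k + n) [0..<length v]"
        unfolding map_add_upt using upt_add_eq_append[of 0 n "length v"] by (simp only: le0 add.commute)
      then have "map (cat (case_nat s \<omega>)) [0..<length (u @ v)]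
          = map (cat (case_nat s \<omega>)) [0..<n] @ map (cat \<omega>) [0..<length v]"
        using words_length[OF u] by (simp add: comp_def cat_case_nat_add)
      also have "map (cat (case_nat s \<omega>)) [0..<n] = map (\<lambda>k. s ! k) [0..<n]"
        by (intro map_cong refl) (simp add: cat_case_nat_less)
      also have "\<dots> = s" unfolding words_length[OF s, symmetric] by (rule map_nth)
      finally show ?thesis using words_length[OF s] words_length[OF u] by auto
    qed
    have **: "case_nat s \<omega> \<in> space S" if "s \<in> words R n" "\<omega> \<in> space S" for s \<omega>
      using measurable_space[OF m, of "(s, \<omega>)"] that by (simp add: space_pair_measure)
    show ?thesis
    proof (intro set_eqI)
      fix p :: "nat list \<times> (nat \<Rightarrow> nat list)"
      obtain s \<omega> where p: "p = (s, \<omega>)" by (cases p)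
      have "p \<in> (\<lambda>(s, \<omega>). case_nat s \<omega>) -` ?E (u @ v) \<inter> space (B \<Otimes>\<^sub>M S)
          \<longleftrightarrow> s \<in> words R n \<and> \<omega> \<in> space S \<and> case_nat s \<omega> \<in> space S
            \<and> map (cat (case_nat s \<omega>)) [0..<length (u @ v)] = u @ v"
        unfolding p space_pair_measure space_B vimage_eq Int_iff mem_Collect_eq mem_Times_iff
          fst_conv snd_conv case_prod_conv by blast
      also have "\<dots> \<longleftrightarrow> s = u \<and> \<omega> \<in> space S \<and> map (cat \<omega>) [0..<length v] = v"
        using *[of s \<omega>] **[of s \<omega>] u by blast
      also have "\<dots> \<longleftrightarrow> p \<in> {u} \<times> ?E v" unfolding p by blast
      finally show "p \<in> (\<lambda>(s, \<omega>). case_nat s \<omega>) -` ?E (u @ v) \<inter> space (B \<Otimes>\<^sub>M S)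
          \<longleftrightarrow> p \<in> {u} \<times> ?E v" .
    qed
  qed
  also have "emeasure (B \<Otimes>\<^sub>M S) ({u} \<times> ?E v) = emeasure B {u} * emeasure S (?E v)"
    using u E by (intro P.emeasure_pair_measure_Times) auto
  also have "\<dots> = ennreal (\<nu> u * Q.win 0 v)"
    unfolding Qw[symmetric] emeasure_B[OF u] using \<nu>_pos[OF u] by (simp add: ennreal_mult)
  finally show ?thesis using \<nu>_pos[OF u] by (subst (asm) ennreal_inj) auto
qed

lemma Q_win_block: "u \<in> words R n \<Longrightarrow> Q.win 0 u = \<nu> u"
  using Q_win_append[of u "[]"] Q.sum_win[of 0 0] by simp

lemma Q_win_period: "Q.win n w = Q.win 0 w"
proof (cases "w \<in> words R (length w)")
  case True
  then have "Q.win n w = (\<Sum>u\<in>words R n. Q.win 0 (u @ w))"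
    using Q.sum_win_append_left[OF True, where m = n and j = 0] by simp
  also have "\<dots> = (\<Sum>u\<in>words R n. \<nu> u) * Q.win 0 w"
    by (simp add: Q_win_append sum_distrib_right)
  finally show ?thesis by (simp add: \<nu>_sum)
next
  \<comment> \<open>A letter outside the alphabet makes both probabilities 0.\<close>
  case False
  have "Q.win j w = 0" for j
  proof -
    have "{x \<in> space Q. map x [j..<j + length w] = w} = {}"
      using Q.window_in_words[of _ j "length w"] False
      by (metis (mono_tags, lifting) Collect_empty_eq)
    then show ?thesis unfolding Q.win_def by (simp only: measure_empty)
  qed
  then show ?thesis by simp
qed

lemma Q_win_pos: "w \<in> words R (N * n) \<Longrightarrow> Q.win 0 w > 0"
proof (induction N arbitrary: w)
  case 0 then show ?case using Q.sum_win[of 0 0] by simp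
next
  case (Suc N)
  then have "w \<in> (\<lambda>(u, v). u @ v) ` (words R n \<times> words R (N * n))"
    using words_append[of R n "N * n"] by simp
  then obtain u v where "w = u @ v" "u \<in> words R n" "v \<in> words R (N * n)" by auto
  then show ?case using Suc.IH[of v] \<nu>_pos[of u] by (simp add: Q_win_append)
qed

text \<open>Independent blocks give equality in superadditivity. Positivity of all word
  probabilities allows the logarithm of the product to be split.\<close>

lemma Q_ent: "Q.ent 0 (N * n) = real N * Q.ent 0 n"
proof (induction N)
  case 0 then show ?case using Q.sum_win[of 0 0] by (simp add: Q.ent_def)
next
  case (Suc N)
  let ?U = "words R n" and ?V = "words R (N * n)"
  have "(\<Sum>w\<in>words R (Suc N * n). Q.win 0 w * ln (Q.win 0 w))
      = (\<Sum>u\<in>?U. \<Sum>v\<in>?V. (\<nu> u * Q.win 0 v) * ln (\<nu> u * Q.win 0 v))"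
    unfolding mult_Suc sum_words_append by (intro sum.cong) (simp_all add: Q_win_append)
  also have "\<dots> = (\<Sum>u\<in>?U. \<Sum>v\<in>?V. \<nu> u * ln (\<nu> u) * Q.win 0 v + \<nu> u * (Q.win 0 v * ln (Q.win 0 v)))"
  proof (intro sum.cong refl)
    fix u v assume "u \<in> ?U" "v \<in> ?V"
    then have "\<nu> u > 0" "Q.win 0 v > 0" using \<nu>_pos Q_win_pos by auto
    then show "(\<nu> u * Q.win 0 v) * ln (\<nu> u * Q.win 0 v)
        = \<nu> u * ln (\<nu> u) * Q.win 0 v + \<nu> u * (Q.win 0 v * ln (Q.win 0 v))"
      by (simp add: ln_mult algebra_simps)
  qed
  also have "\<dots> = (\<Sum>u\<in>?U. \<nu> u * ln (\<nu> u)) + (\<Sum>v\<in>?V. Q.win 0 v * ln (Q.win 0 v))"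
    unfolding sum.distrib sum_distrib_left[symmetric] Q.sum_win
    by (simp add: sum_distrib_right[symmetric] \<nu>_sum)
  finally show ?case using Suc.IH
    by (simp add: Q.ent_def Q_win_block algebra_simps)
qed

lemma invariant_average: "invariant_process (Q.shift_average n) R"
  and average_in_probs: "Q.shift_average n \<in> shift_invariant_probs (digit_measure R)"
proof -
  show "Q.shift_average n \<in> shift_invariant_probs (digit_measure R)"
    using n_pos Q_win_period by (rule Q.shift_average_invariant)
  then show "invariant_process (Q.shift_average n) R" using R2 by (intro invariant_processI) auto
qed

text \<open>A window of length \<open>N n\<close> that starts at \<open>j < n\<close> is contained in the first \<open>N + 1\<close> blocks.\<close>

lemma level3_entropy_average: "level3_entropy (digit_measure R) (Q.shift_average n) \<le> Q.ent 0 n / real n"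
proof -
  interpret A: invariant_process "Q.shift_average n" R by (rule invariant_average)
  have ent: "A.ent 0 (N * n) \<le> real (Suc N) * Q.ent 0 n" for N
  proof -
    have "real n * A.ent 0 (N * n) \<le> (\<Sum>j<n. Q.ent j (N * n))"
      using n_pos by (rule Q.shift_average_ent_le)
    also have "\<dots> \<le> (\<Sum>j<n. Q.ent 0 (Suc N * n))"
    proof (intro sum_mono)
      fix j assume "j \<in> {..<n}"
      then have "j + N * n + (n - j) = Suc N * n" by simp
      then show "Q.ent j (N * n) \<le> Q.ent 0 (Suc N * n)"
        using Q.ent_window_mono[of 0 j "N * n" "n - j"] by (simp add: add.commute)
    qed
    also have "\<dots> = real n * (real (Suc N) * Q.ent 0 n)" by (simp add: Q_ent del: mult_Suc)
    finally show ?thesis using n_pos by simp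
  qed
  have "(\<lambda>N. A.ent 0 (Suc N * n) / real (Suc N * n)) \<longlonglongrightarrow> level3_entropy (digit_measure R) (Q.shift_average n)"
    using n_pos by (intro filterlim_compose[OF A.level3_entropy_tendsto] filterlim_subseq)
      (auto simp: strict_mono_Suc_iff)
  \<comment> \<open>The excess over 1 is the share of the one surplus block.\<close>
  moreover have "(\<lambda>N. (1 + 1 / real (Suc N)) * (Q.ent 0 n / real n)) \<longlonglongrightarrow> (1 + 0) * (Q.ent 0 n / real n)"
    using LIMSEQ_inverse_real_of_nat by (intro tendsto_intros) (simp add: inverse_eq_divide)
  moreover have "A.ent 0 (Suc N * n) / real (Suc N * n) \<le> (1 + 1 / real (Suc N)) * (Q.ent 0 n / real n)" for N
  proof -
    have "A.ent 0 (Suc N * n) / real (Suc N * n) \<le> real (Suc (Suc N)) * Q.ent 0 n / real (Suc N * n)"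
      using ent[of "Suc N"] by (intro divide_right_mono) auto
    also have "\<dots> = (1 + 1 / real (Suc N)) * (Q.ent 0 n / real n)"
      using n_pos by (simp add: field_simps)
    finally show ?thesis .
  qed
  ultimately show ?thesis using LIMSEQ_le by fastforce
qed

text \<open>Averaging over n starts turns the integral of f into 1/n times the mean Birkhoff sum
  over the first block; L pays for its dependence on digits beyond that block.\<close>

lemma free_energy_average_ge:
  assumes f: "\<And>a b. \<bar>f a - f b\<bar> \<le> L * \<bar>a - b\<bar>" and [measurable]: "f \<in> borel_measurable borel"
  shows "((\<Sum>w\<in>words R n. \<nu> w * birkhoff_word R f w) - L - Q.ent 0 n) / real n
    \<le> (\<integral>x. f (expansion R x) \<partial>Q.shift_average n)
        - level3_entropy (digit_measure R) (Q.shift_average n)"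
proof -
  let ?\<phi> = "birkhoff_word R f"
  have L: "0 \<le> L" using f[of 0 1] by simp
  have i: "integrable Q (\<lambda>x. f (expansion R (\<lambda>k. x (j + k))))" for j
    using R2 f by (rule Q.integrable_lipschitz_expansion) measurable
  have "(\<Sum>w\<in>words R n. \<nu> w * ?\<phi> w) - L = (\<integral>x. ?\<phi> (map x [0..<0 + n]) - L \<partial>Q)"
    using Q.window_integral[of ?\<phi> 0 n] by (simp add: Q.prob_space Q_win_block)
  also have "\<dots> \<le> (\<integral>x. birkhoff_seq R f n x \<partial>Q)"
  proof (rule integral_mono)
    show "integrable Q (\<lambda>x. ?\<phi> (map x [0..<0 + n]) - L)"
      using Q.window_integral(1)[of ?\<phi> 0 n] by simp
    show "integrable Q (birkhoff_seq R f n)"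
      unfolding birkhoff_seq_def using i by (intro Bochner_Integration.integrable_sum) auto
    show "?\<phi> (map x [0..<0 + n]) - L \<le> birkhoff_seq R f n x" if "x \<in> space Q" for x
      using birkhoff_seq_word[of R x f L n, OF R2 Q.digit_less[OF that] f] by simp
  qed
  also have "\<dots> = (\<Sum>j<n. \<integral>x. f (expansion R (\<lambda>k. x (j + k))) \<partial>Q)"
    unfolding birkhoff_seq_def using i by (subst Bochner_Integration.integral_sum) auto
  also have "\<dots> = real n * (\<integral>x. f (expansion R x) \<partial>Q.shift_average n)"
  proof -
    have "\<bar>f (expansion R x)\<bar> \<le> \<bar>f 0\<bar> + L" if "x \<in> space Q" for x
    proof -
      have "\<bar>expansion R x\<bar> \<le> 1" using R2 Q.digit_less[OF that] by (rule expansion_range)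
      then have "L * \<bar>expansion R x - 0\<bar> \<le> L * 1" using L by (intro mult_left_mono) auto
      then show ?thesis using f[of "expansion R x" 0] by linarith
    qed
    moreover have "(\<lambda>x. f (expansion R x)) \<in> borel_measurable Q" by measurable
    ultimately have "(\<integral>x. f (expansion R x) \<partial>Q.shift_average n)
        = (\<Sum>j<n. \<integral>x. f (expansion R (\<lambda>k. x (j + k))) \<partial>Q) / real n"
      by (intro Q.shift_average_integral[OF n_pos])
    then show ?thesis using n_pos by simp
  qed
  finally have "((\<Sum>w\<in>words R n. \<nu> w * ?\<phi> w) - L) / real n \<le> (\<integral>x. f (expansion R x) \<partial>Q.shift_average n)"
    using n_pos by (simp add: field_simps)
  with level3_entropy_average show ?thesis by (simp add: diff_divide_distrib)
qed

end

text \<open>Taking the Gibbs weights as block law is the equality case of Gibbs' inequality: energy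
  minus entropy of a block is exactly ln Z. Only the distortion L is lost on either side, so the
  estimate holds at each n and not just asymptotically.\<close>

theorem pressure_partition_sum:
  assumes R: "R \<ge> 2" and f: "\<And>a b. \<bar>f a - f b\<bar> \<le> L * \<bar>a - b\<bar>" and n: "n > 0"
  shows "\<bar>real n * pressure R f - ln (partition_sum R f n)\<bar> \<le> L"
proof -
  have "continuous_on UNIV f"
    using f f[of 0 1] by (intro lipschitz_on_continuous_on[of L] lipschitz_onI) (auto simp: dist_real_def)
  then have fm [measurable]: "f \<in> borel_measurable borel" by (rule borel_measurable_continuous_onI)
  let ?F = "\<lambda>P. (\<integral>x. f (expansion R x) \<partial>P) - level3_entropy (digit_measure R) P"
  let ?I = "shift_invariant_probs (digit_measure R)"
  let ?Z = "partition_sum R f n" and ?\<phi> = "birkhoff_word R f"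
  have upper: "?F P \<le> (ln ?Z + L) / real n" if "P \<in> ?I" for P
  proof -
    interpret invariant_process P R using that R by (intro invariant_processI) auto
    show ?thesis using R f fm n by (rule free_energy_le)
  qed
  have Z: "?Z > 0" using R by (intro partition_sum_pos) auto
  define \<nu> where "\<nu> w = exp (?\<phi> w) / (?Z * real R ^ n)" for w
  have S: "(\<Sum>w\<in>words R n. exp (?\<phi> w)) = ?Z * real R ^ n"
    using R by (simp add: partition_sum_def)
  have "?Z * real R ^ n \<noteq> 0" using Z R by simp
  then have sum1: "(\<Sum>w\<in>words R n. \<nu> w) = 1"
    unfolding \<nu>_def by (simp only: sum_divide_distrib[symmetric] S divide_self_if if_False)
  interpret block_weights R n \<nu>
    using R n Z sum1 by unfold_locales (auto simp: \<nu>_def)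
  have "Q.ent 0 n = (\<Sum>w\<in>words R n. \<nu> w * ln (\<nu> w)) + real n * ln (real R)"
    by (simp add: Q.ent_def Q_win_block)
  also have "(\<Sum>w\<in>words R n. \<nu> w * ln (\<nu> w))
      = (\<Sum>w\<in>words R n. \<nu> w * ?\<phi> w - \<nu> w * (ln ?Z + real n * ln (real R)))"
    using Z R by (intro sum.cong refl) (simp add: \<nu>_def ln_div ln_mult ln_realpow right_diff_distrib)
  also have "\<dots> = (\<Sum>w\<in>words R n. \<nu> w * ?\<phi> w) - (ln ?Z + real n * ln (real R))"
    unfolding sum_subtractf sum_distrib_right[symmetric] by (simp add: sum1)
  finally have "(\<Sum>w\<in>words R n. \<nu> w * ?\<phi> w) - L - Q.ent 0 n = ln ?Z - L" by linarith
  then have lower: "(ln ?Z - L) / real n \<le> ?F (Q.shift_average n)"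
    using free_energy_average_ge[OF f fm] by (simp only:)
  \<comment> \<open>A supremum of reals is meaningful only for a set bounded above.\<close>
  have bdd: "bdd_above (?F ` ?I)" using upper by (intro bdd_aboveI2[of _ _ "(ln ?Z + L) / real n"])
  have "(ln ?Z - L) / real n \<le> pressure R f"
    unfolding pressure_def using average_in_probs bdd lower by (intro cSUP_upper2)
  moreover have "pressure R f \<le> (ln ?Z + L) / real n"
    unfolding pressure_def using average_in_probs upper by (intro cSUP_least) auto
  ultimately show ?thesis using n by (simp add: field_simps abs_le_iff)
qed

section \<open>Euler chains with Gaussian increments\<close>

definition gauss :: "real \<Rightarrow> real measure" where
  "gauss \<sigma> = density lborel (\<lambda>x. ennreal (normal_density 0 \<sigma> x))"

lemma sets_gauss [simp, measurable_cong]: "sets (gauss \<sigma>) = sets borel"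
  by (simp add: gauss_def)

lemma space_gauss [simp]: "space (gauss \<sigma>) = UNIV"
  by (simp add: gauss_def)

lemma prob_space_gauss: "\<sigma> > 0 \<Longrightarrow> prob_space (gauss \<sigma>)"
  unfolding gauss_def by (rule prob_space_normal_density)

lemma gauss_moments:
  assumes "\<sigma> > 0"
  shows "integrable (gauss \<sigma>) (\<lambda>z. z)" "(\<integral>z. z \<partial>gauss \<sigma>) = 0"
    and "integrable (gauss \<sigma>) (\<lambda>z. z\<^sup>2)" "(\<integral>z. z\<^sup>2 \<partial>gauss \<sigma>) = \<sigma>\<^sup>2"
    and "integrable (gauss \<sigma>) (\<lambda>z. \<bar>z\<bar> ^ 3)" "(\<integral>z. \<bar>z\<bar> ^ 3 \<partial>gauss \<sigma>) \<le> 2 * \<sigma> ^ 3"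
proof -
  note gauss_def [simp] integrable_density [simp] integral_density [simp]
  show "integrable (gauss \<sigma>) (\<lambda>z. z)" "(\<integral>z. z \<partial>gauss \<sigma>) = 0"
    using integrable_normal_moment_nz_1[OF assms, of 0] integral_normal_moment_nz_1[OF assms, of 0] by simp_all
  show "integrable (gauss \<sigma>) (\<lambda>z. z\<^sup>2)" "(\<integral>z. z\<^sup>2 \<partial>gauss \<sigma>) = \<sigma>\<^sup>2"
    using integrable_normal_moment[OF assms, of 0 2] integral_normal_moment_even[OF assms, of 0 1]
    by (simp_all add: fact_2)
  show "integrable (gauss \<sigma>) (\<lambda>z. \<bar>z\<bar> ^ 3)"
    using integrable_normal_moment_abs[OF assms, of 0 3] by simp
  have "(\<integral>z. \<bar>z\<bar> ^ 3 \<partial>gauss \<sigma>) = 2 * \<sigma> ^ 3 * sqrt (2 / pi)"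
    using integral_normal_moment_abs_odd[OF assms, of 0 1] by (simp add: eval_nat_numeral)
  also have "\<dots> \<le> 2 * \<sigma> ^ 3 * 1"
    using assms pi_ge_two by (intro mult_left_mono) auto
  finally show "(\<integral>z. \<bar>z\<bar> ^ 3 \<partial>gauss \<sigma>) \<le> 2 * \<sigma> ^ 3" by simp
qed

lemma abs_add_cube_le: "\<bar>a + z\<bar> ^ 3 \<le> 4 * (\<bar>a\<bar> ^ 3 + \<bar>z\<bar> ^ 3)" for a z :: real
proof -
  have "\<bar>a + z\<bar> ^ 3 \<le> (\<bar>a\<bar> + \<bar>z\<bar>) ^ 3" by (intro power_mono) auto
  moreover have "4 * (\<bar>a\<bar> ^ 3 + \<bar>z\<bar> ^ 3) - (\<bar>a\<bar> + \<bar>z\<bar>) ^ 3 = 3 * (\<bar>a\<bar> + \<bar>z\<bar>) * (\<bar>a\<bar> - \<bar>z\<bar>)\<^sup>2"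
    by (simp add: power2_eq_square power3_eq_cube algebra_simps)
  moreover have "0 \<le> 3 * (\<bar>a\<bar> + \<bar>z\<bar>) * (\<bar>a\<bar> - \<bar>z\<bar>)\<^sup>2" by simp
  ultimately show ?thesis by linarith
qed

text \<open>The remainder is of order h^(3/2), so over T / h steps the errors add up to order sqrt
  h. \<open>D1\<close> and \<open>D2\<close> are mere numbers for which the expansion at x holds
  with every d; f may jump away from x, as the cut-off test functions do.\<close>

lemma gauss_one_step:
  fixes f :: "real \<Rightarrow> real"
  assumes f [measurable]: "f \<in> borel_measurable borel" and Bf: "\<And>y. \<bar>f y\<bar> \<le> Bf"
    and taylor: "\<And>d. \<bar>f (x + d) - f x - D1 * d - D2 * d\<^sup>2 / 2\<bar> \<le> K * \<bar>d\<bar> ^ 3"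
    and a: "\<bar>a\<bar> \<le> A * h" and D2: "\<bar>D2\<bar> \<le> C" and h: "0 < h" "h \<le> 1"
  shows "\<bar>(\<integral>z. f (x + a + z) \<partial>gauss (sqrt h)) - (f x + D1 * a + D2 * h / 2)\<bar>
    \<le> (C * A\<^sup>2 / 2 + 4 * K * A ^ 3 + 8 * K) * (h * sqrt h)"
proof -
  let ?G = "gauss (sqrt h)"
  have s: "sqrt h > 0" using h by simp
  interpret G: prob_space ?G using s by (rule prob_space_gauss)
  have G1: "G.prob UNIV = 1" using G.prob_space by simp
  note m = gauss_moments[OF s]
  have K: "0 \<le> K" using order_trans[OF abs_ge_zero taylor[of 1]] by simp
  have A: "0 \<le> A" using order_trans[OF abs_ge_zero a] h by (simp add: zero_le_mult_iff)
  \<comment> \<open>Quadratic in z, so its Gaussian mean follows exactly from two moments; only the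
    cubic remainder has to be estimated.\<close>
  define p where "p z = f x + D1 * (a + z) + D2 * (a + z)\<^sup>2 / 2" for z
  have p_eq: "p z = (f x + D1 * a + D2 * a\<^sup>2 / 2) + (D1 + D2 * a) * z + (D2 / 2) * z\<^sup>2" for z
    by (simp add: p_def power2_eq_square field_simps)
  have ip: "integrable ?G p" unfolding p_eq using m(1,3) by (intro Bochner_Integration.integrable_add) auto
  have int_p: "(\<integral>z. p z \<partial>?G) = f x + D1 * a + D2 * a\<^sup>2 / 2 + D2 / 2 * h"
    unfolding p_eq using m h by (simp add: G1)
  have fi: "integrable ?G (\<lambda>z. f (x + a + z))"
    using Bf by (intro G.integrable_const_bound[of _ Bf]) auto
  have bound: "\<bar>f (x + a + z) - p z\<bar> \<le> 4 * K * \<bar>a\<bar> ^ 3 + 4 * K * \<bar>z\<bar> ^ 3" for z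
  proof -
    have "\<bar>f (x + a + z) - p z\<bar> \<le> K * \<bar>a + z\<bar> ^ 3"
      using taylor[of "a + z"] by (simp add: p_def algebra_simps)
    also have "\<dots> \<le> K * (4 * (\<bar>a\<bar> ^ 3 + \<bar>z\<bar> ^ 3))"
      using K by (intro mult_left_mono abs_add_cube_le)
    finally show ?thesis by (simp add: algebra_simps)
  qed
  have "\<bar>(\<integral>z. f (x + a + z) \<partial>?G) - (\<integral>z. p z \<partial>?G)\<bar> = \<bar>\<integral>z. f (x + a + z) - p z \<partial>?G\<bar>"
    using fi ip by simp
  also have "\<dots> \<le> (\<integral>z. 4 * K * \<bar>a\<bar> ^ 3 + 4 * K * \<bar>z\<bar> ^ 3 \<partial>?G)"
    using m fi ip bound by (intro order_trans[OF integral_abs_bound] integral_mono) auto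
  also have "\<dots> = 4 * K * \<bar>a\<bar> ^ 3 + 4 * K * (\<integral>z. \<bar>z\<bar> ^ 3 \<partial>?G)"
    using m by (simp add: G1)
  also have "\<dots> \<le> 4 * K * (A * h) ^ 3 + 4 * K * (2 * sqrt h ^ 3)"
    using a K m by (intro add_mono mult_left_mono power_mono) auto
  finally have 1: "\<bar>(\<integral>z. f (x + a + z) \<partial>?G) - (\<integral>z. p z \<partial>?G)\<bar> \<le> 4 * K * A ^ 3 * h ^ 3 + 8 * K * sqrt h ^ 3"
    by (simp add: power_mult_distrib mult.assoc)
  have hs: "sqrt h ^ 3 = h * sqrt h" using h by (simp add: power3_eq_cube)
  have "h \<le> sqrt h"
    using h mult_left_le[of h h] by (intro real_le_rsqrt) (simp add: power2_eq_square)
  then have "h * h \<le> h * sqrt h" using h by (intro mult_left_mono) auto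
  then have h2: "h\<^sup>2 \<le> h * sqrt h" by (simp add: power2_eq_square)
  have "h ^ 3 \<le> h\<^sup>2" using h by (intro power_decreasing) auto
  then have h3: "h ^ 3 \<le> h * sqrt h" using h2 by simp
  have "\<bar>D2 * a\<^sup>2 / 2\<bar> \<le> C * (A * h)\<^sup>2 / 2"
  proof -
    have "a\<^sup>2 \<le> (A * h)\<^sup>2" using power_mono[OF a abs_ge_zero, of 2] by simp
    then have "\<bar>D2\<bar> * a\<^sup>2 \<le> C * (A * h)\<^sup>2" using D2 by (intro mult_mono) auto
    then show ?thesis by (simp add: abs_mult)
  qed
  also have "\<dots> \<le> C * A\<^sup>2 / 2 * (h * sqrt h)"
  proof -
    have "0 \<le> C * A\<^sup>2 / 2" using D2 by simp
    from mult_left_mono[OF h2 this] show ?thesis by (simp add: power_mult_distrib)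
  qed
  finally have 2: "\<bar>D2 * a\<^sup>2 / 2\<bar> \<le> C * A\<^sup>2 / 2 * (h * sqrt h)" .
  have 3: "4 * K * A ^ 3 * h ^ 3 \<le> 4 * K * A ^ 3 * (h * sqrt h)"
    using h3 K A by (intro mult_left_mono) auto
  have "\<bar>(\<integral>z. f (x + a + z) \<partial>?G) - (f x + D1 * a + D2 * h / 2)\<bar>
      \<le> \<bar>(\<integral>z. f (x + a + z) \<partial>?G) - (\<integral>z. p z \<partial>?G)\<bar> + \<bar>D2 * a\<^sup>2 / 2\<bar>"
    unfolding int_p by (simp add: algebra_simps)
  also have "\<dots> \<le> 4 * K * A ^ 3 * (h * sqrt h) + 8 * K * (h * sqrt h) + C * A\<^sup>2 / 2 * (h * sqrt h)"
    using 1 2 3 unfolding hs by linarith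
  finally show ?thesis by (simp add: algebra_simps)
qed

text \<open>Fubini for the joint law: conditioning on X amounts to integrating Z out with its own
  law.\<close>

lemma (in prob_space) indep_var_integral:
  fixes \<phi> :: "'b \<times> 'b \<Rightarrow> real"
  assumes ind: "indep_var S X T Z" and \<phi>: "\<phi> \<in> borel_measurable (S \<Otimes>\<^sub>M T)" and B: "\<And>p. \<bar>\<phi> p\<bar> \<le> B"
  shows "(\<integral>w. \<phi> (X w, Z w) \<partial>M) = (\<integral>w. (\<integral>z. \<phi> (X w, z) \<partial>distr M T Z) \<partial>M)"
proof -
  have X [measurable]: "X \<in> measurable M S" and Z [measurable]: "Z \<in> measurable M T"
    and eq: "distr M S X \<Otimes>\<^sub>M distr M T Z = distr M (S \<Otimes>\<^sub>M T) (\<lambda>w. (X w, Z w))"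
    using ind unfolding indep_var_distribution_eq by auto
  interpret X: prob_space "distr M S X" by (rule prob_space_distr[OF X])
  interpret Z: prob_space "distr M T Z" by (rule prob_space_distr[OF Z])
  interpret XZ: pair_prob_space "distr M S X" "distr M T Z" ..
  have \<phi>': "\<phi> \<in> borel_measurable (distr M S X \<Otimes>\<^sub>M distr M T Z)"
    by (subst measurable_cong_sets[OF sets_pair_measure_cong[OF sets_distr sets_distr] refl]) (rule \<phi>)
  have i: "integrable (distr M S X \<Otimes>\<^sub>M distr M T Z) \<phi>"
    using B \<phi>' by (intro XZ.P.integrable_const_bound[of _ B]) auto
  have "(\<integral>w. \<phi> (X w, Z w) \<partial>M) = (\<integral>p. \<phi> p \<partial>distr M (S \<Otimes>\<^sub>M T) (\<lambda>w. (X w, Z w)))"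
    using \<phi> by (subst integral_distr) auto
  also have "\<dots> = (\<integral>x. (\<integral>z. \<phi> (x, z) \<partial>distr M T Z) \<partial>distr M S X)"
    unfolding eq[symmetric] by (rule XZ.integral_fst'[OF i, symmetric])
  also have "\<dots> = (\<integral>w. (\<integral>z. \<phi> (X w, z) \<partial>distr M T Z) \<partial>M)"
  proof (rule integral_distr[OF X])
    show "(\<lambda>x. \<integral>z. \<phi> (x, z) \<partial>distr M T Z) \<in> borel_measurable S"
      by (intro Z.borel_measurable_lebesgue_integral,
          subst measurable_cong_sets[OF sets_pair_measure_cong[OF refl sets_distr] refl])
        (simp add: \<phi> case_prod_eta)
  qed
  finally show ?thesis .
qed

section \<open>The Euler chain, its exit time and a discrete Dynkin formula\<close>

primrec euler :: "(real \<Rightarrow> real) \<Rightarrow> real \<Rightarrow> (nat \<Rightarrow> real) \<Rightarrow> nat \<Rightarrow> real" where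
  "euler b h v 0 = 0"
| "euler b h v (Suc k) = euler b h v k + h * b (euler b h v k) + v k"

definition alive :: "(real \<Rightarrow> real) \<Rightarrow> real \<Rightarrow> real \<Rightarrow> (nat \<Rightarrow> real) \<Rightarrow> nat \<Rightarrow> real" where
  "alive b h r v k = (if \<forall>j\<le>k. \<bar>euler b h v j\<bar> < r then 1 else 0)"

text \<open>The indicators are nonincreasing in k, so their sum is the first exit index, capped at
  n.\<close>

definition alive_steps :: "(real \<Rightarrow> real) \<Rightarrow> real \<Rightarrow> real \<Rightarrow> (nat \<Rightarrow> real) \<Rightarrow> nat \<Rightarrow> real" where
  "alive_steps b h r v n = (\<Sum>k<n. alive b h r v k)"

text \<open>The value of f at the stopped chain, written as a telescoping sum so that expectations
  can be taken one step at a time.\<close>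

definition stopped :: "(real \<Rightarrow> real) \<Rightarrow> (real \<Rightarrow> real) \<Rightarrow> real \<Rightarrow> real \<Rightarrow> (nat \<Rightarrow> real) \<Rightarrow> nat \<Rightarrow> real" where
  "stopped f b h r v n = f 0 + (\<Sum>k<n. alive b h r v k * (f (euler b h v (Suc k)) - f (euler b h v k)))"

text \<open>Adaptedness: the position at time k is a function of the first k increments only, which
  is what independence of the next one is played against.\<close>

lemma euler_restrict: "k \<le> m \<Longrightarrow> euler b h (restrict v {..<m}) k = euler b h v k"
  by (induction k) auto

lemma alive_restrict: "k \<le> m \<Longrightarrow> alive b h r (restrict v {..<m}) k = alive b h r v k"
  by (simp add: alive_def euler_restrict)

lemma alive_bounds: "0 \<le> alive b h r v k" "alive b h r v k \<le> 1"
  by (auto simp: alive_def)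

lemma euler_measurable:
  assumes [measurable]: "b \<in> borel_measurable borel" and "k \<le> m"
  shows "(\<lambda>v. euler b h v k) \<in> borel_measurable (PiM {..<m} (\<lambda>_. borel))"
  using assms(2)
proof (induction k)
  case (Suc k)
  then have [measurable]: "(\<lambda>v. euler b h v k) \<in> borel_measurable (PiM {..<m} (\<lambda>_. borel))" by simp
  have [measurable]: "(\<lambda>v. v k) \<in> borel_measurable (PiM {..<m} (\<lambda>_. borel))"
    using Suc.prems by (intro measurable_component_singleton) auto
  show ?case by simp
qed simp

lemma alive_measurable:
  assumes [measurable]: "b \<in> borel_measurable borel" and "k \<le> m"
  shows "(\<lambda>v. alive b h r v k) \<in> borel_measurable (PiM {..<m} (\<lambda>_. borel))"
proof -
  have "Measurable.pred (PiM {..<m} (\<lambda>_. borel)) (\<lambda>v. \<bar>euler b h v j\<bar> < r)" if "j \<le> k" for j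
  proof -
    have [measurable]: "(\<lambda>v. euler b h v j) \<in> borel_measurable (PiM {..<m} (\<lambda>_. borel))"
      using assms that by (intro euler_measurable) auto
    show ?thesis by measurable
  qed
  then have "Measurable.pred (PiM {..<m} (\<lambda>_. borel)) (\<lambda>v. \<forall>j\<in>{..k}. \<bar>euler b h v j\<bar> < r)"
    by (intro pred_intros_finite) auto
  then have "{v \<in> space (PiM {..<m} (\<lambda>_. borel)). \<forall>j\<le>k. \<bar>euler b h v j\<bar> < r} \<in> sets (PiM {..<m} (\<lambda>_. borel))"
    by (simp only: Ball_def atMost_iff pred_def)
  then show ?thesis
    unfolding alive_def by (rule measurable_If[OF borel_measurable_const borel_measurable_const])
qed

text \<open>Of the exit point only the bound by r from below is recorded, since a Gaussian step may
  overshoot by any amount. The sign of f is therefore controlled on the whole outside later.\<close>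

lemma stopped_cases:
  "(if \<forall>j<n. \<bar>euler b h v j\<bar> < r then stopped f b h r v n = f (euler b h v n)
    else \<exists>k. r \<le> \<bar>euler b h v k\<bar> \<and> stopped f b h r v n = f (euler b h v k))"
proof (induction n)
  case (Suc n)
  have step: "stopped f b h r v (Suc n) = stopped f b h r v n
      + alive b h r v n * (f (euler b h v (Suc n)) - f (euler b h v n))"
    by (simp add: stopped_def)
  show ?case
  proof (cases "\<forall>j<Suc n. \<bar>euler b h v j\<bar> < r")
    case True
    then have "alive b h r v n = 1" by (simp add: alive_def less_Suc_eq_le)
    then show ?thesis using True Suc step by simp
  next
    case False
    then have a: "alive b h r v n = 0" by (auto simp: alive_def less_Suc_eq_le)
    show ?thesis
    proof (cases "\<forall>j<n. \<bar>euler b h v j\<bar> < r")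
      case True
      then have "r \<le> \<bar>euler b h v n\<bar>" using False by (auto simp: less_Suc_eq not_less)
      then show ?thesis using False True Suc step a by auto
    next
      case F: False
      then show ?thesis using False Suc step a by auto
    qed
  qed
qed (simp add: stopped_def)

lemma alive_steps_eq: "\<forall>j<n. \<bar>euler b h v j\<bar> < r \<Longrightarrow> alive_steps b h r v n = real n"
  by (simp add: alive_steps_def alive_def)

lemma alive_steps_bounds: "0 \<le> alive_steps b h r v n" "alive_steps b h r v n \<le> real n"
proof -
  show "0 \<le> alive_steps b h r v n" unfolding alive_steps_def by (intro sum_nonneg alive_bounds)
  have "alive_steps b h r v n \<le> (\<Sum>k<n. 1)" unfolding alive_steps_def by (intro sum_mono alive_bounds)
  then show "alive_steps b h r v n \<le> real n" by simp
qed

locale gaussian_increments = prob_space M for M :: "'w measure" +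
  fixes D :: "nat \<Rightarrow> 'w \<Rightarrow> real" and n :: nat and h :: real and b :: "real \<Rightarrow> real"
  assumes h: "0 < h" "h \<le> 1"
    and indep: "indep_vars (\<lambda>_. borel) D {..<n}"
    and normal: "\<And>k. k < n \<Longrightarrow> distributed M lborel (D k) (normal_density 0 (sqrt h))"
    and b [measurable]: "b \<in> borel_measurable borel"
begin

abbreviation "incr w \<equiv> (\<lambda>k. D k w)"

lemma D_measurable: "k < n \<Longrightarrow> D k \<in> borel_measurable M"
  using distributed_measurable[OF normal] by simp

lemma distr_D: "k < n \<Longrightarrow> distr M borel (D k) = gauss (sqrt h)"
  using distributed_distr_eq_density[OF normal] unfolding gauss_def
  by (simp add: distr_cong[of M M borel lborel])

lemma restrict_measurable: "m \<le> n \<Longrightarrow> (\<lambda>w. restrict (incr w) {..<m}) \<in> measurable M (PiM {..<m} (\<lambda>_. borel))"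
  using D_measurable by (intro measurable_restrict) auto

lemma euler_incr_measurable: "k \<le> n \<Longrightarrow> (\<lambda>w. euler b h (incr w) k) \<in> borel_measurable M"
  using measurable_compose[OF restrict_measurable[of n] euler_measurable[of b k n h]] by (simp add: euler_restrict)

lemma alive_incr_measurable: "k \<le> n \<Longrightarrow> (\<lambda>w. alive b h r (incr w) k) \<in> borel_measurable M"
  using measurable_compose[OF restrict_measurable[of n] alive_measurable[of b k n h r]] by (simp add: alive_restrict)

lemma alive_steps_measurable: "(\<lambda>w. alive_steps b h r (incr w) n) \<in> borel_measurable M"
  unfolding alive_steps_def using alive_incr_measurable by (intro borel_measurable_sum) auto

text \<open>Given the first k increments, the next one is an independent Gaussian, so the inner mean
  is the one-step estimate; survival is decided by the past and weights it by 0 or 1.\<close>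

lemma step_expectation:
  assumes f [measurable]: "f \<in> borel_measurable borel" and Bf: "\<And>y. \<bar>f y\<bar> \<le> Bf" and k: "k < n"
    and C: "0 \<le> C"
    and step: "\<And>x. \<bar>x\<bar> < r \<Longrightarrow> \<bar>(\<integral>z. f (x + h * b x + z) \<partial>gauss (sqrt h)) - f x + h\<bar> \<le> C"
  shows "\<bar>\<integral>w. alive b h r (incr w) k * (f (euler b h (incr w) (Suc k)) - f (euler b h (incr w) k) + h) \<partial>M\<bar> \<le> C"
    (is "\<bar>\<integral>w. ?L w \<partial>M\<bar> \<le> C")
proof -
  let ?S = "PiM {..<k} (\<lambda>_. borel :: real measure)"
  let ?T = "PiM {k} (\<lambda>_. borel :: real measure)"
  let ?X = "\<lambda>w. restrict (incr w) {..<k}" and ?Z = "\<lambda>w. restrict (incr w) {k}"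
  define \<phi> where "\<phi> = (\<lambda>(v, z). alive b h r v k * (f (euler b h v k + h * b (euler b h v k) + z) - f (euler b h v k) + h))"
  \<comment> \<open>\<open>indep_var_restrict\<close> gives independence of the families on {..<k}
    and on {k}, so the single increment enters as a function with one coordinate.\<close>
  define \<psi> where "\<psi> p = \<phi> (fst p, snd p k)" for p :: "(nat \<Rightarrow> real) \<times> (nat \<Rightarrow> real)"
  interpret G: prob_space "gauss (sqrt h)" using h by (intro prob_space_gauss) simp
  have G1: "G.prob UNIV = 1" using G.prob_space by simp
  have [measurable]: "(\<lambda>v. euler b h v k) \<in> borel_measurable ?S" "(\<lambda>v. alive b h r v k) \<in> borel_measurable ?S"
    by (auto intro: euler_measurable alive_measurable)
  have \<phi>m: "\<phi> \<in> borel_measurable (?S \<Otimes>\<^sub>M borel)" unfolding \<phi>_def by measurable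
  have \<phi>B: "\<bar>\<phi> p\<bar> \<le> 2 * Bf + h" for p
  proof -
    obtain v z where p: "p = (v, z)" by (cases p)
    let ?d = "f (euler b h v k + h * b (euler b h v k) + z) - f (euler b h v k) + h"
    have "\<bar>?d\<bar> \<le> 2 * Bf + h"
      using Bf[of "euler b h v k + h * b (euler b h v k) + z"] Bf[of "euler b h v k"] h by linarith
    then show ?thesis using Bf[of 0] h by (auto simp: p \<phi>_def alive_def)
  qed
  have "indep_var (PiM {..<k} (\<lambda>_. borel)) ?X (PiM {k} (\<lambda>_. borel)) (\<lambda>w. restrict (incr w) {k})"
    using k by (intro indep_var_restrict[OF indep]) auto
  then have ind: "indep_var ?S ?X ?T ?Z" .
  have \<psi>m: "\<psi> \<in> borel_measurable (?S \<Otimes>\<^sub>M ?T)"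
    unfolding \<psi>_def by (rule measurable_compose[OF _ \<phi>m]) measurable
  have \<psi>B: "\<bar>\<psi> p\<bar> \<le> 2 * Bf + h" for p
    using \<phi>B by (simp add: \<psi>_def)
  have inner_eq: "(\<integral>u. \<psi> (v, u) \<partial>distr M ?T ?Z) = (\<integral>z. \<phi> (v, z) \<partial>gauss (sqrt h))"
    if v: "v \<in> space ?S" for v
  proof -
    have \<phi>v: "(\<lambda>z. \<phi> (v, z)) \<in> borel_measurable borel"
      using v by (intro measurable_compose[OF measurable_Pair1' \<phi>m])
    have Z: "?Z \<in> measurable M ?T" using D_measurable k by (intro measurable_restrict) auto
    have "(\<integral>u. \<psi> (v, u) \<partial>distr M ?T ?Z) = (\<integral>w. \<psi> (v, ?Z w) \<partial>M)"
    proof (rule integral_distr[OF Z])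
      have "(\<lambda>u. u k) \<in> borel_measurable ?T" by (intro measurable_component_singleton) simp
      then show "(\<lambda>u. \<psi> (v, u)) \<in> borel_measurable ?T"
        unfolding \<psi>_def using \<phi>v by simp
    qed
    also have "\<dots> = (\<integral>w. \<phi> (v, D k w) \<partial>M)" by (simp add: \<psi>_def)
    also have "\<dots> = (\<integral>z. \<phi> (v, z) \<partial>distr M borel (D k))"
      using D_measurable[OF k] \<phi>v by (intro integral_distr[symmetric])
    finally show ?thesis by (simp add: distr_D[OF k])
  qed
  have "(\<integral>w. ?L w \<partial>M) = (\<integral>w. \<phi> (?X w, D k w) \<partial>M)"
    by (simp add: \<phi>_def euler_restrict alive_restrict)
  also have "\<dots> = (\<integral>w. \<psi> (?X w, ?Z w) \<partial>M)" by (simp add: \<psi>_def)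
  also have "\<dots> = (\<integral>w. (\<integral>u. \<psi> (?X w, u) \<partial>distr M ?T ?Z) \<partial>M)"
    by (rule indep_var_integral[OF ind \<psi>m \<psi>B])
  also have "\<dots> = (\<integral>w. (\<integral>z. \<phi> (?X w, z) \<partial>gauss (sqrt h)) \<partial>M)"
    by (intro Bochner_Integration.integral_cong refl inner_eq) (simp add: space_PiM)
  finally have eq: "(\<integral>w. ?L w \<partial>M) = (\<integral>w. (\<integral>z. \<phi> (?X w, z) \<partial>gauss (sqrt h)) \<partial>M)" .
  have inner: "\<bar>\<integral>z. \<phi> (?X w, z) \<partial>gauss (sqrt h)\<bar> \<le> C" for w
  proof (cases "alive b h r (incr w) k = 0")
    case False
    let ?x = "euler b h (incr w) k"
    have a: "alive b h r (incr w) k = 1" and x: "\<bar>?x\<bar> < r"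
      using False by (auto simp: alive_def split: if_splits)
    have i: "integrable (gauss (sqrt h)) (\<lambda>z. f (?x + h * b ?x + z))"
      using Bf by (intro G.integrable_const_bound[of _ Bf]) auto
    have "(\<integral>z. \<phi> (?X w, z) \<partial>gauss (sqrt h)) = (\<integral>z. f (?x + h * b ?x + z) - f ?x + h \<partial>gauss (sqrt h))"
      using a by (simp add: \<phi>_def euler_restrict alive_restrict)
    also have "\<dots> = (\<integral>z. f (?x + h * b ?x + z) \<partial>gauss (sqrt h)) - f ?x + h"
      using i by (simp add: G1)
    finally show ?thesis using step[OF x] by simp
  qed (use C in \<open>simp add: \<phi>_def euler_restrict alive_restrict\<close>)
  have "\<bar>\<integral>w. ?L w \<partial>M\<bar> \<le> C"
  proof -
    have "(\<lambda>w. \<integral>z. \<phi> (?X w, z) \<partial>gauss (sqrt h)) \<in> borel_measurable M"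
    proof (rule measurable_compose[OF restrict_measurable])
      show "(\<lambda>v. \<integral>z. \<phi> (v, z) \<partial>gauss (sqrt h)) \<in> borel_measurable ?S"
        by (intro G.borel_measurable_lebesgue_integral,
            subst measurable_cong_sets[OF sets_pair_measure_cong[OF refl sets_gauss] refl])
          (simp add: \<phi>m case_prod_eta)
    qed (use k in simp)
    then have "integrable M (\<lambda>w. \<integral>z. \<phi> (?X w, z) \<partial>gauss (sqrt h))"
      using inner by (intro integrable_const_bound[of _ "C"]) auto
    then show ?thesis unfolding eq using inner
      by (intro order_trans[OF integral_abs_bound] integral_le_const) auto
  qed
  then show ?thesis .
qed

lemma stopped_measurable:
  assumes [measurable]: "f \<in> borel_measurable borel"
  shows "(\<lambda>w. stopped f b h r (incr w) n) \<in> borel_measurable M"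
proof -
  have "(\<lambda>w. alive b h r (incr w) k * (f (euler b h (incr w) (Suc k)) - f (euler b h (incr w) k))) \<in> borel_measurable M"
    if "k \<in> {..<n}" for k
  proof -
    have [measurable]: "(\<lambda>w. alive b h r (incr w) k) \<in> borel_measurable M"
      "(\<lambda>w. euler b h (incr w) k) \<in> borel_measurable M" "(\<lambda>w. euler b h (incr w) (Suc k)) \<in> borel_measurable M"
      using that by (auto intro!: alive_incr_measurable euler_incr_measurable simp del: euler.simps)
    show ?thesis by measurable
  qed
  then show ?thesis unfolding stopped_def by (intro borel_measurable_add borel_measurable_sum) auto
qed

lemma abs_stopped_le:
  assumes "\<And>y. \<bar>f y\<bar> \<le> Bf" shows "\<bar>stopped f b h r v n\<bar> \<le> Bf"
  using stopped_cases[of n b h v r f] assms by (auto split: if_splits)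

text \<open>Discrete Dynkin formula: if the mean of f drops by about h per step, then the stopped
  value plus h times the number of steps keeps its mean, up to n one-step errors.\<close>

lemma stopped_expectation:
  assumes f [measurable]: "f \<in> borel_measurable borel" and Bf: "\<And>y. \<bar>f y\<bar> \<le> Bf" and C: "0 \<le> C"
    and step: "\<And>x. \<bar>x\<bar> < r \<Longrightarrow> \<bar>(\<integral>z. f (x + h * b x + z) \<partial>gauss (sqrt h)) - f x + h\<bar> \<le> C"
  shows "\<bar>(\<integral>w. stopped f b h r (incr w) n \<partial>M) + h * (\<integral>w. alive_steps b h r (incr w) n \<partial>M) - f 0\<bar> \<le> real n * C"
proof -
  let ?s = "\<lambda>k w. alive b h r (incr w) k * (f (euler b h (incr w) (Suc k)) - f (euler b h (incr w) k) + h)"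
  have ist: "integrable M (\<lambda>w. stopped f b h r (incr w) n)"
    using abs_stopped_le[of f Bf] Bf by (intro integrable_const_bound[of _ Bf] stopped_measurable) auto
  have ia: "integrable M (\<lambda>w. alive_steps b h r (incr w) n)"
    using alive_steps_bounds[of b h r _ n]
    by (intro integrable_const_bound[of _ "real n"] alive_steps_measurable) auto
  have ik: "integrable M (?s k)" if k: "k \<in> {..<n}" for k
  proof (rule integrable_const_bound[of _ "2 * Bf + h"])
    have "\<bar>?s k w\<bar> \<le> 2 * Bf + h" for w
    proof -
      have "\<bar>f (euler b h (incr w) (Suc k)) - f (euler b h (incr w) k) + h\<bar> \<le> 2 * Bf + h"
        using Bf[of "euler b h (incr w) (Suc k)"] Bf[of "euler b h (incr w) k"] h by linarith
      then show ?thesis using Bf[of 0] h by (auto simp: alive_def simp del: euler.simps)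
    qed
    then show "AE w in M. norm (?s k w) \<le> 2 * Bf + h" by (simp del: euler.simps)
    have [measurable]: "(\<lambda>w. alive b h r (incr w) k) \<in> borel_measurable M"
      "(\<lambda>w. euler b h (incr w) k) \<in> borel_measurable M" "(\<lambda>w. euler b h (incr w) (Suc k)) \<in> borel_measurable M"
      using k by (auto intro!: alive_incr_measurable euler_incr_measurable simp del: euler.simps)
    show "?s k \<in> borel_measurable M" by measurable
  qed
  have "(\<integral>w. stopped f b h r (incr w) n \<partial>M) + h * (\<integral>w. alive_steps b h r (incr w) n \<partial>M) - f 0
      = (\<integral>w. stopped f b h r (incr w) n + h * alive_steps b h r (incr w) n - f 0 \<partial>M)"
    using ist ia by (simp add: prob_space)
  also have "\<dots> = (\<integral>w. (\<Sum>k<n. ?s k w) \<partial>M)"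
    unfolding stopped_def alive_steps_def
    by (simp add: sum_distrib_left sum.distrib[symmetric] algebra_simps del: euler.simps)
  also have "\<dots> = (\<Sum>k<n. \<integral>w. ?s k w \<partial>M)"
    using ik by (intro Bochner_Integration.integral_sum)
  finally have "\<bar>(\<integral>w. stopped f b h r (incr w) n \<partial>M) + h * (\<integral>w. alive_steps b h r (incr w) n \<partial>M) - f 0\<bar>
      = \<bar>\<Sum>k<n. \<integral>w. ?s k w \<partial>M\<bar>" by simp
  also have "\<dots> \<le> (\<Sum>k<n. C)"
    using step_expectation[OF f Bf _ C step] by (intro order_trans[OF sum_abs] sum_mono) auto
  finally show ?thesis by simp
qed

end

section \<open>Pathwise convergence of the Euler chain\<close>

text \<open>Discrete Gronwall inequality. The noise increments are exact, so only the drift is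
  approximated, and an error e becomes at most (1 + L h) e + L h \<omega> in one step.\<close>

lemma euler_error:
  fixes y :: "real \<Rightarrow> real"
  assumes cont: "continuous_on {0..} y" and y0: "y 0 = 0"
    and b: "\<And>u v. \<bar>b u - b v\<bar> \<le> L * \<bar>u - v\<bar>" and h: "0 < h"
    and step: "\<And>k. k < n \<Longrightarrow> y (real (Suc k) * h) = y (real k * h) + v k
        + integral {real k * h..real (Suc k) * h} (\<lambda>s. b (y s))"
    and osc: "\<And>k s. k < n \<Longrightarrow> s \<in> {real k * h..real (Suc k) * h} \<Longrightarrow> \<bar>y s - y (real k * h)\<bar> \<le> \<omega>"
    and "0 \<le> \<omega>" and "k \<le> n"
  shows "\<bar>euler b h v k - y (real k * h)\<bar> \<le> \<omega> * ((1 + L * h) ^ k - 1)"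
  using \<open>k \<le> n\<close>
proof (induction k)
  case 0 then show ?case using y0 by simp
next
  case (Suc k)
  have L: "0 \<le> L" using b[of 0 1] by simp
  let ?I = "{real k * h..real (Suc k) * h}" and ?X = "euler b h v k"
  have le: "real k * h \<le> real (Suc k) * h" using h by simp
  have bc: "continuous_on UNIV b"
    using b L by (intro lipschitz_on_continuous_on[of L] lipschitz_onI) (auto simp: dist_real_def)
  have "continuous_on ?I y" using h by (intro continuous_on_subset[OF cont]) auto
  then have cby: "continuous_on ?I (\<lambda>s. b (y s))"
    using continuous_on_compose2[OF bc] by auto
  let ?E = "\<bar>?X - y (real k * h)\<bar>"
  have "norm (integral ?I (\<lambda>s. b ?X - b (y s))) \<le> L * (?E + \<omega>) * (real (Suc k) * h - real k * h)"
  proof (rule integral_bound[OF le])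
    show "continuous_on ?I (\<lambda>s. b ?X - b (y s))" by (intro continuous_intros cby)
    fix s assume s: "s \<in> ?I"
    have "\<bar>?X - y s\<bar> \<le> ?E + \<omega>" using osc[OF _ s] Suc.prems by simp
    then show "norm (b ?X - b (y s)) \<le> L * (?E + \<omega>)"
      unfolding real_norm_def using L by (intro order_trans[OF b] mult_left_mono)
  qed
  also have "integral ?I (\<lambda>s. b ?X - b (y s)) = h * b ?X - integral ?I (\<lambda>s. b (y s))"
    using integral_diff[OF integrable_const_ivl integrable_continuous_real[OF cby], of "b ?X"] h
    by (simp add: algebra_simps)
  finally have i: "\<bar>h * b ?X - integral ?I (\<lambda>s. b (y s))\<bar> \<le> L * (?E + \<omega>) * h"
    by (simp add: algebra_simps)
  have "\<bar>euler b h v (Suc k) - y (real (Suc k) * h)\<bar> \<le> ?E + L * (?E + \<omega>) * h"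
    using i step[of k] Suc.prems by simp
  also have "\<dots> = (1 + L * h) * ?E + L * h * \<omega>" by (simp add: algebra_simps)
  also have "\<dots> \<le> (1 + L * h) * (\<omega> * ((1 + L * h) ^ k - 1)) + L * h * \<omega>"
    using Suc L h by (intro add_right_mono mult_left_mono) auto
  also have "\<dots> = \<omega> * ((1 + L * h) ^ Suc k - 1)" by (simp add: algebra_simps)
  finally show ?case .
qed

text \<open>The oscillation bound accompanies the convergence on the grid because the path may exit
  between grid times.\<close>

lemma euler_converges:
  fixes y W :: "real \<Rightarrow> real"
  assumes cont: "continuous_on {0..} y" and y0: "y 0 = 0"
    and b: "\<And>u v. \<bar>b u - b v\<bar> \<le> L * \<bar>u - v\<bar>" and T: "0 < T" and \<delta>: "0 < \<delta>"
    and eq: "\<And>t. 0 \<le> t \<Longrightarrow> y t = W t + integral {0..t} (\<lambda>s. b (y s))"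
  shows "eventually (\<lambda>n. n > 0
    \<and> (\<forall>k\<le>n. \<bar>euler b (T / real n) (\<lambda>k. W (real (Suc k) * (T / real n)) - W (real k * (T / real n))) k
        - y (real k * (T / real n))\<bar> < \<delta>)
    \<and> (\<forall>s\<in>{0..T}. \<forall>t\<in>{0..T}. \<bar>s - t\<bar> \<le> T / real n \<longrightarrow> \<bar>y s - y t\<bar> < \<delta>)) sequentially"
proof -
  have L: "0 \<le> L" using b[of 0 1] by simp
  \<comment> \<open>The Gronwall factor is below exp(L T), and this choice absorbs it.\<close>
  define \<omega> where "\<omega> = \<delta> / exp (L * T)"
  have \<omega>: "0 < \<omega>" "\<omega> \<le> \<delta>" using \<delta> L T by (auto simp: \<omega>_def divide_le_eq mult_le_cancel_left1)
  have "uniformly_continuous_on {0..T} y"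
    using continuous_on_subset[OF cont] by (intro compact_uniformly_continuous) auto
  then obtain d where d: "d > 0" "\<And>s t. s \<in> {0..T} \<Longrightarrow> t \<in> {0..T} \<Longrightarrow> \<bar>s - t\<bar> < d \<Longrightarrow> \<bar>y s - y t\<bar> < \<omega>"
    using \<omega>(1) unfolding uniformly_continuous_on_def dist_real_def by (metis abs_minus_commute)
  have bc: "continuous_on UNIV b"
    using b L by (intro lipschitz_on_continuous_on[of L] lipschitz_onI) (auto simp: dist_real_def)
  have "eventually (\<lambda>n. T / real n < d) sequentially"
    using lim_const_over_n[of T] d(1) by (rule order_tendstoD)
  then show ?thesis using eventually_gt_at_top[of 0]
  proof eventually_elim
    case (elim n)
    let ?h = "T / real n"
    let ?v = "\<lambda>k. W (real (Suc k) * ?h) - W (real k * ?h)"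
    have h: "0 < ?h" and nh: "real n * ?h = T" using T elim by auto
    have kT: "real k * ?h \<le> T" if "k \<le> n" for k
      using mult_right_mono[of "real k" "real n" ?h] h nh that by simp
    have osc: "\<bar>y s - y t\<bar> < \<omega>" if "s \<in> {0..T}" "t \<in> {0..T}" "\<bar>s - t\<bar> \<le> ?h" for s t
      using d(2) that elim by (meson le_less_trans)
    have "\<bar>euler b ?h ?v k - y (real k * ?h)\<bar> < \<delta>" if k: "k \<le> n" for k
    proof -
      have "\<bar>euler b ?h ?v k - y (real k * ?h)\<bar> \<le> \<omega> * ((1 + L * ?h) ^ k - 1)"
      proof (rule euler_error[OF cont y0 b h _ _ _ k])
        fix k assume k: "k < n"
        let ?a = "real k * ?h" and ?c = "real (Suc k) * ?h"
        have ac: "0 \<le> ?a" "?a \<le> ?c"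
          using h by (auto intro!: mult_nonneg_nonneg mult_right_mono simp del: times_divide_eq_right)
        have "continuous_on {0..?c} y" by (intro continuous_on_subset[OF cont]) auto
        then have "(\<lambda>s. b (y s)) integrable_on {0..?c}"
          using continuous_on_compose2[OF bc] by (intro integrable_continuous_real) auto
        then have "integral {0..?a} (\<lambda>s. b (y s)) + integral {?a..?c} (\<lambda>s. b (y s)) = integral {0..?c} (\<lambda>s. b (y s))"
          using ac by (intro Henstock_Kurzweil_Integration.integral_combine) auto
        then show "y ?c = y ?a + ?v k + integral {?a..?c} (\<lambda>s. b (y s))"
          using eq[of ?a] eq[of ?c] ac by simp
        fix s assume s: "s \<in> {?a..?c}"
        have "?c \<le> T" using kT[of "Suc k"] k by simp
        moreover have "?c - ?a = ?h" by (simp add: algebra_simps add_divide_distrib)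
        ultimately show "\<bar>y s - y ?a\<bar> \<le> \<omega>" using s ac by (intro less_imp_le[OF osc]) auto
      qed (use \<omega> in simp)
      also have "\<dots> < \<omega> * exp (L * T)"
      proof -
        have "(1 + L * ?h) ^ k \<le> exp (L * ?h) ^ k"
        proof (rule power_mono)
          have "0 \<le> L * ?h" using L h by (intro mult_nonneg_nonneg) auto
          then show "0 \<le> 1 + L * ?h" by linarith
        qed (rule exp_ge_add_one_self)
        also have "\<dots> = exp (L * (real k * ?h))" by (simp add: exp_of_nat_mult[symmetric] algebra_simps)
        also have "\<dots> \<le> exp (L * T)"
          unfolding exp_le_cancel_iff using kT[OF k] L by (rule mult_left_mono)
        finally show ?thesis using \<omega>(1) by (intro mult_strict_left_mono) auto
      qed
      also have "\<dots> = \<delta>" by (simp add: \<omega>_def)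
      finally show ?thesis .
    qed
    then show ?case using elim osc \<omega>(2) by (meson less_le_trans)
  qed
qed

lemma alive_steps_le:
  assumes "r \<le> \<bar>euler b h v k\<bar>"
  shows "alive_steps b h r v n \<le> real k"
proof (cases "k < n")
  case True
  have "alive_steps b h r v n = (\<Sum>j<k. alive b h r v j) + (\<Sum>j\<in>{k..<n}. alive b h r v j)"
    unfolding alive_steps_def using True
    by (subst sum.union_disjoint[symmetric]) (auto intro!: sum.cong)
  also have "(\<Sum>j\<in>{k..<n}. alive b h r v j) = 0"
    using assms by (intro sum.neutral) (auto simp: alive_def not_less)
  also have "(\<Sum>j<k. alive b h r v j) \<le> real k"
    using alive_steps_bounds(2)[of b h r v k] by (simp add: alive_steps_def)
  finally show ?thesis by simp
next
  case False
  then show ?thesis using alive_steps_bounds(2)[of b h r v n] by simp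
qed

lemma alive_steps_ge:
  assumes "\<forall>j<k. \<bar>euler b h v j\<bar> < r" "k \<le> n"
  shows "real k \<le> alive_steps b h r v n"
proof -
  have "real k = (\<Sum>j<k. alive b h r v j)" using assms(1) by (simp add: alive_def)
  also have "\<dots> \<le> alive_steps b h r v n"
    unfolding alive_steps_def using assms(2) by (intro sum_mono2) (auto simp: alive_bounds)
  finally show ?thesis .
qed

lemma exit_time_le: "0 \<le> t \<Longrightarrow> y t w \<notin> D \<Longrightarrow> exit_time y D w \<le> ennreal t"
  unfolding exit_time_def by (intro Inf_lower) auto

text \<open>When the chain leaves the larger interval, the path is outside the smaller one at the
  same grid time. Truncation at T covers a chain that survives all n steps.\<close>

lemma exit_time_le_alive_steps:
  assumes close: "\<And>k. k \<le> n \<Longrightarrow> \<bar>euler b h v k - y (real k * h) w\<bar> < \<delta>"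
    and r: "r + \<delta> \<le> r2" and h: "0 < h" and T: "T = real n * h"
  shows "min (exit_time y {-r<..<r} w) (ennreal T) \<le> ennreal (h * alive_steps b h r2 v n)"
proof (cases "\<forall>j<n. \<bar>euler b h v j\<bar> < r2")
  case True
  then have "h * alive_steps b h r2 v n = T" unfolding T using alive_steps_eq by (metis mult.commute)
  then show ?thesis by simp
next
  case False
  define k where "k = (LEAST j. j < n \<and> r2 \<le> \<bar>euler b h v j\<bar>)"
  have k: "k < n \<and> r2 \<le> \<bar>euler b h v k\<bar>"
    unfolding k_def by (rule LeastI_ex) (use False not_less in blast)
  have less: "\<forall>j<k. \<bar>euler b h v j\<bar> < r2"
    using not_less_Least[of _ "\<lambda>j. j < n \<and> r2 \<le> \<bar>euler b h v j\<bar>"] k unfolding k_def[symmetric]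
    by (meson less_trans not_less)
  have "y (real k * h) w \<notin> {-r<..<r}" using close[of k] k r by auto
  then have "exit_time y {-r<..<r} w \<le> ennreal (real k * h)" using h by (intro exit_time_le) auto
  also have "\<dots> \<le> ennreal (h * alive_steps b h r2 v n)"
    using alive_steps_ge[OF less, of n] k h by (intro ennreal_leI) (simp add: mult.commute)
  finally show ?thesis by (simp add: min.coboundedI1)
qed

text \<open>One \<delta> pays for moving from s to a grid time, the other for the distance between
  path and chain.\<close>

lemma alive_steps_le_exit:
  assumes close: "\<And>k. k \<le> n \<Longrightarrow> \<bar>euler b h v k - y (real k * h)\<bar> < \<delta>"
    and osc: "\<And>s t. s \<in> {0..T} \<Longrightarrow> t \<in> {0..T} \<Longrightarrow> \<bar>s - t\<bar> \<le> h \<Longrightarrow> \<bar>y s - y t\<bar> < \<delta>"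
    and r: "r1 + 2 * \<delta> \<le> r" and h: "0 < h" and T: "T = real n * h"
    and s: "0 \<le> s" "s \<le> T" "y s \<notin> {-r<..<r}"
  shows "h * alive_steps b h r1 v n \<le> s + h"
proof -
  \<comment> \<open>The first grid time not before s; rounding up causes the extra h in the
    conclusion.\<close>
  define k where "k = nat \<lceil>s / h\<rceil>"
  have k1: "s \<le> real k * h" and k2: "real k * h < s + h"
  proof -
    have "0 \<le> s / h" using s h by simp
    then have "s / h \<le> real k" "real k < s / h + 1" unfolding k_def by linarith+
    then show "s \<le> real k * h" "real k * h < s + h" using h by (simp_all add: field_simps)
  qed
  have "s / h \<le> real n" using s h T by (simp add: field_simps)
  then have kn: "k \<le> n" unfolding k_def by linarith
  then have "real k * h \<le> T" using h T by simp
  then have "\<bar>y s - y (real k * h)\<bar> < \<delta>" using s k1 k2 by (intro osc) auto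
  then have "r1 \<le> \<bar>euler b h v k\<bar>" using close[OF kn] s(3) r by auto
  then have "alive_steps b h r1 v n \<le> real k" by (rule alive_steps_le)
  then have "h * alive_steps b h r1 v n \<le> real k * h" using h by (simp add: mult.commute)
  then show ?thesis using k2 by simp
qed

section \<open>Expected exit times\<close>

locale additive_sde = prob_space M for M :: "'w measure" +
  fixes W y :: "real \<Rightarrow> 'w \<Rightarrow> real" and b :: "real \<Rightarrow> real" and L :: real
  assumes bm: "brownian_motion M W" and sde: "sde_solution M W b 0 y"
    and lip: "\<And>u v. \<bar>b u - b v\<bar> \<le> L * \<bar>u - v\<bar>"
begin

definition grid_incr :: "real \<Rightarrow> nat \<Rightarrow> 'w \<Rightarrow> real" where
  "grid_incr h k w = W (real (Suc k) * h) w - W (real k * h) w"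

definition approx_exit :: "real \<Rightarrow> nat \<Rightarrow> real \<Rightarrow> 'w \<Rightarrow> real" where
  "approx_exit T n r w = (T / real n) * alive_steps b (T / real n) r (\<lambda>k. grid_incr (T / real n) k w) n"

lemma b_measurable [measurable]: "b \<in> borel_measurable borel"
proof -
  have "continuous_on UNIV b"
    using lip lip[of 0 1] by (intro lipschitz_on_continuous_on[of L] lipschitz_onI) (auto simp: dist_real_def)
  then show ?thesis by (rule borel_measurable_continuous_onI)
qed

lemma gaussian_increments_grid:
  assumes h: "0 < h" "h \<le> 1"
  shows "gaussian_increments M (grid_incr h) n h b"
proof
  show "indep_vars (\<lambda>_. borel) (grid_incr h) {..<n}"
  proof -
    have mono: "0 \<le> real 0 * h \<and> strict_mono (\<lambda>i. real i * h)" using h by (auto intro: strict_monoI)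
    have "\<forall>n t. 0 \<le> t 0 \<and> strict_mono t \<longrightarrow>
        indep_vars (\<lambda>_. borel) (\<lambda>i w. W (t (Suc i)) w - W (t i) w) {..<n}"
      using bm unfolding brownian_motion_def by blast
    from this[rule_format, OF mono]
    have "indep_vars (\<lambda>_. borel) (\<lambda>i w. W (real (Suc i) * h) w - W (real i * h) w) {..<n}" .
    moreover have "grid_incr h = (\<lambda>i w. W (real (Suc i) * h) w - W (real i * h) w)"
      unfolding grid_incr_def by (rule refl)
    ultimately show ?thesis by (simp only:)
  qed
  fix k
  have "distributed M lborel (\<lambda>w. W (real (Suc k) * h) w - W (real k * h) w)
      (normal_density 0 (sqrt (real (Suc k) * h - real k * h)))"
    using bm h unfolding brownian_motion_def by simp
  then show "distributed M lborel (grid_incr h k) (normal_density 0 (sqrt h))"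
    unfolding grid_incr_def by (simp add: algebra_simps)
qed (use h in auto)

lemma approx_exit_measurable:
  assumes "0 < T" "T \<le> real n"
  shows "approx_exit T n r \<in> borel_measurable M"
proof -
  have n: "0 < real n" using assms by linarith
  interpret gaussian_increments M "grid_incr (T / real n)" n "T / real n" b
    using assms n by (intro gaussian_increments_grid) auto
  show ?thesis unfolding approx_exit_def using alive_steps_measurable by (intro borel_measurable_times) auto
qed

lemma approx_exit_bounds:
  assumes "0 < T"
  shows "0 \<le> approx_exit T n r w" "approx_exit T n r w \<le> T"
proof -
  let ?a = "alive_steps b (T / real n) r (\<lambda>k. grid_incr (T / real n) k w) n"
  show "0 \<le> approx_exit T n r w"
    unfolding approx_exit_def using assms by (intro mult_nonneg_nonneg alive_steps_bounds) auto
  have "T / real n * ?a \<le> T / real n * real n"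
    using assms by (intro mult_left_mono alive_steps_bounds) auto
  also have "\<dots> \<le> T" using assms by simp
  finally show "approx_exit T n r w \<le> T" unfolding approx_exit_def .
qed

definition good :: "'w \<Rightarrow> bool" where
  "good w \<longleftrightarrow> continuous_on {0..} (\<lambda>t. y t w) \<and> y 0 w = 0 \<and>
    (\<forall>t\<ge>0. y t w = W t w + integral {0..t} (\<lambda>s. b (y s w)))"

lemma AE_good: "AE w in M. good w"
  using sde unfolding sde_solution_def good_def by auto

lemma good_approx:
  assumes "good w" "0 < T" "0 < \<delta>"
  shows "eventually (\<lambda>n. n > 0
    \<and> (\<forall>k\<le>n. \<bar>euler b (T / real n) (\<lambda>k. grid_incr (T / real n) k w) k - y (real k * (T / real n)) w\<bar> < \<delta>)
    \<and> (\<forall>s\<in>{0..T}. \<forall>t\<in>{0..T}. \<bar>s - t\<bar> \<le> T / real n \<longrightarrow> \<bar>y s w - y t w\<bar> < \<delta>)) sequentially"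
  using assms lip unfolding grid_incr_def good_def
  by (intro euler_converges[where L = L]) auto

text \<open>The exit time itself need not be measurable; it is only compared with liminf and limsup of
  measurable approximations, taken for slightly different radii so that touching the boundary
  without crossing it causes no trouble.\<close>

lemma exit_le_liminf_approx:
  assumes "good w" "0 < T" "r < r2"
  shows "min (exit_time y {-r<..<r} w) (ennreal T) \<le> liminf (\<lambda>n. ennreal (approx_exit T n r2 w))"
proof (rule Liminf_bounded)
  have "eventually (\<lambda>n. n > 0
    \<and> (\<forall>k\<le>n. \<bar>euler b (T / real n) (\<lambda>k. grid_incr (T / real n) k w) k - y (real k * (T / real n)) w\<bar> < r2 - r)
    \<and> (\<forall>s\<in>{0..T}. \<forall>t\<in>{0..T}. \<bar>s - t\<bar> \<le> T / real n \<longrightarrow> \<bar>y s w - y t w\<bar> < r2 - r)) sequentially"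
    using assms by (intro good_approx) auto
  then show "eventually (\<lambda>n. min (exit_time y {-r<..<r} w) (ennreal T) \<le> ennreal (approx_exit T n r2 w)) sequentially"
  proof eventually_elim
    case (elim n)
    then show ?case unfolding approx_exit_def using assms
      by (intro exit_time_le_alive_steps[where \<delta> = "r2 - r"]) auto
  qed
qed

lemma limsup_approx_le_exit:
  assumes "good w" "0 < T" "r1 < r"
  shows "limsup (\<lambda>n. ennreal (approx_exit T n r1 w)) \<le> exit_time y {-r<..<r} w"
  unfolding exit_time_def
proof (rule Inf_greatest, clarify)
  fix s assume s: "0 \<le> s" "y s w \<notin> {-r<..<r}"
  show "limsup (\<lambda>n. ennreal (approx_exit T n r1 w)) \<le> ennreal s"
  proof (cases "s \<le> T")
    case True
    define \<delta> where "\<delta> = (r - r1) / 2"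
    have "2 * \<delta> = r - r1" by (simp add: \<delta>_def)
    then have \<delta>: "0 < \<delta>" "r1 + 2 * \<delta> \<le> r" using assms(3) by simp_all
    have "eventually (\<lambda>n. n > 0
      \<and> (\<forall>k\<le>n. \<bar>euler b (T / real n) (\<lambda>k. grid_incr (T / real n) k w) k - y (real k * (T / real n)) w\<bar> < \<delta>)
      \<and> (\<forall>s\<in>{0..T}. \<forall>t\<in>{0..T}. \<bar>s - t\<bar> \<le> T / real n \<longrightarrow> \<bar>y s w - y t w\<bar> < \<delta>)) sequentially"
      using assms \<delta> by (intro good_approx) auto
    then have "eventually (\<lambda>n. ennreal (approx_exit T n r1 w) \<le> ennreal (s + T / real n)) sequentially"
    proof eventually_elim
      case (elim n)
      then show ?case unfolding approx_exit_def using assms s True \<delta>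
        by (intro ennreal_leI alive_steps_le_exit[where \<delta> = \<delta> and y = "\<lambda>t. y t w" and T = T and r = r]) auto
    qed
    then have "limsup (\<lambda>n. ennreal (approx_exit T n r1 w)) \<le> limsup (\<lambda>n. ennreal (s + T / real n))"
      by (rule Limsup_mono)
    also have "(\<lambda>n. ennreal (s + T / real n)) \<longlonglongrightarrow> ennreal (s + 0)"
      by (intro tendsto_intros lim_const_over_n)
    from lim_imp_Limsup[OF trivial_limit_sequentially this] have "limsup (\<lambda>n. ennreal (s + T / real n)) = ennreal s" by simp
    finally show ?thesis .
  next
    \<comment> \<open>An exit after T is harmless: the approximation never exceeds T.\<close>
    case False
    then have "approx_exit T n r1 w \<le> s" for n
      using approx_exit_bounds(2)[OF assms(2), of n r1 w] by linarith
    then show ?thesis by (intro Limsup_bounded always_eventually allI ennreal_leI)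
  qed
qed

text \<open>With h = T / n, the n errors of size C h^(3/2) add up to T C sqrt h, which vanishes as
  the grid is refined.\<close>

lemma approx_exit_expectation:
  assumes T: "0 < T" "T \<le> real n" and f: "f \<in> borel_measurable borel" and Bf: "\<And>y. \<bar>f y\<bar> \<le> Bf" and C: "0 \<le> C"
    and step: "\<And>h x. 0 < h \<Longrightarrow> h \<le> 1 \<Longrightarrow> \<bar>x\<bar> < r \<Longrightarrow>
      \<bar>(\<integral>z. f (x + h * b x + z) \<partial>gauss (sqrt h)) - f x + h\<bar> \<le> C * (h * sqrt h)"
  shows "\<bar>(\<integral>w. stopped f b (T / real n) r (\<lambda>k. grid_incr (T / real n) k w) n \<partial>M)
    + (\<integral>w. approx_exit T n r w \<partial>M) - f 0\<bar> \<le> T * C * sqrt (T / real n)"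
proof -
  let ?h = "T / real n"
  have n: "0 < real n" using T by linarith
  have h: "0 < ?h" "?h \<le> 1" using T n by auto
  interpret gaussian_increments M "grid_incr ?h" n ?h b
    using h by (rule gaussian_increments_grid)
  have "\<bar>(\<integral>w. stopped f b ?h r (incr w) n \<partial>M) + ?h * (\<integral>w. alive_steps b ?h r (incr w) n \<partial>M) - f 0\<bar>
      \<le> real n * (C * (?h * sqrt ?h))"
    using h C step by (intro stopped_expectation[OF f Bf]) (auto simp del: times_divide_eq_left)
  also have "real n * (C * (?h * sqrt ?h)) = T * C * sqrt ?h" using n by simp
  finally show ?thesis by (simp add: approx_exit_def)
qed

lemma integrable_approx_exit: "0 < T \<Longrightarrow> T \<le> real n \<Longrightarrow> integrable M (approx_exit T n r)"
  using approx_exit_bounds[of T n r] by (intro integrable_const_bound[of _ T] approx_exit_measurable) auto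

lemma nn_integral_approx_exit:
  assumes "0 < T" "T \<le> real n"
  shows "(\<integral>\<^sup>+w. ennreal (approx_exit T n r w) \<partial>M) = ennreal (\<integral>w. approx_exit T n r w \<partial>M)"
  using assms approx_exit_bounds by (intro nn_integral_eq_integral integrable_approx_exit) auto

lemma error_tendsto_0: "(\<lambda>n. T * C * sqrt (T / real n)) \<longlonglongrightarrow> 0"
proof -
  have "(\<lambda>n. T * C * sqrt (T / real n)) \<longlonglongrightarrow> T * C * sqrt 0"
    by (intro tendsto_intros lim_const_over_n)
  then show ?thesis by simp
qed

theorem expected_exit_time_le:
  assumes f: "f \<in> borel_measurable borel" and Bf: "\<And>y. \<bar>f y\<bar> \<le> Bf" and C: "0 \<le> C"
    and step: "\<And>h x. 0 < h \<Longrightarrow> h \<le> 1 \<Longrightarrow> \<bar>x\<bar> < r2 \<Longrightarrow>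
      \<bar>(\<integral>z. f (x + h * b x + z) \<partial>gauss (sqrt h)) - f x + h\<bar> \<le> C * (h * sqrt h)"
    and nonneg: "\<And>x. 0 \<le> f x" and r: "r < r2"
  shows "(\<integral>\<^sup>+w. exit_time y {-r<..<r} w \<partial>M) \<le> ennreal (f 0)"
proof -
  \<comment> \<open>The shift by \<open>Suc m\<close> keeps the step size at most 1 for every
    n.\<close>
  let ?g = "\<lambda>m n w. ennreal (approx_exit (real (Suc m)) (n + Suc m) r2 w)"
  have meas: "?g m n \<in> borel_measurable M" for m n
    using approx_exit_measurable[of "real (Suc m)" "n + Suc m" r2] by measurable
  have "(\<integral>\<^sup>+w. liminf (\<lambda>n. ?g m n w) \<partial>M) \<le> ennreal (f 0)" for m
  proof -
    let ?T = "real (Suc m)"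
    have le: "(\<integral>\<^sup>+w. ?g m n w \<partial>M) \<le> ennreal (f 0 + ?T * C * sqrt (?T / real (n + Suc m)))" for n
    proof -
      have T: "0 < ?T" "?T \<le> real (n + Suc m)" by auto
      have "0 \<le> (\<integral>w. stopped f b (?T / real (n + Suc m)) r2 (\<lambda>k. grid_incr (?T / real (n + Suc m)) k w) (n + Suc m) \<partial>M)"
      proof (intro integral_nonneg_AE AE_I2)
        show "0 \<le> stopped f b h r2 v n" for h v n
          using stopped_cases[of n b h v r2 f] nonneg by (auto split: if_splits)
      qed
      then have "(\<integral>w. approx_exit ?T (n + Suc m) r2 w \<partial>M) \<le> f 0 + ?T * C * sqrt (?T / real (n + Suc m))"
        using approx_exit_expectation[of ?T "n + Suc m" f Bf C r2, OF T f Bf C step] by linarith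
      then show ?thesis unfolding nn_integral_approx_exit[OF T] by (rule ennreal_leI)
    qed
    have "(\<integral>\<^sup>+w. liminf (\<lambda>n. ?g m n w) \<partial>M) \<le> liminf (\<lambda>n. \<integral>\<^sup>+w. ?g m n w \<partial>M)"
      by (rule nn_integral_liminf[OF meas])
    also have "\<dots> \<le> liminf (\<lambda>n. ennreal (f 0 + ?T * C * sqrt (?T / real (n + Suc m))))"
      by (intro Liminf_mono always_eventually allI le)
    also have "(\<lambda>n. ennreal (f 0 + ?T * C * sqrt (?T / real (n + Suc m)))) \<longlonglongrightarrow> ennreal (f 0 + 0)"
      by (intro tendsto_intros LIMSEQ_ignore_initial_segment[OF error_tendsto_0])
    from lim_imp_Liminf[OF trivial_limit_sequentially this] have "liminf (\<lambda>n. ennreal (f 0 + ?T * C * sqrt (?T / real (n + Suc m)))) = ennreal (f 0)" by simp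
    finally show ?thesis .
  qed
  note bound = this
  have "(\<integral>\<^sup>+w. exit_time y {-r<..<r} w \<partial>M) \<le> (\<integral>\<^sup>+w. liminf (\<lambda>m. liminf (\<lambda>n. ?g m n w)) \<partial>M)"
  proof (rule nn_integral_mono_AE)
    show "AE w in M. exit_time y {-r<..<r} w \<le> liminf (\<lambda>m. liminf (\<lambda>n. ?g m n w))"
      using AE_good
    proof eventually_elim
      case (elim w)
      have "min (exit_time y {-r<..<r} w) (ennreal (real (Suc m))) \<le> liminf (\<lambda>n. ?g m n w)" for m
      proof -
        have "min (exit_time y {-r<..<r} w) (ennreal (real (Suc m)))
            \<le> liminf (\<lambda>n. ennreal (approx_exit (real (Suc m)) n r2 w))"
          using elim r by (intro exit_le_liminf_approx) auto
        also have "\<dots> \<le> liminf (\<lambda>n. ?g m n w)"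
          by (rule liminf_subseq_mono[of "\<lambda>n. n + Suc m", unfolded comp_def]) (simp add: strict_mono_def)
        finally show ?thesis .
      qed
      then have "liminf (\<lambda>m. min (exit_time y {-r<..<r} w) (ennreal (real (Suc m))))
          \<le> liminf (\<lambda>m. liminf (\<lambda>n. ?g m n w))"
        by (intro Liminf_mono always_eventually allI)
      moreover have "(\<lambda>m. min (exit_time y {-r<..<r} w) (ennreal (real (Suc m)))) \<longlonglongrightarrow> min (exit_time y {-r<..<r} w) top"
      proof (intro tendsto_min tendsto_const)
        have "(\<lambda>m. of_nat m :: ennreal) \<longlonglongrightarrow> top" by (rule of_nat_tendsto_top_ennreal)
        then show "(\<lambda>m. ennreal (real (Suc m))) \<longlonglongrightarrow> top"
          unfolding ennreal_of_nat_eq_real_of_nat[symmetric] by (rule LIMSEQ_Suc)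
      qed
      from lim_imp_Liminf[OF trivial_limit_sequentially this] have "liminf (\<lambda>m. min (exit_time y {-r<..<r} w) (ennreal (real (Suc m)))) = exit_time y {-r<..<r} w" by simp
      ultimately show ?case by simp
    qed
  qed
  also have "\<dots> \<le> liminf (\<lambda>m. \<integral>\<^sup>+w. liminf (\<lambda>n. ?g m n w) \<partial>M)"
    using meas by (intro nn_integral_liminf borel_measurable_liminf)
  also have "\<dots> \<le> ennreal (f 0)"
    by (rule order_trans[OF Liminf_le_Limsup[OF sequentially_bot] Limsup_bounded[OF always_eventually]])
      (rule allI, rule bound)
  finally show ?thesis .
qed

text \<open>At an exit f \<le> 0 has the right sign, but a chain that survives up to T may
  contribute Bf. There the approximate exit time equals T, so this contribution is at most Bf / T
  times it, and the resulting factor 1 + Bf / T tends to 1 as T grows.\<close>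

theorem expected_exit_time_ge:
  assumes f: "f \<in> borel_measurable borel" and Bf: "\<And>y. \<bar>f y\<bar> \<le> Bf" and C: "0 \<le> C"
    and step: "\<And>h x. 0 < h \<Longrightarrow> h \<le> 1 \<Longrightarrow> \<bar>x\<bar> < r1 \<Longrightarrow>
      \<bar>(\<integral>z. f (x + h * b x + z) \<partial>gauss (sqrt h)) - f x + h\<bar> \<le> C * (h * sqrt h)"
    and nonpos: "\<And>x. r1 \<le> \<bar>x\<bar> \<Longrightarrow> f x \<le> 0" and r: "r1 < r"
  shows "ennreal (f 0) \<le> (\<integral>\<^sup>+w. exit_time y {-r<..<r} w \<partial>M)"
proof -
  have B0: "0 \<le> Bf" using Bf[of 0] by simp
  have main: "ennreal (f 0 / (1 + Bf / real (Suc m))) \<le> (\<integral>\<^sup>+w. exit_time y {-r<..<r} w \<partial>M)" for m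
  proof -
    let ?T = "real (Suc m)" and ?n = "\<lambda>n. n + Suc m"
    let ?g = "\<lambda>n w. ennreal (approx_exit ?T (?n n) r1 w)"
    have meas: "?g n \<in> borel_measurable M" for n
      using approx_exit_measurable[of ?T "?n n" r1] by measurable
    have ge: "(f 0 - ?T * C * sqrt (?T / real (?n n))) / (1 + Bf / ?T) \<le> (\<integral>w. approx_exit ?T (?n n) r1 w \<partial>M)" for n
    proof -
      have T: "0 < ?T" "?T \<le> real (?n n)" by auto
      let ?h = "?T / real (?n n)"
      have h: "0 < ?h" "?h \<le> 1" by (auto simp: divide_simps)
      interpret gaussian_increments M "grid_incr ?h" "?n n" ?h b
        using h by (rule gaussian_increments_grid)
      have "(\<integral>w. stopped f b ?h r1 (incr w) (?n n) \<partial>M) \<le> (\<integral>w. Bf / ?T * approx_exit ?T (?n n) r1 w \<partial>M)"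
      proof (rule integral_mono)
        show "integrable M (\<lambda>w. stopped f b ?h r1 (incr w) (?n n))"
          using abs_stopped_le[of f Bf] Bf f by (intro integrable_const_bound[of _ Bf] stopped_measurable) auto
        show "integrable M (\<lambda>w. Bf / ?T * approx_exit ?T (?n n) r1 w)"
          using integrable_approx_exit[OF T] by simp
        fix w
        show "stopped f b ?h r1 (incr w) (?n n) \<le> Bf / ?T * approx_exit ?T (?n n) r1 w"
        proof (cases "\<forall>j<?n n. \<bar>euler b ?h (incr w) j\<bar> < r1")
          case True
          have "approx_exit ?T (?n n) r1 w = ?h * real (?n n)"
            unfolding approx_exit_def alive_steps_eq[OF True] ..
          also have "\<dots> = ?T" by simp
          finally have "Bf / ?T * approx_exit ?T (?n n) r1 w = Bf" by simp
          then show ?thesis using abs_stopped_le[of f Bf r1 "incr w"] Bf by simp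
        next
          case False
          then have "stopped f b ?h r1 (incr w) (?n n) \<le> 0"
            using stopped_cases[of "?n n" b ?h "incr w" r1 f] nonpos by (auto split: if_splits)
          also have "0 \<le> Bf / ?T * approx_exit ?T (?n n) r1 w"
            using B0 approx_exit_bounds(1)[OF T(1)] by (intro mult_nonneg_nonneg) auto
          finally show ?thesis .
        qed
      qed
      then have "f 0 - ?T * C * sqrt ?h \<le> (1 + Bf / ?T) * (\<integral>w. approx_exit ?T (?n n) r1 w \<partial>M)"
        using approx_exit_expectation[of ?T "?n n" f Bf C r1, OF T f Bf C step] by (simp add: distrib_right del: of_nat_Suc)
      moreover have "0 < 1 + Bf / ?T" using B0 by (intro add_pos_nonneg) auto
      ultimately show ?thesis by (simp add: pos_divide_le_eq mult.commute)
    qed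
    have "(\<lambda>n. ennreal ((f 0 - ?T * C * sqrt (?T / real (?n n))) / (1 + Bf / ?T)))
        \<longlonglongrightarrow> ennreal ((f 0 - 0) / (1 + Bf / ?T))"
    proof (intro tendsto_ennrealI tendsto_divide tendsto_diff tendsto_const
        LIMSEQ_ignore_initial_segment[OF error_tendsto_0])
      have "0 < 1 + Bf / ?T" using B0 by (intro add_pos_nonneg) auto
      then show "1 + Bf / ?T \<noteq> 0" by linarith
    qed
    from lim_imp_Limsup[OF trivial_limit_sequentially this] have "ennreal (f 0 / (1 + Bf / ?T))
        = limsup (\<lambda>n. ennreal ((f 0 - ?T * C * sqrt (?T / real (?n n))) / (1 + Bf / ?T)))" by simp
    also have "\<dots> \<le> limsup (\<lambda>n. \<integral>\<^sup>+w. ?g n w \<partial>M)"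
      using ge by (intro Limsup_mono always_eventually allI, subst nn_integral_approx_exit) (auto intro: ennreal_leI)
    also have "\<dots> \<le> (\<integral>\<^sup>+w. limsup (\<lambda>n. ?g n w) \<partial>M)"
    \<comment> \<open>Reverse Fatou: at a fixed horizon the approximations are bounded by
      it.\<close>
    proof (rule nn_integral_limsup[OF meas, of "\<lambda>_. ennreal ?T"])
      show "AE w in M. ?g n w \<le> ennreal ?T" for n
        using approx_exit_bounds(2)[of ?T "?n n" r1] by (intro AE_I2 ennreal_leI) auto
      show "(\<integral>\<^sup>+w. ennreal ?T \<partial>M) < \<infinity>" by (simp add: emeasure_space_1)
    qed simp
    also have "\<dots> \<le> (\<integral>\<^sup>+w. exit_time y {-r<..<r} w \<partial>M)"
    proof (rule nn_integral_mono_AE)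
      show "AE w in M. limsup (\<lambda>n. ?g n w) \<le> exit_time y {-r<..<r} w"
        using AE_good
      proof eventually_elim
        case (elim w)
        have "limsup (\<lambda>n. ?g n w) \<le> limsup (\<lambda>n. ennreal (approx_exit ?T n r1 w))"
          by (rule limsup_subseq_mono[of ?n, unfolded comp_def]) (simp add: strict_mono_def)
        also have "\<dots> \<le> exit_time y {-r<..<r} w"
          using elim r by (intro limsup_approx_le_exit) auto
        finally show ?case .
      qed
    qed
    finally show ?thesis .
  qed
  have "(\<lambda>m. ennreal (f 0 / (1 + Bf / real (Suc m)))) \<longlonglongrightarrow> ennreal (f 0 / (1 + 0))"
    by (intro tendsto_ennrealI tendsto_divide tendsto_add tendsto_const LIMSEQ_Suc[OF lim_const_over_n]) auto
  then show ?thesis using main by (intro LIMSEQ_le_const2[of _ "ennreal (f 0)"]) auto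
qed

end

section \<open>Test functions for the generator\<close>

lemma continuous_bounded_interval:
  fixes g :: "real \<Rightarrow> real"
  assumes "continuous_on {a..b} g"
  shows "\<exists>B\<ge>0. \<forall>x\<in>{a..b}. \<bar>g x\<bar> \<le> B"
proof -
  have "bounded (g ` {a..b})"
    using assms by (intro compact_imp_bounded compact_continuous_image) auto
  then obtain B where "\<forall>x\<in>{a..b}. \<bar>g x\<bar> \<le> B" by (auto simp: bounded_iff)
  then have "0 \<le> max B 0 \<and> (\<forall>x\<in>{a..b}. \<bar>g x\<bar> \<le> max B 0)" by fastforce
  then show ?thesis by blast
qed

text \<open>Prescribing m and q by derivatives and values at 0, rather than by integrals, treats
  both half-lines at once. The bound on \<open>V2\<close> makes the drift globally
  Lipschitz.\<close>

locale potential =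
  fixes V V1 V2 m q :: "real \<Rightarrow> real" and L :: real
  assumes dV: "\<And>x. (V has_real_derivative V1 x) (at x)"
    and dV1: "\<And>x. (V1 has_real_derivative V2 x) (at x)" and V2: "\<And>x. \<bar>V2 x\<bar> \<le> L"
    and dm: "\<And>x. (m has_real_derivative 2 * exp (- 2 * V x)) (at x)" and m0: "m 0 = 0"
    and dq: "\<And>x. (q has_real_derivative exp (2 * V x) * m x) (at x)" and q0: "q 0 = 0"
begin

lemma V1_lipschitz: "\<bar>V1 u - V1 v\<bar> \<le> L * \<bar>u - v\<bar>"
  using field_differentiable_bound[of UNIV V1 V2 L u v] dV1 V2 by simp

lemma m_mono: "x \<le> y \<Longrightarrow> m x \<le> m y"
  by (rule DERIV_nonneg_imp_nondecreasing) (use dm in \<open>force+\<close>)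

lemma q_mono:
  assumes "0 \<le> x" "x \<le> y" shows "q x \<le> q y"
proof (rule DERIV_nonneg_imp_nondecreasing[OF assms(2)])
  fix t assume "x \<le> t"
  with assms(1) have "0 \<le> m t" using m_mono[of 0 t] m0 by simp
  then show "\<exists>d. (q has_real_derivative d) (at t) \<and> 0 \<le> d" using dq[of t] by force
qed

lemma q_antimono:
  assumes "x \<le> y" "y \<le> 0" shows "q y \<le> q x"
proof (rule DERIV_nonpos_imp_nonincreasing[OF assms(1)])
  fix t assume "t \<le> y"
  with assms(2) have "m t \<le> 0" using m_mono[of t 0] m0 by simp
  then show "\<exists>d. (q has_real_derivative d) (at t) \<and> d \<le> 0" using dq[of t] by (force simp: mult_le_0_iff)
qed

lemma q_nonneg: "0 \<le> q x"
  using q_mono[of 0 x] q_antimono[of x 0] q0 by (cases "0 \<le> x") auto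

text \<open>This and the next two are the derivatives of q. The formula for \<open>q2\<close> is
  q''/2 - V' q' = 1 solved for q'', so the third derivative needs only two derivatives of V.\<close>

definition q1 :: "real \<Rightarrow> real" where "q1 x = exp (2 * V x) * m x"
definition q2 :: "real \<Rightarrow> real" where "q2 x = 2 * V1 x * q1 x + 2"
definition q3 :: "real \<Rightarrow> real" where "q3 x = 2 * V2 x * q1 x + 2 * V1 x * q2 x"

lemma q_deriv: "(q has_real_derivative q1 x) (at x)"
  using dq by (simp add: q1_def)

lemma q1_deriv: "(q1 has_real_derivative q2 x) (at x)"
proof -
  have "exp (2 * V x) * exp (- 2 * V x) = 1" by (simp add: exp_add[symmetric])
  then have "exp (2 * V x) * (2 * V1 x) * m x + exp (2 * V x) * (2 * exp (- 2 * V x)) = q2 x"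
    by (simp add: q2_def q1_def algebra_simps)
  then show ?thesis unfolding q1_def
    by (auto intro!: derivative_eq_intros dV dm simp: algebra_simps)
qed

lemma q2_deriv: "(q2 has_real_derivative q3 x) (at x)"
  unfolding q2_def q3_def
  by (auto intro!: derivative_eq_intros dV1 q1_deriv simp: q2_def algebra_simps)

lemma continuous_qs: "continuous_on S q" "continuous_on S q1" "continuous_on S q2" "continuous_on S V1"
  by (auto intro!: DERIV_atLeastAtMost_imp_continuous_on DERIV_continuous_on
      intro: has_field_derivative_at_within q_deriv q1_deriv q2_deriv dV1)

text \<open>Cutting off at zero outside \<open>[-R, R]\<close> keeps the test function bounded.  The jump is harmless: from
  \<open>|x| < R - 1\<close> only increments with \<open>|d| > 1\<close> see it, and there it is at most a multiple of \<open>|d|\<^sup>3\<close>.\<close>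

definition test_fun :: "real \<Rightarrow> real \<Rightarrow> real \<Rightarrow> real" where
  "test_fun R F0 x = (if \<bar>x\<bar> \<le> R then F0 - q x else 0)"

lemma test_fun_measurable [measurable]: "test_fun R F0 \<in> borel_measurable borel"
proof -
  have [measurable]: "q \<in> borel_measurable borel"
    by (rule borel_measurable_continuous_onI[OF continuous_qs(1)])
  show ?thesis unfolding test_fun_def by measurable
qed

lemma test_fun_bounded: "\<exists>B\<ge>0. \<forall>x. \<bar>test_fun R F0 x\<bar> \<le> B"
proof -
  obtain B where "B \<ge> 0" "\<forall>x\<in>{-R..R}. \<bar>F0 - q x\<bar> \<le> B"
    using continuous_bounded_interval[OF continuous_on_diff[OF continuous_on_const continuous_qs(1)]] by blast
  then show ?thesis by (intro exI[of _ B]) (auto simp: test_fun_def abs_le_iff)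
qed

lemma taylor_q:
  assumes "\<And>t. \<bar>t\<bar> \<le> R \<Longrightarrow> \<bar>q3 t\<bar> \<le> B" "\<bar>x\<bar> \<le> R" "\<bar>x + d\<bar> \<le> R"
  shows "\<bar>q (x + d) - q x - q1 x * d - q2 x * d\<^sup>2 / 2\<bar> \<le> B * \<bar>d\<bar> ^ 3"
proof (cases "d = 0")
  case False
  let ?D = "\<lambda>k::nat. if k = 0 then q else if k = 1 then q1 else if k = 2 then q2 else q3"
  have "\<exists>t. (if x + d < x then x + d < t \<and> t < x else x < t \<and> t < x + d) \<and>
      q (x + d) = (\<Sum>k<3. ?D k x / fact k * (x + d - x) ^ k) + ?D 3 t / fact 3 * (x + d - x) ^ 3"
  proof (rule Taylor[where a = "-R" and b = R])
    show "\<forall>k t. k < 3 \<and> - R \<le> t \<and> t \<le> R \<longrightarrow> (?D k has_real_derivative ?D (Suc k) t) (at t)"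
    proof (intro allI impI)
      fix k :: nat and t assume "k < 3 \<and> - R \<le> t \<and> t \<le> R"
      then have "k = 0 \<or> k = 1 \<or> k = 2" by auto
      then show "(?D k has_real_derivative ?D (Suc k) t) (at t)"
        using q_deriv q1_deriv q2_deriv by (auto simp: numeral_2_eq_2)
    qed
  qed (use assms False in auto)
  then obtain t where t: "if x + d < x then x + d < t \<and> t < x else x < t \<and> t < x + d"
    and eq: "q (x + d) = (\<Sum>k<3. ?D k x / fact k * d ^ k) + q3 t / 6 * d ^ 3"
    by (auto simp: fact_numeral)
  have tR: "\<bar>t\<bar> \<le> R" using t assms(2,3) by (auto split: if_splits)
  have "(\<Sum>k<3. ?D k x / fact k * d ^ k) = q x + q1 x * d + q2 x * d\<^sup>2 / 2"
    by (simp add: eval_nat_numeral)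
  then have "\<bar>q (x + d) - q x - q1 x * d - q2 x * d\<^sup>2 / 2\<bar> = \<bar>q3 t\<bar> / 6 * \<bar>d\<bar> ^ 3"
    using eq by (simp add: abs_mult power_abs)
  also have "\<dots> \<le> B * \<bar>d\<bar> ^ 3"
    using assms(1)[OF tR] by (intro mult_right_mono) auto
  finally show ?thesis .
qed simp

lemma test_fun_step:
  assumes r: "0 < r"
  shows "\<exists>C\<ge>0. \<forall>h x. 0 < h \<longrightarrow> h \<le> 1 \<longrightarrow> \<bar>x\<bar> < r \<longrightarrow>
    \<bar>(\<integral>z. test_fun (r + 1) F0 (x + h * - V1 x + z) \<partial>gauss (sqrt h)) - test_fun (r + 1) F0 x + h\<bar> \<le> C * (h * sqrt h)"
proof -
  let ?R = "r + 1" let ?f = "test_fun ?R F0"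
  obtain Bf where Bf: "Bf \<ge> 0" "\<And>x. \<bar>?f x\<bar> \<le> Bf" using test_fun_bounded by blast
  obtain A where A: "A \<ge> 0" "\<And>x. x \<in> {-?R..?R} \<Longrightarrow> \<bar>V1 x\<bar> \<le> A"
    using continuous_bounded_interval[OF continuous_qs(4)] by metis
  obtain M1 where M1: "M1 \<ge> 0" "\<And>x. x \<in> {-?R..?R} \<Longrightarrow> \<bar>q1 x\<bar> \<le> M1"
    using continuous_bounded_interval[OF continuous_qs(2)] by metis
  obtain M2 where M2: "M2 \<ge> 0" "\<And>x. x \<in> {-?R..?R} \<Longrightarrow> \<bar>q2 x\<bar> \<le> M2"
    using continuous_bounded_interval[OF continuous_qs(3)] by metis
  have L: "0 \<le> L" using V2[of 0] by simp
  define M3 where "M3 = 2 * L * M1 + 2 * A * M2"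
  have M3: "\<bar>q3 t\<bar> \<le> M3" if "\<bar>t\<bar> \<le> ?R" for t
  proof -
    have "t \<in> {-?R..?R}" using that by auto
    then have "\<bar>V2 t\<bar> * \<bar>q1 t\<bar> \<le> L * M1" "\<bar>V1 t\<bar> * \<bar>q2 t\<bar> \<le> A * M2"
      using V2 A M1 M2 L by (auto intro!: mult_mono)
    then show ?thesis unfolding q3_def M3_def
      using abs_triangle_ineq[of "2 * V2 t * q1 t" "2 * V1 t * q2 t"] by (simp add: abs_mult)
  qed
  have M3_nonneg: "0 \<le> M3" using L M1 M2 A by (simp add: M3_def)
  \<comment> \<open>\<open>M3\<close> serves increments with |d| \<le> 1, the other terms those with
    |d| > 1.\<close>
  define K where "K = M3 + 2 * Bf + M1 + M2"
  have K: "0 \<le> K" using M3_nonneg Bf M1 M2 by (simp add: K_def)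
  have taylor: "\<bar>?f (x + d) - ?f x - (- q1 x) * d - (- q2 x) * d\<^sup>2 / 2\<bar> \<le> K * \<bar>d\<bar> ^ 3" if x: "\<bar>x\<bar> < r" for x d
  proof (cases "\<bar>d\<bar> \<le> 1")
    case True
    then have R: "\<bar>x\<bar> \<le> ?R" "\<bar>x + d\<bar> \<le> ?R" using x by auto
    have "\<bar>?f (x + d) - ?f x - (- q1 x) * d - (- q2 x) * d\<^sup>2 / 2\<bar> = \<bar>q (x + d) - q x - q1 x * d - q2 x * d\<^sup>2 / 2\<bar>"
      using R by (simp add: test_fun_def)
    also have "\<dots> \<le> M3 * \<bar>d\<bar> ^ 3" using M3 R by (rule taylor_q)
    also have "\<dots> \<le> K * \<bar>d\<bar> ^ 3" using Bf M1 M2 by (intro mult_right_mono) (auto simp: K_def)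
    finally show ?thesis .
  next
    case False
    have xR: "x \<in> {-?R..?R}" using x by auto
    have d1: "1 \<le> \<bar>d\<bar> ^ 3" "\<bar>d\<bar> \<le> \<bar>d\<bar> ^ 3" "\<bar>d\<bar>\<^sup>2 \<le> \<bar>d\<bar> ^ 3"
      using False power_increasing[of 1 3 "\<bar>d\<bar>"] power_increasing[of 2 3 "\<bar>d\<bar>"] power_increasing[of 0 3 "\<bar>d\<bar>"] by auto
    have "\<bar>?f (x + d) - ?f x - (- q1 x) * d - (- q2 x) * d\<^sup>2 / 2\<bar>
        \<le> \<bar>?f (x + d)\<bar> + \<bar>?f x\<bar> + \<bar>q1 x\<bar> * \<bar>d\<bar> + \<bar>q2 x\<bar> * \<bar>d\<bar>\<^sup>2 / 2"
    proof -
      have "\<bar>q1 x * d\<bar> = \<bar>q1 x\<bar> * \<bar>d\<bar>" "\<bar>q2 x * d\<^sup>2 / 2\<bar> = \<bar>q2 x\<bar> * \<bar>d\<bar>\<^sup>2 / 2" by (simp_all add: abs_mult)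
      then show ?thesis by (simp only: mult_minus_left minus_divide_left[symmetric]) linarith
    qed
    also have "\<dots> \<le> Bf * \<bar>d\<bar> ^ 3 + Bf * \<bar>d\<bar> ^ 3 + M1 * \<bar>d\<bar> ^ 3 + M2 * \<bar>d\<bar> ^ 3"
    proof (intro add_mono)
      show "\<bar>?f (x + d)\<bar> \<le> Bf * \<bar>d\<bar> ^ 3" "\<bar>?f x\<bar> \<le> Bf * \<bar>d\<bar> ^ 3"
        using Bf d1(1) mult_left_mono[OF d1(1) Bf(1)] by (auto intro: order_trans)
      show "\<bar>q1 x\<bar> * \<bar>d\<bar> \<le> M1 * \<bar>d\<bar> ^ 3" using M1 xR d1 by (intro mult_mono) auto
      have "\<bar>q2 x\<bar> * \<bar>d\<bar>\<^sup>2 \<le> M2 * \<bar>d\<bar> ^ 3" using M2 xR d1 by (intro mult_mono) auto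
      moreover have "0 \<le> M2 * \<bar>d\<bar> ^ 3" using M2(1) by simp
      ultimately show "\<bar>q2 x\<bar> * \<bar>d\<bar>\<^sup>2 / 2 \<le> M2 * \<bar>d\<bar> ^ 3" by linarith
    qed
    also have "\<dots> \<le> K * \<bar>d\<bar> ^ 3" using M3_nonneg by (simp add: K_def algebra_simps)
    finally show ?thesis .
  qed
  define C where "C = M2 * A\<^sup>2 / 2 + 4 * K * A ^ 3 + 8 * K"
  have "0 \<le> C" using M2 K A by (simp add: C_def)
  moreover have "\<bar>(\<integral>z. ?f (x + h * - V1 x + z) \<partial>gauss (sqrt h)) - ?f x + h\<bar> \<le> C * (h * sqrt h)"
    if h: "0 < h" "h \<le> 1" and x: "\<bar>x\<bar> < r" for h x
  proof -
    have xR: "x \<in> {-?R..?R}" using x by auto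
    have "\<bar>h * - V1 x\<bar> \<le> A * h" using A(2)[OF xR] h by (simp add: abs_mult mult.commute)
    moreover have "\<bar>- q2 x\<bar> \<le> M2" using M2(2)[OF xR] by simp
    ultimately have "\<bar>(\<integral>z. ?f (x + h * - V1 x + z) \<partial>gauss (sqrt h)) - (?f x + (- q1 x) * (h * - V1 x) + (- q2 x) * h / 2)\<bar>
        \<le> C * (h * sqrt h)"
      unfolding C_def by (intro gauss_one_step[OF test_fun_measurable Bf(2) taylor[OF x] _ _ h])
    \<comment> \<open>The equation for q: drift and diffusion terms combine to -h.\<close>
    moreover have "?f x + (- q1 x) * (h * - V1 x) + (- q2 x) * h / 2 = ?f x - h"
      by (simp add: q2_def field_simps)
    ultimately show ?thesis by simp
  qed
  ultimately show ?thesis by blast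
qed

end

locale gradient_sde = potential V V1 V2 m q L + additive_sde M W y "\<lambda>x. - V1 x" L
  for V V1 V2 m q L and M :: "'w measure" and W y
begin

text \<open>Three radii: r for the path, r + 1 for the chain, r + 2 for the cut-off. As q increases
  away from 0, \<open>?F\<close> is its maximum on the cut-off interval, which makes the test
  function nonnegative.\<close>

lemma exit_time_upper:
  assumes r: "0 < r"
  shows "(\<integral>\<^sup>+w. exit_time y {-r<..<r} w \<partial>M) \<le> ennreal (max (q (r + 2)) (q (- (r + 2))))"
proof -
  let ?F = "max (q (r + 2)) (q (- (r + 2)))"
  let ?f = "test_fun (r + 1 + 1) ?F"
  obtain C where C: "C \<ge> 0" "\<And>h x. 0 < h \<Longrightarrow> h \<le> 1 \<Longrightarrow> \<bar>x\<bar> < r + 1 \<Longrightarrow>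
      \<bar>(\<integral>z. ?f (x + h * - V1 x + z) \<partial>gauss (sqrt h)) - ?f x + h\<bar> \<le> C * (h * sqrt h)"
    using test_fun_step[of "r + 1" ?F] r by auto
  obtain Bf where Bf: "Bf \<ge> 0" "\<And>x. \<bar>?f x\<bar> \<le> Bf" using test_fun_bounded by blast
  have "0 \<le> ?f x" for x
  proof (cases "\<bar>x\<bar> \<le> r + 2")
    case True
    then have "q x \<le> ?F"
      using q_mono[of x "r + 2"] q_antimono[of "- (r + 2)" x] by (cases "0 \<le> x") auto
    then show ?thesis by (simp add: test_fun_def)
  qed (simp add: test_fun_def)
  then have "(\<integral>\<^sup>+w. exit_time y {-r<..<r} w \<partial>M) \<le> ennreal (?f 0)"
    using C Bf by (intro expected_exit_time_le[of ?f Bf C "r + 1"]) auto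
  also have "?f 0 = ?F" using r by (simp add: test_fun_def q0)
  finally show ?thesis .
qed

text \<open>As q increases away from 0, \<open>?F\<close> is its minimum outside (-r1, r1), so the
  test function is at most 0 wherever the chain can exit.\<close>

lemma exit_time_lower:
  assumes r: "0 < r1" "r1 < r"
  shows "ennreal (min (q r1) (q (- r1))) \<le> (\<integral>\<^sup>+w. exit_time y {-r<..<r} w \<partial>M)"
proof -
  let ?F = "min (q r1) (q (- r1))"
  let ?f = "test_fun (r1 + 1) ?F"
  obtain C where C: "C \<ge> 0" "\<And>h x. 0 < h \<Longrightarrow> h \<le> 1 \<Longrightarrow> \<bar>x\<bar> < r1 \<Longrightarrow>
      \<bar>(\<integral>z. ?f (x + h * - V1 x + z) \<partial>gauss (sqrt h)) - ?f x + h\<bar> \<le> C * (h * sqrt h)"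
    using test_fun_step[of r1 ?F] r by auto
  obtain Bf where Bf: "Bf \<ge> 0" "\<And>x. \<bar>?f x\<bar> \<le> Bf" using test_fun_bounded by blast
  have "?f x \<le> 0" if "r1 \<le> \<bar>x\<bar>" for x
  proof -
    have "?F \<le> q x"
      using that r q_mono[of r1 x] q_antimono[of x "- r1"] by (cases "0 \<le> x") auto
    then show ?thesis by (simp add: test_fun_def)
  qed
  then have "ennreal (?f 0) \<le> (\<integral>\<^sup>+w. exit_time y {-r<..<r} w \<partial>M)"
    using C Bf r by (intro expected_exit_time_ge[of ?f Bf C r1]) auto
  also have "?f 0 = ?F" using r by (simp add: test_fun_def q0)
  finally show ?thesis .
qed

end

section \<open>The self-similar potential\<close>

lemma real_antiderivative:
  fixes g :: "real \<Rightarrow> real"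
  assumes "continuous_on UNIV g"
  shows "\<exists>G. G 0 = 0 \<and> (\<forall>x. (G has_real_derivative g x) (at x))"
proof -
  have "\<exists>F. \<forall>x::real. - \<infinity> < ereal x \<longrightarrow> ereal x < \<infinity> \<longrightarrow> (F has_vector_derivative g x) (at x)"
    using assms by (intro einterval_antiderivative) (auto simp: continuous_on_eq_continuous_at)
  then obtain F where F: "\<And>x. (F has_real_derivative g x) (at x)"
    by (auto simp: has_real_derivative_iff_has_vector_derivative)
  have "((\<lambda>x. F x - F 0) has_real_derivative g x) (at x)" for x
    by (auto intro!: derivative_eq_intros F)
  then show ?thesis by (intro exI[of _ "\<lambda>x. F x - F 0"]) simp
qed

lemma periodic_add_nat:
  fixes f :: "real \<Rightarrow> 'a"
  assumes "\<And>x. f (x + 1) = f x"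
  shows "f (x + real n) = f x"
  by (induction n) (use assms in \<open>simp_all add: add.assoc[symmetric] add.commute[of 1]\<close>)

lemma periodic_add_int:
  fixes f :: "real \<Rightarrow> 'a"
  assumes "\<And>x. f (x + 1) = f x"
  shows "f (x + real_of_int k) = f x"
proof (cases "0 \<le> k")
  case True
  then show ?thesis using periodic_add_nat[of f x "nat k", OF assms] by simp
next
  case False
  then show ?thesis using periodic_add_nat[of f "x + real_of_int k" "nat (- k)", OF assms] by simp
qed

lemma periodic_continuous_bounded:
  fixes f :: "real \<Rightarrow> real"
  assumes per: "\<And>x. f (x + 1) = f x" and "continuous_on UNIV f"
  shows "\<exists>B\<ge>0. \<forall>x. \<bar>f x\<bar> \<le> B"
proof -
  have "continuous_on {0..1} f" using assms(2) by (rule continuous_on_subset) simp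
  then obtain B where B: "\<And>x. x \<in> {0..1} \<Longrightarrow> \<bar>f x\<bar> \<le> B"
    using continuous_bounded_interval by metis
  have "\<bar>f x\<bar> \<le> B" for x
  proof -
    have "f (frac x + real_of_int \<lfloor>x\<rfloor>) = f (frac x)" by (rule periodic_add_int[of f, OF per])
    then have "f x = f (frac x)" by (simp add: frac_def)
    then show ?thesis using B[of "frac x"] frac_lt_1[of x] by (simp add: less_imp_le)
  qed
  moreover have "0 \<le> B" using B[of 0] by force
  ultimately show ?thesis by blast
qed

text \<open>Derivatives of periodic functions are periodic, and continuous periodic functions are
  bounded; this gives global bounds.\<close>

lemma smooth_torus_derivatives:
  assumes "smooth_torus U"
  shows "(U has_real_derivative deriv U x) (at x)"
    and "(deriv U has_real_derivative deriv (deriv U) x) (at x)"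
    and "\<exists>B\<ge>0. \<forall>x. \<bar>U x\<bar> \<le> B" "\<exists>B\<ge>0. \<forall>x. \<bar>deriv U x\<bar> \<le> B" "\<exists>B\<ge>0. \<forall>x. \<bar>deriv (deriv U) x\<bar> \<le> B"
proof -
  have per: "\<And>x. U (x + 1) = U x" and diff: "\<And>n x. (deriv ^^ n) U differentiable (at x)"
    using assms unfolding smooth_torus_def by auto
  have d: "((deriv ^^ n) U has_real_derivative (deriv ^^ Suc n) U x) (at x)" for n x
    using diff[of n x] by (simp add: DERIV_deriv_iff_real_differentiable)
  have per': "(deriv ^^ n) U (x + 1) = (deriv ^^ n) U x" for n x
  proof (induction n arbitrary: x)
    case (Suc n)
    have "((\<lambda>x. (deriv ^^ n) U (x + 1)) has_real_derivative (deriv ^^ Suc n) U (x + 1)) (at x)"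
      using d[of n "x + 1"] unfolding DERIV_shift by (simp add: add.commute)
    then have "((deriv ^^ n) U has_real_derivative (deriv ^^ Suc n) U (x + 1)) (at x)"
      by (simp only: Suc)
    then show ?case using d[of n x] by (rule DERIV_unique)
  qed (simp add: per)
  have bd: "\<exists>B\<ge>0. \<forall>x. \<bar>(deriv ^^ n) U x\<bar> \<le> B" for n
  proof (rule periodic_continuous_bounded)
    show "continuous_on UNIV ((deriv ^^ n) U)"
      using d by (intro continuous_at_imp_continuous_on ballI DERIV_isCont)
  qed (rule per')
  show "(U has_real_derivative deriv U x) (at x)" using d[of 0 x] by simp
  show "(deriv U has_real_derivative deriv (deriv U) x) (at x)" using d[of 1 x] by simp
  show "\<exists>B\<ge>0. \<forall>x. \<bar>U x\<bar> \<le> B" using bd[of 0] by simp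
  show "\<exists>B\<ge>0. \<forall>x. \<bar>deriv U x\<bar> \<le> B" using bd[of 1] by simp
  show "\<exists>B\<ge>0. \<forall>x. \<bar>deriv (deriv U) x\<bar> \<le> B" using bd[of 2] by (simp add: numeral_2_eq_2)
qed

text \<open>Covers both \<open>V\<close> (\<open>c = 1\<close>) and its termwise derivative (\<open>c = 1 / \<rho>\<close>).\<close>

lemma self_similar_series_deriv:
  fixes u u1 :: "real \<Rightarrow> real"
  assumes \<rho>: "\<rho> \<ge> 2" and c: "0 < c" "c \<le> 1"
    and du: "\<And>x. (u has_real_derivative u1 x) (at x)" and B: "\<And>x. \<bar>u1 x\<bar> \<le> B"
    and sum0: "summable (\<lambda>n. u 0 * c ^ n)"
  shows "summable (\<lambda>n. u (x / real \<rho> ^ n) * c ^ n)"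
    and "((\<lambda>x. \<Sum>n. u (x / real \<rho> ^ n) * c ^ n) has_real_derivative (\<Sum>n. u1 (x / real \<rho> ^ n) * (c / real \<rho>) ^ n)) (at x)"
    and "\<bar>\<Sum>n. u1 (x / real \<rho> ^ n) * (c / real \<rho>) ^ n\<bar> \<le> 2 * B"
proof -
  have B0: "0 \<le> B" using B[of 0] by simp
  have c2: "0 \<le> c / real \<rho>" "c / real \<rho> \<le> 1 / 2"
    using c \<rho> by (auto simp: divide_simps)
  have bound: "norm (u1 (x / real \<rho> ^ n) * (c / real \<rho>) ^ n) \<le> B * (1 / 2) ^ n" for x n
  proof -
    have "(c / real \<rho>) ^ n \<le> (1 / 2) ^ n" using c2 by (intro power_mono) auto
    then show ?thesis using B[of "x / real \<rho> ^ n"] c2 B0 by (auto simp: abs_mult intro!: mult_mono)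
  qed
  have geo: "summable (\<lambda>n. B * (1 / 2) ^ n)" by (intro summable_mult summable_geometric) auto
  have uc: "uniformly_convergent_on UNIV (\<lambda>n x. \<Sum>i<n. u1 (x / real \<rho> ^ i) * (c / real \<rho>) ^ i)"
    using bound geo by (intro Weierstrass_m_test'[where M = "\<lambda>n. B * (1 / 2) ^ n"]) auto
  have d: "((\<lambda>x. u (x / real \<rho> ^ n) * c ^ n) has_real_derivative u1 (x / real \<rho> ^ n) * (c / real \<rho>) ^ n) (at x within UNIV)" for n x
    using \<rho> by (auto intro!: derivative_eq_intros DERIV_chain2[OF du] simp: power_divide)
  have s0: "summable (\<lambda>n. u (0 / real \<rho> ^ n) * c ^ n)" using sum0 by simp
  have x: "x \<in> interior UNIV" by simp
  show "summable (\<lambda>n. u (x / real \<rho> ^ n) * c ^ n)"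
    by (rule has_field_derivative_series'(1)[OF convex_UNIV d uc UNIV_I s0 x])
  show "((\<lambda>x. \<Sum>n. u (x / real \<rho> ^ n) * c ^ n) has_real_derivative (\<Sum>n. u1 (x / real \<rho> ^ n) * (c / real \<rho>) ^ n)) (at x)"
    by (rule has_field_derivative_series'(2)[OF convex_UNIV d uc UNIV_I s0 x])
  have sm: "summable (\<lambda>n. norm (u1 (x / real \<rho> ^ n) * (c / real \<rho>) ^ n))"
    using bound by (intro summable_comparison_test'[OF geo, of 0]) auto
  have "\<bar>\<Sum>n. u1 (x / real \<rho> ^ n) * (c / real \<rho>) ^ n\<bar> \<le> (\<Sum>n. norm (u1 (x / real \<rho> ^ n) * (c / real \<rho>) ^ n))"
    using summable_norm[OF sm] by simp
  also have "\<dots> \<le> (\<Sum>n. B * (1 / 2) ^ n)" by (intro suminf_le bound sm geo)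
  also have "\<dots> = 2 * B" by (simp add: suminf_mult suminf_geometric)
  finally show "\<bar>\<Sum>n. u1 (x / real \<rho> ^ n) * (c / real \<rho>) ^ n\<bar> \<le> 2 * B" .
qed

lemma self_similar_potential_derivatives:
  assumes \<rho>: "\<rho> \<ge> 2" and U: "smooth_torus U" and U0: "U 0 = 0"
  defines "V \<equiv> self_similar_potential \<rho> U"
  shows "\<exists>V2 L. (\<forall>x. (V has_real_derivative deriv V x) (at x)) \<and>
    (\<forall>x. (deriv V has_real_derivative V2 x) (at x)) \<and> (\<forall>x. \<bar>V2 x\<bar> \<le> L)"
    and "summable (\<lambda>n. U (x / real \<rho> ^ n))"
proof -
  note dU = smooth_torus_derivatives[OF U]
  obtain B1 B2 where B1: "\<And>x. \<bar>deriv U x\<bar> \<le> B1" and B2: "\<And>x. \<bar>deriv (deriv U) x\<bar> \<le> B2"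
    using dU(4,5) by blast
  define V1 where "V1 = (\<lambda>x. \<Sum>n. deriv U (x / real \<rho> ^ n) * (1 / real \<rho>) ^ n)"
  define V2 where "V2 = (\<lambda>x. \<Sum>n. deriv (deriv U) (x / real \<rho> ^ n) * (1 / real \<rho> / real \<rho>) ^ n)"
  have V: "V = (\<lambda>x. \<Sum>n. U (x / real \<rho> ^ n) * 1 ^ n)"
    unfolding V_def self_similar_potential_def by simp
  \<comment> \<open>For c = 1 no geometric factor helps. The series converges at the base point
    because U 0 = 0, and the uniformly convergent derivative series carries this to all x.\<close>
  have s0: "summable (\<lambda>n. U 0 * 1 ^ n)" by (simp add: U0)
  have s1: "summable (\<lambda>n. deriv U 0 * (1 / real \<rho>) ^ n)"
    using \<rho> by (intro summable_mult summable_geometric) auto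
  have 0: "(V has_real_derivative V1 x) (at x)" for x
    unfolding V V1_def by (rule self_similar_series_deriv(2)[OF \<rho> _ _ dU(1) B1 s0]) auto
  have 1: "(V1 has_real_derivative V2 x) (at x)" for x
    unfolding V1_def V2_def using \<rho> by (intro self_similar_series_deriv(2)[OF \<rho> _ _ dU(2) B2 s1]) auto
  have 2: "\<bar>V2 x\<bar> \<le> 2 * B2" for x
    unfolding V2_def using \<rho> by (intro self_similar_series_deriv(3)[OF \<rho> _ _ dU(2) B2 s1]) auto
  have "deriv V = V1" using 0 by (auto intro: DERIV_imp_deriv)
  then show "\<exists>V2 L. (\<forall>x. (V has_real_derivative deriv V x) (at x)) \<and>
    (\<forall>x. (deriv V has_real_derivative V2 x) (at x)) \<and> (\<forall>x. \<bar>V2 x\<bar> \<le> L)"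
    using 0 1 2 by auto
  show "summable (\<lambda>n. U (x / real \<rho> ^ n))"
    using self_similar_series_deriv(1)[OF \<rho> _ _ dU(1) B1 s0, of x] by simp
qed

lemma self_similar_potential_scale:
  assumes \<rho>: "\<rho> \<ge> 2" and U: "smooth_torus U" and U0: "U 0 = 0"
  shows "self_similar_potential \<rho> U (real \<rho> ^ N * z)
    = self_similar_potential \<rho> U z + (\<Sum>k<N. U (real \<rho> ^ Suc k * z))"
proof (induction N)
  case (Suc N)
  let ?V = "self_similar_potential \<rho> U" and ?x = "real \<rho> ^ N * z"
  have "?V (real \<rho> * ?x) = U (real \<rho> * ?x / real \<rho> ^ 0) + (\<Sum>n. U (real \<rho> * ?x / real \<rho> ^ Suc n))"
    unfolding self_similar_potential_def
    using suminf_split_head[OF self_similar_potential_derivatives(2)[OF assms, of "real \<rho> * ?x"]] by simp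
  also have "\<dots> = U (real \<rho> * ?x) + ?V ?x"
    using \<rho> by (simp add: self_similar_potential_def)
  finally show ?case using Suc by (simp add: mult.assoc)
qed simp

section \<open>Growth of the scale and speed functions\<close>

lemma word_value_Cons: "word_value R (c # w) = (real c + word_value R w) / real R"
  unfolding word_value_def
  by (simp only: length_Cons sum.lessThan_Suc_shift nth_Cons_0 nth_Cons_Suc)
    (simp add: add_divide_distrib sum_divide_distrib mult.commute)

lemma word_value_snoc: "word_value R (w @ [c]) = word_value R w + real c / real R ^ Suc (length w)"
  unfolding word_value_def by (auto simp: nth_append intro!: sum.cong)

lemma word_value_bounds:
  assumes "R \<ge> 2" "w \<in> words R n"
  shows "0 \<le> word_value R w" "word_value R w + 1 / real R ^ n \<le> 1"
proof -
  show "0 \<le> word_value R w" unfolding word_value_def by (intro sum_nonneg) auto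
  show "word_value R w + 1 / real R ^ n \<le> 1"
    using assms(2)
  proof (induction n arbitrary: w)
    case 0 then show ?case by (simp add: word_value_def)
  next
    case (Suc n)
    then obtain c v where w: "w = c # v" by (auto simp: words_def length_Suc_conv)
    then have v: "v \<in> words R n" and c: "c < R" using Suc.prems by (auto simp: words_def)
    have "real c + (word_value R v + 1 / real R ^ n) \<le> (real R - 1) + 1"
      using Suc.IH[OF v] c by (intro add_mono) auto
    then have "(real c + (word_value R v + 1 / real R ^ n)) / real R \<le> 1"
      using assms(1) by (simp add: divide_le_eq)
    then show ?case by (simp add: w word_value_Cons add_divide_distrib mult.commute)
  qed
qed

text \<open>The cells of level n tile [0, 1]: increments over the R children of a cell telescope to
  the increment over the cell.\<close>

lemma words_telescope:
  fixes G :: "real \<Rightarrow> real"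
  assumes R: "R > 0"
  shows "(\<Sum>w\<in>words R n. G (word_value R w + 1 / real R ^ n) - G (word_value R w)) = G 1 - G 0"
proof (induction n)
  case 0 then show ?case by (simp add: word_value_def)
next
  case (Suc n)
  have "(\<Sum>v\<in>words R (Suc 0). G (word_value R (u @ v) + 1 / real R ^ Suc n) - G (word_value R (u @ v)))
      = G (word_value R u + 1 / real R ^ n) - G (word_value R u)" if u: "u \<in> words R n" for u
  proof -
    let ?g = "\<lambda>c. G (word_value R u + real c / real R ^ Suc n)"
    have "inj_on (\<lambda>c. [c]) {..<R}" by (auto simp: inj_on_def)
    then have "(\<Sum>v\<in>words R (Suc 0). G (word_value R (u @ v) + 1 / real R ^ Suc n) - G (word_value R (u @ v)))
        = (\<Sum>c<R. G (word_value R u + real c / real R ^ Suc n + 1 / real R ^ Suc n) - ?g c)"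
      unfolding words_1 by (subst sum.reindex) (simp_all add: word_value_snoc words_length[OF u] del: power_Suc)
    also have "\<dots> = (\<Sum>c<R. ?g (Suc c) - ?g c)"
      by (intro sum.cong refl) (simp add: add_divide_distrib algebra_simps del: power_Suc)
    also have "\<dots> = ?g R - ?g 0" by (rule sum_lessThan_telescope)
    also have "real R / real R ^ Suc n = 1 / real R ^ n" using R by simp
    finally show ?thesis by simp
  qed
  then show ?case
    using Suc sum_words_append[of "\<lambda>w. G (word_value R w + 1 / real R ^ Suc n) - G (word_value R w)" R n "Suc 0"]
    by simp
qed

text \<open>Multiplication by R^j pushes the first j digits into the integer part, which a periodic
  function does not see.\<close>

lemma scaled_word_value:
  assumes "R > 0" "j \<le> length w"
  shows "\<exists>i::nat. real R ^ j * word_value R w = real i + word_value R (drop j w)"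
  using assms(2)
proof (induction j arbitrary: w)
  case 0 then show ?case by (intro exI[of _ 0]) simp
next
  case (Suc j)
  then obtain c v where w: "w = c # v" by (cases w) auto
  then obtain i :: nat where i: "real R ^ j * word_value R v = real i + word_value R (drop j v)"
    using Suc.IH[of v] Suc.prems by auto
  have "real R ^ Suc j * word_value R w = real R ^ j * real c + real R ^ j * word_value R v"
    using assms(1) by (simp add: w word_value_Cons field_simps)
  also have "\<dots> = real (R ^ j * c + i) + word_value R (drop (Suc j) w)"
    by (simp add: i w)
  finally show ?case by blast
qed

text \<open>Counterpart of \<open>birkhoff_seq_word\<close> for real points. Only the distance to
  the left endpoint of the closed cell enters, so no digit expansion of z is chosen.\<close>

lemma birkhoff_point_word:
  assumes R: "R \<ge> 2" and per: "\<And>x. f (x + 1) = f x" and f: "\<And>a b. \<bar>f a - f b\<bar> \<le> L * \<bar>a - b\<bar>"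
    and w: "w \<in> words R n" and z: "word_value R w \<le> z" "z \<le> word_value R w + 1 / real R ^ n"
  shows "\<bar>(\<Sum>j<n. f (real R ^ j * z)) - birkhoff_word R f w\<bar> \<le> L"
proof -
  have L: "0 \<le> L" using f[of 0 1] by simp
  have "\<bar>f (real R ^ j * z) - f (word_value R (drop j w))\<bar> \<le> L * (1 / real R) ^ (n - j)" if j: "j < n" for j
  proof -
    obtain i :: nat where i: "real R ^ j * word_value R w = real i + word_value R (drop j w)"
      using scaled_word_value[of R j w] R j words_length[OF w] by auto
    let ?t = "real R ^ j * (z - word_value R w)"
    have "real R ^ j * z = (word_value R (drop j w) + ?t) + real i"
      using i by (simp add: algebra_simps)
    then have "f (real R ^ j * z) = f (word_value R (drop j w) + ?t)"
      using periodic_add_nat[of f, OF per] by simp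
    moreover have "L * \<bar>?t\<bar> \<le> L * (1 / real R) ^ (n - j)"
    proof (rule mult_left_mono)
      have "\<bar>?t\<bar> \<le> real R ^ j * (1 / real R ^ n)"
      proof -
        have "z - word_value R w \<le> 1 / real R ^ n" using z by simp
        then have "real R ^ j * (z - word_value R w) \<le> real R ^ j * (1 / real R ^ n)"
          by (rule mult_left_mono) simp
        then show ?thesis using z by (simp add: abs_mult)
      qed
      also have "\<dots> = (1 / real R) ^ (n - j)"
        using j R by (simp add: power_divide power_diff)
      finally show "\<bar>?t\<bar> \<le> (1 / real R) ^ (n - j)" .
    qed (rule L)
    moreover have "\<bar>f (word_value R (drop j w) + ?t) - f (word_value R (drop j w))\<bar> \<le> L * \<bar>?t\<bar>"
      using f[of "word_value R (drop j w) + ?t" "word_value R (drop j w)"] by simp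
    ultimately show ?thesis by linarith
  qed
  then have "\<bar>(\<Sum>j<n. f (real R ^ j * z)) - birkhoff_word R f w\<bar> \<le> (\<Sum>j<n. L * (1 / real R) ^ (n - j))"
    unfolding birkhoff_word_def words_length[OF w] sum_subtractf[symmetric]
    by (intro order_trans[OF sum_abs] sum_mono) auto
  also have "\<dots> \<le> L * 1"
    unfolding sum_distrib_left[symmetric] using L geometric_tail_sum[OF R] by (intro mult_left_mono)
  finally show ?thesis by simp
qed

text \<open>The mean value theorem on the cells coded by words of length \<open>N\<close> turns the increment into a sum of
  exponentials; the integer \<open>a\<close> selects the period \<open>[a, a + 1]\<close>, which only changes the bounded part of \<open>V\<close>.\<close>

lemma antiderivative_growth:
  fixes A :: "real \<Rightarrow> real" and a :: int
  assumes \<rho>: "\<rho> \<ge> 2" and U: "smooth_torus U" and U0: "U 0 = 0"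
    and A: "\<And>x. (A has_real_derivative exp (c * self_similar_potential \<rho> U x)) (at x)"
  shows "\<exists>C. \<forall>N>0.
    exp (real N * (ln (real \<rho>) + pressure \<rho> (\<lambda>x. c * U x)) - C)
      \<le> A (real \<rho> ^ N * real_of_int (a + 1)) - A (real \<rho> ^ N * real_of_int a) \<and>
    A (real \<rho> ^ N * real_of_int (a + 1)) - A (real \<rho> ^ N * real_of_int a)
      \<le> exp (real N * (ln (real \<rho>) + pressure \<rho> (\<lambda>x. c * U x)) + C)"
proof -
  let ?V = "self_similar_potential \<rho> U" and ?f = "\<lambda>x. c * U x"
  note dU = smooth_torus_derivatives[OF U]
  have per: "U (x + 1) = U x" for x using U by (simp add: smooth_torus_def)
  obtain B0 where B0: "\<And>x. \<bar>U x\<bar> \<le> B0" using dU(3) by blast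
  obtain B1 where B1: "\<And>x. \<bar>deriv U x\<bar> \<le> B1" using dU(4) by blast
  define L where "L = \<bar>c\<bar> * B1"
  have lip: "\<bar>?f u - ?f v\<bar> \<le> L * \<bar>u - v\<bar>" for u v
  proof -
    have "\<bar>U u - U v\<bar> \<le> B1 * \<bar>u - v\<bar>"
      using field_differentiable_bound[of UNIV U "deriv U" B1 u v] dU(1) B1 by simp
    then have "\<bar>c\<bar> * \<bar>U u - U v\<bar> \<le> \<bar>c\<bar> * (B1 * \<bar>u - v\<bar>)" by (intro mult_left_mono) auto
    then show ?thesis by (simp add: L_def abs_mult[symmetric] right_diff_distrib mult.assoc)
  qed
  have "(?V has_real_derivative deriv ?V x) (at x)" for x
    using self_similar_potential_derivatives(1)[OF \<rho> U U0] by blast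
  then have "continuous_on {real_of_int a..real_of_int a + 1} ?V"
    by (intro continuous_at_imp_continuous_on ballI DERIV_isCont)
  then obtain BV where BV: "\<And>x. x \<in> {real_of_int a..real_of_int a + 1} \<Longrightarrow> \<bar>?V x\<bar> \<le> BV"
    using continuous_bounded_interval by metis
  \<comment> \<open>V on the chosen period, the end terms U z and U (\<rho>^N z) of an index shift,
    and the distortion L.\<close>
  define C1 where "C1 = \<bar>c\<bar> * BV + 2 * (\<bar>c\<bar> * B0) + L"
  have main: "exp (- C1) * (real \<rho> ^ N * partition_sum \<rho> ?f N)
      \<le> A (real \<rho> ^ N * real_of_int (a + 1)) - A (real \<rho> ^ N * real_of_int a)
    \<and> A (real \<rho> ^ N * real_of_int (a + 1)) - A (real \<rho> ^ N * real_of_int a)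
      \<le> exp C1 * (real \<rho> ^ N * partition_sum \<rho> ?f N)" for N
  proof -
    let ?r = "real \<rho> ^ N"
    have r: "?r > 0" using \<rho> by simp
    define G where "G z = A (?r * (real_of_int a + z))" for z
    have dG: "(G has_real_derivative ?r * exp (c * ?V (?r * (real_of_int a + z)))) (at z)" for z
    proof -
      have "((\<lambda>z. ?r * (real_of_int a + z)) has_real_derivative ?r) (at z)"
        by (auto intro!: derivative_eq_intros)
      from DERIV_chain2[OF A this] show ?thesis unfolding G_def by (simp add: mult.commute)
    qed
    have term_bounds: "exp (- C1) * exp (birkhoff_word \<rho> ?f w) \<le> G (word_value \<rho> w + 1 / ?r) - G (word_value \<rho> w)
      \<and> G (word_value \<rho> w + 1 / ?r) - G (word_value \<rho> w) \<le> exp C1 * exp (birkhoff_word \<rho> ?f w)"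
      if w: "w \<in> words \<rho> N" for w
    proof -
      let ?v = "word_value \<rho> w"
      have lt: "?v < ?v + 1 / ?r" using r by simp
      obtain z where z: "?v < z" "z < ?v + 1 / ?r"
        and eq: "G (?v + 1 / ?r) - G ?v = (?v + 1 / ?r - ?v) * (?r * exp (c * ?V (?r * (real_of_int a + z))))"
        using MVT2[OF lt dG] by blast
      \<comment> \<open>The cell has length \<rho>^(-N), which cancels the factor from
        rescaling.\<close>
      have val: "G (?v + 1 / ?r) - G ?v = exp (c * ?V (?r * (real_of_int a + z)))"
        using eq r by simp
      have z01: "0 \<le> z" "z \<le> 1" using z word_value_bounds[OF \<rho> w] by auto
      \<comment> \<open>The number \<rho>^(k+1) a is an integer, so the choice of the period
        disappears.\<close>
      have "(\<Sum>k<N. U (real \<rho> ^ Suc k * (real_of_int a + z))) = (\<Sum>k<N. U (real \<rho> ^ Suc k * z))"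
      proof (intro sum.cong refl)
        fix k
        have "real \<rho> ^ Suc k * (real_of_int a + z) = real \<rho> ^ Suc k * z + real_of_int (int \<rho> ^ Suc k * a)"
          by (simp add: algebra_simps)
        then show "U (real \<rho> ^ Suc k * (real_of_int a + z)) = U (real \<rho> ^ Suc k * z)"
          by (simp only: periodic_add_int[of U, OF per])
      qed
      \<comment> \<open>Scaling V produces the exponents 1 to N, a Birkhoff sum those from 0 to N -
        1.\<close>
      also have "\<dots> = (\<Sum>k<N. U (real \<rho> ^ k * z)) + U (?r * z) - U z"
        using sum.lessThan_Suc_shift[of "\<lambda>k. U (real \<rho> ^ k * z)" N] sum.lessThan_Suc[of "\<lambda>k. U (real \<rho> ^ k * z)" N]
        by simp
      finally have eq: "(\<Sum>k<N. U (real \<rho> ^ Suc k * (real_of_int a + z)))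
          = (\<Sum>k<N. U (real \<rho> ^ k * z)) + U (?r * z) - U z" .
      have "c * ?V (?r * (real_of_int a + z))
          = c * ?V (real_of_int a + z) + ((\<Sum>k<N. ?f (real \<rho> ^ k * z)) + c * U (?r * z) - c * U z)"
        unfolding self_similar_potential_scale[OF \<rho> U U0] eq sum_distrib_left[symmetric]
        by (simp only: distrib_left right_diff_distrib)
      moreover have "\<bar>c * ?V (real_of_int a + z)\<bar> \<le> \<bar>c\<bar> * BV"
        using BV[of "real_of_int a + z"] z01 by (auto simp: abs_mult intro!: mult_left_mono)
      moreover have "\<bar>c * U u\<bar> \<le> \<bar>c\<bar> * B0" for u
        using B0[of u] by (auto simp: abs_mult intro!: mult_left_mono)
      note this[of z] this[of "?r * z"]
      moreover have "\<bar>(\<Sum>k<N. ?f (real \<rho> ^ k * z)) - birkhoff_word \<rho> ?f w\<bar> \<le> L"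
        using z by (intro birkhoff_point_word[OF \<rho> _ lip w]) (auto simp: per)
      ultimately have "\<bar>c * ?V (?r * (real_of_int a + z)) - birkhoff_word \<rho> ?f w\<bar> \<le> C1"
        unfolding C1_def by linarith
      then show ?thesis unfolding val exp_add[symmetric] exp_le_cancel_iff by linarith
    qed
    have S: "(\<Sum>w\<in>words \<rho> N. exp (birkhoff_word \<rho> ?f w)) = ?r * partition_sum \<rho> ?f N"
      using \<rho> by (simp add: partition_sum_def)
    have "A (?r * real_of_int (a + 1)) - A (?r * real_of_int a) = G 1 - G 0" by (simp add: G_def)
    also have "\<dots> = (\<Sum>w\<in>words \<rho> N. G (word_value \<rho> w + 1 / ?r) - G (word_value \<rho> w))"
      using \<rho> by (intro words_telescope[symmetric]) auto
    finally have D: "A (?r * real_of_int (a + 1)) - A (?r * real_of_int a)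
        = (\<Sum>w\<in>words \<rho> N. G (word_value \<rho> w + 1 / ?r) - G (word_value \<rho> w))" .
    show ?thesis
      unfolding D S[symmetric] sum_distrib_left using term_bounds by (intro conjI sum_mono) auto
  qed
  show ?thesis
  proof (intro exI[of _ "C1 + L"] allI impI)
    fix N :: nat assume N: "N > 0"
    let ?P = "pressure \<rho> ?f" and ?Z = "partition_sum \<rho> ?f N"
    have Z: "?Z > 0" using \<rho> by (intro partition_sum_pos) auto
    have PZ: "\<bar>real N * ?P - ln ?Z\<bar> \<le> L" using \<rho> lip N by (rule pressure_partition_sum)
    \<comment> \<open>The number of words, \<rho>^N, contributes the ln \<rho> of the growth
      rate.\<close>
    have rZ: "real \<rho> ^ N * ?Z = exp (real N * ln (real \<rho>) + ln ?Z)"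
      using Z \<rho> by (simp add: exp_add exp_of_nat_mult)
    have "exp (real N * (ln (real \<rho>) + ?P) - (C1 + L)) \<le> exp (- C1) * (real \<rho> ^ N * ?Z)"
      unfolding rZ exp_add[symmetric] exp_le_cancel_iff distrib_left using PZ by linarith
    moreover have "exp C1 * (real \<rho> ^ N * ?Z) \<le> exp (real N * (ln (real \<rho>) + ?P) + (C1 + L))"
      unfolding rZ exp_add[symmetric] exp_le_cancel_iff distrib_left using PZ by linarith
    ultimately show "exp (real N * (ln (real \<rho>) + ?P) - (C1 + L))
        \<le> A (real \<rho> ^ N * real_of_int (a + 1)) - A (real \<rho> ^ N * real_of_int a) \<and>
      A (real \<rho> ^ N * real_of_int (a + 1)) - A (real \<rho> ^ N * real_of_int a)
        \<le> exp (real N * (ln (real \<rho>) + ?P) + (C1 + L))"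
      using main[of N] by linarith
  qed
qed

section \<open>Growth of the expected exit time\<close>

context potential
begin

lemma m_strict_mono: "x < y \<Longrightarrow> m x < m y"
  using DERIV_pos_imp_increasing[of x y m] dm by force

text \<open>S is the scale function. Together with m it encloses q between products, whose growth
  rates add.\<close>

context
  fixes S :: "real \<Rightarrow> real"
  assumes dS: "\<And>x. (S has_real_derivative exp (2 * V x)) (at x)" and S0: "S 0 = 0"
begin

lemma S_strict_mono: "x < y \<Longrightarrow> S x < S y"
  using DERIV_pos_imp_increasing[of x y S] dS by force

text \<open>Integration by parts: S m - q has derivative S m', which has the sign of its
  argument.\<close>

lemma q_le_product: "q x \<le> S x * m x"
proof -
  have d: "((\<lambda>x. S x * m x - q x) has_real_derivative S x * (2 * exp (- 2 * V x))) (at x)" for x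
    by (auto intro!: derivative_eq_intros dS dm dq)
  show ?thesis
  proof (cases "0 \<le> x")
    case True
    have "S 0 * m 0 - q 0 \<le> S x * m x - q x"
    proof (rule DERIV_nonneg_imp_nondecreasing[OF True])
      fix t :: real assume "0 \<le> t"
      then have "0 \<le> S t" using S_strict_mono[of 0 t] S0 by (cases "t = 0") auto
      then have "0 \<le> S t * (2 * exp (- 2 * V t))" by simp
      then show "\<exists>d. ((\<lambda>x. S x * m x - q x) has_real_derivative d) (at t) \<and> 0 \<le> d"
        using d[of t] by blast
    qed
    then show ?thesis by (simp add: S0 q0)
  next
    case False
    then have "x \<le> 0" by simp
    then have "S 0 * m 0 - q 0 \<le> S x * m x - q x"
    proof (rule DERIV_nonpos_imp_nonincreasing)
      fix t :: real assume "t \<le> 0"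
      then have "S t \<le> 0" using S_strict_mono[of t 0] S0 by (cases "t = 0") auto
      then have "S t * (2 * exp (- 2 * V t)) \<le> 0" by (simp add: mult_nonpos_nonneg)
      then show "\<exists>d. ((\<lambda>x. S x * m x - q x) has_real_derivative d) (at t) \<and> d \<le> 0"
        using d[of t] by blast
    qed
    then show ?thesis by (simp add: S0 q0)
  qed
qed

text \<open>m is nondecreasing, so on [x, y] it may be replaced by its value at x.\<close>

lemma q_ge_right: "x \<le> y \<Longrightarrow> m x * (S y - S x) \<le> q y - q x"
proof -
  assume xy: "x \<le> y"
  have "q x - m x * S x \<le> q y - m x * S y"
  proof (rule DERIV_nonneg_imp_nondecreasing[OF xy])
    fix t assume "x \<le> t"
    have "((\<lambda>t. q t - m x * S t) has_real_derivative exp (2 * V t) * (m t - m x)) (at t)"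
      by (auto intro!: derivative_eq_intros dS dq simp: algebra_simps)
    then show "\<exists>d. ((\<lambda>t. q t - m x * S t) has_real_derivative d) (at t) \<and> 0 \<le> d"
      using m_mono[OF \<open>x \<le> t\<close>] by (intro exI conjI) auto
  qed
  then show ?thesis by (simp add: algebra_simps)
qed

text \<open>The mirror image, for use left of 0, where -m is positive.\<close>

lemma q_ge_left: "y \<le> x \<Longrightarrow> (- m x) * (S x - S y) \<le> q y - q x"
proof -
  assume yx: "y \<le> x"
  have "q x - m x * S x \<le> q y - m x * S y"
  proof (rule DERIV_nonpos_imp_nonincreasing[OF yx])
    fix t assume "t \<le> x"
    have "((\<lambda>t. q t - m x * S t) has_real_derivative exp (2 * V t) * (m t - m x)) (at t)"
      by (auto intro!: derivative_eq_intros dS dq simp: algebra_simps)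
    then show "\<exists>d. ((\<lambda>t. q t - m x * S t) has_real_derivative d) (at t) \<and> d \<le> 0"
      using m_mono[OF \<open>t \<le> x\<close>] by (intro exI conjI) (auto simp: mult_nonneg_nonpos)
  qed
  then show ?thesis by (simp add: algebra_simps)
qed

lemma q_pos: "x \<noteq> 0 \<Longrightarrow> 0 < q x"
proof (cases "0 < x")
  case True
  then have "0 < m (x / 2)" "0 < S x - S (x / 2)"
    using m_strict_mono[of 0 "x / 2"] S_strict_mono[of "x / 2" x] m0 by auto
  then have "0 < m (x / 2) * (S x - S (x / 2))" by (rule mult_pos_pos)
  then show ?thesis using q_ge_right[of "x / 2" x] q_nonneg[of "x / 2"] True by linarith
next
  case False
  assume "x \<noteq> 0"
  with False have x: "x < 0" by simp
  then have "0 < - m (x / 2)" "0 < S (x / 2) - S x"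
    using m_strict_mono[of "x / 2" 0] S_strict_mono[of x "x / 2"] m0 by auto
  then have "0 < - m (x / 2) * (S (x / 2) - S x)" by (rule mult_pos_pos)
  then show ?thesis using q_ge_left[of x "x / 2"] q_nonneg[of "x / 2"] x by linarith
qed

text \<open>Upper bounds come from S m at \<rho>^N. For the lower bounds m is taken at \<rho>^N and
  S over the next period, up to 2 \<rho>^N; hence the periods a = 0, 1 on the right and a = -1, -2
  on the left.\<close>

lemma q_growth:
  assumes \<rho>: "\<rho> \<ge> 2" and U: "smooth_torus U" and U0: "U 0 = 0"
    and V: "V = self_similar_potential \<rho> U"
  defines "\<gamma> \<equiv> 2 * ln (real \<rho>) + (pressure \<rho> (\<lambda>x. 2 * U x) + pressure \<rho> (\<lambda>x. - 2 * U x))"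
  shows "\<exists>C. \<forall>N>0. exp (real N * \<gamma> - C) \<le> q (2 * real \<rho> ^ N) \<and> exp (real N * \<gamma> - C) \<le> q (- 2 * real \<rho> ^ N)
    \<and> q (real \<rho> ^ N) \<le> exp (real N * \<gamma> + C) \<and> q (- (real \<rho> ^ N)) \<le> exp (real N * \<gamma> + C)"
proof -
  let ?P = "ln (real \<rho>) + pressure \<rho> (\<lambda>x. 2 * U x)" and ?P' = "ln (real \<rho>) + pressure \<rho> (\<lambda>x. - 2 * U x)"
  \<comment> \<open>Halving removes the factor 2 from m', so that
    \<open>antiderivative_growth\<close> applies with c = -2; the ln 2 in C accounts for it.\<close>
  let ?m = "\<lambda>x. m x / 2"
  have dS': "(S has_real_derivative exp (2 * self_similar_potential \<rho> U x)) (at x)" for x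
    using dS by (simp add: V)
  have dm': "(?m has_real_derivative exp (- 2 * self_similar_potential \<rho> U x)) (at x)" for x
    using DERIV_cdivide[OF dm[of x], of 2] by (simp add: V)
  note gS = antiderivative_growth[OF \<rho> U U0 dS'] and gm = antiderivative_growth[OF \<rho> U U0 dm']
  obtain c0 where c0: "\<And>N. N > 0 \<Longrightarrow> exp (real N * ?P - c0) \<le> S (real \<rho> ^ N) \<and> S (real \<rho> ^ N) \<le> exp (real N * ?P + c0)"
    using gS[of 0] by (auto simp: S0)
  obtain c1 where c1: "\<And>N. N > 0 \<Longrightarrow> exp (real N * ?P - c1) \<le> S (2 * real \<rho> ^ N) - S (real \<rho> ^ N)"
    using gS[of 1] by (auto simp: mult.commute)
  obtain c2 where c2: "\<And>N. N > 0 \<Longrightarrow> exp (real N * ?P - c2) \<le> - S (- (real \<rho> ^ N)) \<and> - S (- (real \<rho> ^ N)) \<le> exp (real N * ?P + c2)"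
    using gS[of "-1"] by (auto simp: S0)
  obtain c3 where c3: "\<And>N. N > 0 \<Longrightarrow> exp (real N * ?P - c3) \<le> S (- (real \<rho> ^ N)) - S (- 2 * real \<rho> ^ N)"
    using gS[of "-2"] by (auto simp: mult.commute)
  obtain d0 where d0: "\<And>N. N > 0 \<Longrightarrow> exp (real N * ?P' - d0) \<le> ?m (real \<rho> ^ N) \<and> ?m (real \<rho> ^ N) \<le> exp (real N * ?P' + d0)"
    using gm[of 0] by (auto simp: m0)
  obtain d2 where d2: "\<And>N. N > 0 \<Longrightarrow> exp (real N * ?P' - d2) \<le> - ?m (- (real \<rho> ^ N)) \<and> - ?m (- (real \<rho> ^ N)) \<le> exp (real N * ?P' + d2)"
    using gm[of "-1"] by (auto simp: m0)
  define C where "C = \<bar>c0\<bar> + \<bar>c1\<bar> + \<bar>c2\<bar> + \<bar>c3\<bar> + \<bar>d0\<bar> + \<bar>d2\<bar> + ln 2"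
  have \<gamma>: "real N * \<gamma> = real N * ?P + real N * ?P'" for N by (simp add: \<gamma>_def algebra_simps)
  have e2: "exp (ln 2) = (2::real)" by simp
  have ln2: "0 \<le> ln (2::real)" by simp
  have upper: "x * y \<le> exp (real N * \<gamma> + C)"
    if "x \<le> exp (real N * ?P + c)" "0 \<le> x" "y / 2 \<le> exp (real N * ?P' + d)" "\<bar>c\<bar> + \<bar>d\<bar> + ln 2 \<le> C" for x y c d N
  proof -
    have "y \<le> 2 * exp (real N * ?P' + d)" using that by simp
    then have "x * y \<le> x * (2 * exp (real N * ?P' + d))" using that(2) by (rule mult_left_mono)
    also have "\<dots> \<le> exp (real N * ?P + c) * (2 * exp (real N * ?P' + d))" using that(1) by (intro mult_right_mono) auto
    also have "\<dots> = exp (real N * ?P + c + (ln 2 + (real N * ?P' + d)))"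
      by (simp only: exp_add e2)
    also have "\<dots> \<le> exp (real N * \<gamma> + C)"
      unfolding exp_le_cancel_iff \<gamma> using that(4) by linarith
    finally show ?thesis .
  qed
  have lower: "exp (real N * \<gamma> - C) \<le> y * x"
    if "exp (real N * ?P - c) \<le> x" "exp (real N * ?P' - d) \<le> y / 2" "\<bar>c\<bar> + \<bar>d\<bar> + ln 2 \<le> C" for x y c d N
  proof -
    have "exp (real N * \<gamma> - C) \<le> exp (real N * ?P' - d + (real N * ?P - c))"
      unfolding exp_le_cancel_iff \<gamma> using that(3) ln2 by linarith
    also have "\<dots> \<le> y / 2 * x"
      unfolding exp_add using that(1,2) order_trans[OF exp_ge_zero that(2)] by (intro mult_mono) simp_all
    also have "\<dots> \<le> y * x"
    proof -
      have "0 \<le> y / 2" "0 \<le> x"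
        using order_trans[OF exp_ge_zero that(1)] order_trans[OF exp_ge_zero that(2)] by simp_all
      then show ?thesis by (intro mult_right_mono) auto
    qed
    finally show ?thesis .
  qed
  show ?thesis
  proof (intro exI[of _ C] allI impI conjI)
    fix N :: nat assume N: "N > 0"
    let ?r = "real \<rho> ^ N"
    have r: "0 < ?r" using \<rho> by simp
    have "exp (real N * \<gamma> - C) \<le> m ?r * (S (2 * ?r) - S ?r)"
      using c1[OF N] d0[OF N] by (intro lower) (auto simp: C_def)
    also have "\<dots> \<le> q (2 * ?r)" using q_ge_right[of ?r "2 * ?r"] q_nonneg[of ?r] r by simp
    finally show "exp (real N * \<gamma> - C) \<le> q (2 * ?r)" .
    have "exp (real N * \<gamma> - C) \<le> (- m (- ?r)) * (S (- ?r) - S (- 2 * ?r))"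
      using c3[OF N] d2[OF N] by (intro lower) (auto simp: C_def)
    also have "\<dots> \<le> q (- 2 * ?r)" using q_ge_left[of "- 2 * ?r" "- ?r"] q_nonneg[of "- ?r"] r by simp
    finally show "exp (real N * \<gamma> - C) \<le> q (- 2 * ?r)" .
    have "q ?r \<le> S ?r * m ?r" by (rule q_le_product)
    also have "\<dots> \<le> exp (real N * \<gamma> + C)"
      using c0[OF N] d0[OF N] by (intro upper) (auto simp: C_def intro: order_trans[OF exp_ge_zero])
    finally show "q ?r \<le> exp (real N * \<gamma> + C)" .
    have "q (- ?r) \<le> (- S (- ?r)) * (- m (- ?r))" using q_le_product[of "- ?r"] by simp
    also have "\<dots> \<le> exp (real N * \<gamma> + C)"
      using c2[OF N] d2[OF N] S_strict_mono[of "- ?r" 0] S0 r by (intro upper) (auto simp: C_def)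
    finally show "q (- ?r) \<le> exp (real N * \<gamma> + C)" .
  qed
qed

end

end

section \<open>From the scales \<rho>^N to arbitrary radii\<close>

theorem theorem2p6:
  fixes \<rho> :: nat
    and U V :: "real \<Rightarrow> real"
    and M :: "'w measure"
    and W y :: "real \<Rightarrow> 'w \<Rightarrow> real"
  assumes "\<rho> \<ge> 2"
    and "smooth_torus U"
    and "U 0 = 0"
    and "torus_D U < 1"
    and "V = self_similar_potential \<rho> U"
    and "brownian_motion M W"
    and "sde_solution M W (\<lambda>x. - deriv V x) 0 y"
  shows "\<exists>\<nu> \<epsilon> :: real \<Rightarrow> real.
           (\<forall>r>1. (\<integral>\<^sup>+w. exit_time y {-r<..<r} w \<partial>M) = ennreal (r powr (2 + \<nu> r))) \<and>
           (\<forall>r>1. \<nu> r = (pressure \<rho> (\<lambda>x. 2 * U x) + pressure \<rho> (\<lambda>x. - 2 * U x)) / ln (real \<rho>)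
                         + \<epsilon> r) \<and>
           (\<epsilon> \<longlongrightarrow> 0) at_top"
proof -
  note \<rho> = assms(1)
  obtain V2 L where dV: "\<And>x. (V has_real_derivative deriv V x) (at x)"
    and dV1: "\<And>x. (deriv V has_real_derivative V2 x) (at x)" and V2: "\<And>x. \<bar>V2 x\<bar> \<le> L"
    using self_similar_potential_derivatives(1)[OF assms(1-3)] unfolding assms(5)[symmetric] by blast
  have contV: "continuous_on UNIV V"
    by (intro continuous_at_imp_continuous_on ballI DERIV_isCont[OF dV])
  have "continuous_on UNIV (\<lambda>x. 2 * exp (- 2 * V x))" "continuous_on UNIV (\<lambda>x. exp (2 * V x))"
    by (intro continuous_intros contV)+
  from this[THEN real_antiderivative] obtain m S where
    m: "m 0 = 0" "\<And>x. (m has_real_derivative 2 * exp (- 2 * V x)) (at x)" and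
    S: "S 0 = 0" "\<And>x. (S has_real_derivative exp (2 * V x)) (at x)" by blast
  have "continuous_on UNIV m"
    by (intro continuous_at_imp_continuous_on ballI DERIV_isCont[OF m(2)])
  then have "continuous_on UNIV (\<lambda>x. exp (2 * V x) * m x)"
    by (intro continuous_intros contV)
  from real_antiderivative[OF this] obtain q where
    q: "q 0 = 0" "\<And>x. (q has_real_derivative exp (2 * V x) * m x) (at x)" by blast
  interpret potential V "deriv V" V2 m q L
    by unfold_locales (rule dV dV1 V2 m q)+
  interpret prob_space M using assms(6) by (simp add: brownian_motion_def)
  have lip: "\<bar>- deriv V u - - deriv V v\<bar> \<le> L * \<bar>u - v\<bar>" for u v
    using V1_lipschitz[of u v] by simp
  interpret gradient_sde V "deriv V" V2 m q L M W y
    by unfold_locales (rule assms lip)+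
  let ?P = "pressure \<rho> (\<lambda>x. 2 * U x) + pressure \<rho> (\<lambda>x. - 2 * U x)"
  define \<gamma> where "\<gamma> = 2 * ln (real \<rho>) + ?P"
  obtain C where C: "\<And>N. N > 0 \<Longrightarrow> exp (real N * \<gamma> - C) \<le> q (2 * real \<rho> ^ N)"
      "\<And>N. N > 0 \<Longrightarrow> exp (real N * \<gamma> - C) \<le> q (- 2 * real \<rho> ^ N)"
      "\<And>N. N > 0 \<Longrightarrow> q (real \<rho> ^ N) \<le> exp (real N * \<gamma> + C)"
      "\<And>N. N > 0 \<Longrightarrow> q (- (real \<rho> ^ N)) \<le> exp (real N * \<gamma> + C)"
    using q_growth[OF S(2,1) assms(1-3,5)] unfolding \<gamma>_def by blast
  define T where "T r = (\<integral>\<^sup>+w. exit_time y {-r<..<r} w \<partial>M)" for r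
  \<comment> \<open>\<open>enn2real\<close> sends infinity to 0; the upper bound on T r rules this
    case out.\<close>
  define E where "E r = enn2real (T r)" for r
  have T_E: "T r = ennreal (E r)" and E_le: "E r \<le> max (q (r + 2)) (q (- (r + 2)))" if "0 < r" for r
  proof -
    have "T r \<le> ennreal (max (q (r + 2)) (q (- (r + 2))))"
      unfolding T_def using that by (rule exit_time_upper)
    then show "T r = ennreal (E r)" "E r \<le> max (q (r + 2)) (q (- (r + 2)))"
      unfolding E_def using q_nonneg[of "r + 2"]
      by (auto simp: enn2real_leI max_def intro!: ennreal_enn2real[symmetric] le_less_trans[OF _ ennreal_less_top])
  qed
  have E_ge: "min (q r1) (q (- r1)) \<le> E r" if "0 < r1" "r1 < r" for r1 r
  proof -
    have "ennreal (min (q r1) (q (- r1))) \<le> ennreal (E r)"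
      using exit_time_lower[OF that] T_E[of r] that unfolding T_def by simp
    then show ?thesis by (subst (asm) ennreal_le_iff) (simp_all add: E_def)
  qed
  have E_pos: "0 < E r" if "1 < r" for r
  proof -
    have "0 < min (q (r / 2)) (q (- (r / 2)))" using q_pos[OF S(2,1)] that by simp
    also have "\<dots> \<le> E r" using that by (intro E_ge) auto
    finally show ?thesis .
  qed
  \<comment> \<open>Forced by T r = r^(2 + \<nu> r) for r > 1, where ln r is positive.\<close>
  define \<nu> where "\<nu> r = ln (E r) / ln r - 2" for r
  define \<epsilon> where "\<epsilon> r = \<nu> r - ?P / ln (real \<rho>)" for r
  have ln\<rho>: "0 < ln (real \<rho>)" using \<rho> by simp
  \<comment> \<open>C comes from \<open>q_growth\<close>, two |\<gamma>| from moving the scale by 2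
    in either direction, one from rounding the logarithm of r down to N.\<close>
  define K where "K = C + 3 * \<bar>\<gamma>\<bar>"
  \<comment> \<open>The bound r \<ge> \<rho>^3 gives N \<ge> 3, so that \<open>q_growth\<close>
    applies at N - 2 > 0.\<close>
  have main: "\<bar>\<epsilon> r\<bar> \<le> K / ln r" if r: "real \<rho> ^ 3 \<le> r" for r
  proof -
    have "1 < real \<rho> ^ 3" using \<rho> by (intro one_less_power) auto
    then have r1: "1 < r" using r by simp
    define N where "N = nat \<lfloor>log (real \<rho>) r\<rfloor>"
    have "3 \<le> log (real \<rho>) r"
      using r r1 \<rho> by (subst le_log_iff) (auto simp: powr_realpow)
    then have N3: "3 \<le> N" and NN: "real N \<le> log (real \<rho>) r" "log (real \<rho>) r < real N + 1"
      unfolding N_def by linarith+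
    have Nr: "real \<rho> ^ N \<le> r" "r < real \<rho> ^ Suc N"
    proof -
      show "real \<rho> ^ N \<le> r" using NN(1) r1 \<rho> by (subst (asm) le_log_iff) (auto simp: powr_realpow)
      have "r < real \<rho> powr (real N + 1)" using NN(2) r1 \<rho> by (subst (asm) log_less_iff) auto
      also have "\<dots> = real \<rho> ^ Suc N" using \<rho> by (simp add: powr_add powr_realpow)
      finally show "r < real \<rho> ^ Suc N" .
    qed
    have lnr: "real N * ln (real \<rho>) \<le> ln r" "ln r \<le> real N * ln (real \<rho>) + ln (real \<rho>)"
      using NN ln\<rho> by (simp_all add: log_def field_simps)
    \<comment> \<open>The lower bound lives at twice a power of \<rho> and needs a strictly smaller
      radius; going down two levels suffices even for \<rho> = 2.\<close>
    have "2 * real \<rho> ^ (N - 2) < r"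
    proof -
      have pos: "0 < real \<rho> ^ (N - 2)" using \<rho> by simp
      have "2 * real \<rho> ^ (N - 2) < 2 * 2 * real \<rho> ^ (N - 2)" using pos by simp
      also have "\<dots> \<le> real \<rho> * real \<rho> * real \<rho> ^ (N - 2)"
        using \<rho> by (intro mult_right_mono mult_mono) auto
      also have "\<dots> = real \<rho> ^ (Suc (Suc (N - 2)))" by simp
      also have "Suc (Suc (N - 2)) = N" using N3 by simp
      finally show ?thesis using Nr by simp
    qed
    then have "min (q (2 * real \<rho> ^ (N - 2))) (q (- (2 * real \<rho> ^ (N - 2)))) \<le> E r"
      using \<rho> by (intro E_ge) auto
    then have "exp (real (N - 2) * \<gamma> - C) \<le> E r"
      using C(1)[of "N - 2"] C(2)[of "N - 2"] N3 by (auto simp: min_def split: if_splits)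
    then have low: "(real N - 2) * \<gamma> - C \<le> ln (E r)"
      using E_pos[OF r1] N3 by (simp add: ln_ge_iff of_nat_diff)
    \<comment> \<open>Since r may be close to \<rho>^(N+1), the 2 from
      \<open>exit_time_upper\<close> costs one more level.\<close>
    have "r + 2 \<le> real \<rho> ^ (N + 2)"
    proof -
      have "real \<rho> ^ 1 \<le> real \<rho> ^ Suc N" using \<rho> by (intro power_increasing) auto
      moreover have "2 \<le> real \<rho>" using \<rho> by simp
      ultimately have "2 \<le> real \<rho> ^ Suc N" by (simp only: power_one_right)
      then have "r + 2 \<le> 2 * real \<rho> ^ Suc N" using Nr by simp
      also have "\<dots> \<le> real \<rho> * real \<rho> ^ Suc N" using \<rho> by (intro mult_right_mono) auto
      finally show ?thesis by simp
    qed
    then have "q (r + 2) \<le> q (real \<rho> ^ (N + 2))" and "q (- (r + 2)) \<le> q (- (real \<rho> ^ (N + 2)))"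
      using r1 by (intro q_mono, simp_all, intro q_antimono, simp_all)
    then have "E r \<le> exp (real (N + 2) * \<gamma> + C)"
      using E_le[of r] r1 C(3)[of "N + 2"] C(4)[of "N + 2"] by (auto simp del: power_Suc)
    then have up: "ln (E r) \<le> (real N + 2) * \<gamma> + C"
      using E_pos[OF r1] by (subst (asm) ln_le_cancel_iff[symmetric]) (auto simp: add.commute)
    let ?\<delta> = "\<gamma> / ln (real \<rho>)"
    have "\<bar>ln (E r) - real N * \<gamma>\<bar> \<le> C + 2 * \<bar>\<gamma>\<bar>"
      using low up abs_ge_self[of \<gamma>] abs_ge_minus_self[of \<gamma>]
      unfolding left_diff_distrib distrib_right abs_le_iff by linarith
    moreover have "\<bar>real N * \<gamma> - ?\<delta> * ln r\<bar> \<le> \<bar>\<gamma>\<bar>"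
    proof -
      have "real N * \<gamma> - ?\<delta> * ln r = ?\<delta> * (real N * ln (real \<rho>) - ln r)"
        using ln\<rho> by (simp add: field_simps)
      then have "\<bar>real N * \<gamma> - ?\<delta> * ln r\<bar> = \<bar>?\<delta>\<bar> * \<bar>real N * ln (real \<rho>) - ln r\<bar>"
        by (simp only: abs_mult)
      also have "\<dots> \<le> \<bar>?\<delta>\<bar> * ln (real \<rho>)" using lnr by (intro mult_left_mono) auto
      also have "\<dots> = \<bar>\<gamma>\<bar>" using ln\<rho> by (simp add: abs_divide)
      finally show ?thesis .
    qed
    ultimately have "\<bar>ln (E r) - ?\<delta> * ln r\<bar> \<le> K" unfolding K_def by linarith
    moreover have "\<epsilon> r = (ln (E r) - ?\<delta> * ln r) / ln r"
      using ln\<rho> r1 by (simp add: \<epsilon>_def \<nu>_def \<gamma>_def field_simps)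
    ultimately show ?thesis using r1 by (simp add: abs_divide divide_right_mono)
  qed
  have "((\<lambda>r. K / ln r) \<longlongrightarrow> 0) at_top"
    by (rule real_tendsto_divide_at_top[OF tendsto_const ln_at_top])
  then have "(\<epsilon> \<longlongrightarrow> 0) at_top"
    by (rule Lim_null_comparison[rotated])
      (use main in \<open>auto simp: eventually_at_top_linorder intro!: exI[of _ "real \<rho> ^ 3"]\<close>)
  moreover have "T r = ennreal (r powr (2 + \<nu> r))" if r: "r > 1" for r
  proof -
    have "r powr (2 + \<nu> r) = exp (ln (E r))"
      using r by (simp add: powr_def \<nu>_def)
    then show ?thesis using T_E[of r] r E_pos[OF r] by simp
  qed
  moreover have "\<nu> r = ?P / ln (real \<rho>) + \<epsilon> r" for r by (simp add: \<epsilon>_def)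
  ultimately show ?thesis unfolding T_def by blast
qed

end
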